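(* Let $\mathfrak g$ be the Lie algebra attached to $(\mathfrak h,(\cdot,\cdot),\alpha_1,\dots,\alpha_R)$, $\sigma$ a diagram automorphism of order $T$, and $\Omega$ the skew-symmetric bilinear form (a cocycle) on $\mathfrak g^\sigma$ defined in the context. Let $\mathfrak g(B^\sigma)\subset\mathfrak g^\sigma$ be the Lie subalgebra generated by $\mathfrak h^\sigma$ and the projected generators $\bar E_i=\sum_{k=0}^{T-1}\sigma^kE_i$, $\bar F_i=\sum_{k=0}^{T-1}\sigma^kF_i$, $1\le i\le R$. If $\mathfrak g(B^\sigma)=\mathfrak g^\sigma$, then $\Omega=0$.
   Context: Lie algebra. $\mathfrak h$ is a finite-dimensional complex vector space with non-degenerate symmetric bilinear form $(\cdot,\cdot)$ (inducing a form on $\mathfrak h^*$), $\alpha_1,\dots,\alpha_R\in\mathfrak h^*$ linearly independent, $H_i\in\mathfrak h$ given by $\lambda(H_i)=(\alpha_i,\lambda)$. $\mathfrak g$ is generated by $\mathfrak h$ and $E_i,F_i$ ($1\le i\le R$) with relations $[E_i,F_j]=\delta_{ij}H_i$, $[H,E_i]=\alpha_i(H)E_i$, $[H,F_i]=-\alpha_i(H)F_i$, $[H,H']=0$. $\mathfrak n,\mathfrak n_+$ are the free subalgebras generated by the $F_i$, resp. $E_i$; $\mathfrak g=\mathfrak n\oplus\mathfrak h\oplus\mathfrak n_+$. $\varphi$ is the anti-automorphism $E_i\leftrightarrow F_i$, $H\mapsto H$. $\sigma$ is an automorphism of $\mathfrak g$ of finite order $T$, with $\sigma(\mathfrak h)=\mathfrak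 h$, preserving $(\cdot,\cdot)$ on $\mathfrak h$, and $\sigma(E_i)=E_{\sigma(i)}$, $\sigma(F_i)=F_{\sigma(i)}$, $\sigma(H_i)=H_{\sigma(i)}$ for a permutation $\sigma\in\Sigma_R$. $\omega$ is a primitive $T$-th root of unity, $\mathbb Z_T=\mathbb Z/T\mathbb Z$. $r$ is the number of cycles of the permutation, $\iota(i)$ a chosen element of the $i$-th cycle, $T_i$ its length. $\mathfrak n$ is $\mathbb Z^r_{\ge0}$-graded with $\sigma^kF_{\iota(i)}$ of degree $e_i$, $\mathfrak n_+$ likewise with $\sigma^kE_{\iota(i)}$. For a non-zero $\lambda\in\mathbb Z^r_{\ge0}$ put $m=\lambda_1+\dots+\lambda_r$, $i_n:=\lambda_1+\dots+\lambda_{i-1}+n$ ($1\le n\le\lambda_i$), $w_\lambda=\prod_{i=1}^r(T/T_i)^{\lambda_i}\lambda_i!$. Free Lie algebra. $\mathfrak a$ is free on $f^{(k)}_i$, $1\le i\le m$, $k\in\mathbb Z_T$; $\tau(f_i^{(k)})=f_i^{(k+1)}$; $\bar{\mathfrak a}=\mathfrak a^\tau$; $\bar g=\sum_{j\in\mathbb Z_T}\tau^jg$; $f_i=f_i^{(0)}$; $\mathbb Z^m_{\ge0}$-grading with $f^{(k)}_i$ of degree $e_i$; $[1^m]$ is degree $(1,\dots,1)$. The homomorphism $\jmath:\mathfrak n\to\mathfrak a$, $\jmath(\sigma^kF_{\iota(i)})=\sum_{l=0}^{T/T_i-1}\sum_{n=1}^{\lambda_i}f^{(k+T_il)}_{i_n}$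 ($0\le k<T_i$), satisfies $\jmath\sigma=\tau\jmath$; $s:\mathfrak n^\sigma_\lambda\to\bar{\mathfrak a}_{[1^m]}$ is $\jmath$ followed by projection to degree $[1^m]$. Arrangement $\mathcal C_{0;m}$ in $\mathbb C^m$: hyperplanes $t_i=\omega^kt_j$ ($i<j$, $k\in\mathbb Z_T$) and $t_i=0$, with weights $a(t_{i_n}=\omega^kt_{i'_{n'}})=(\alpha_{\iota(i)},\alpha_{\sigma^k(\iota(i'))})$ and $a(t_i=0)=0$. Edges are non-empty intersections of hyperplanes ($\mathbb C^m$ included). $\mathcal F^p$ is the complex space generated by flags $\mathbb C^m=L^0\supset\dots\supset L^p$ of edges, $\operatorname{codim}L^j=j$, modulo: for each $0<i<p$ and each chain with the $i$-th edge missing, the sum of all completing flags is $0$. For a flag $F$ and hyperplanes $H_1,\dots,H_p$, $\langle F,H_1\wedge\dots\wedge H_p\rangle=(-1)^{|s|}$ if $L^i=H_{s(1)}\cap\dots\cap H_{s(i)}$ for all $i$ for some (unique) $s\in\Sigma_p$, else $0$; this is well defined on $\mathcal F^p$. $G^p(F,F')=\sum\langle F,H_1\wedge\dots\wedge H_p\rangle\langle F',H_1\wedge\dots\wedge H_p\rangle a(H_1)\cdots a(H_p)$ over unordered $p$-tuples. Maps $\psi_p:(\bigwedge^p\bar{\mathfrak a}\otimes U(\bar{\mathfrak a}))_{[1^m]}\to\mathcal F^{m-p}(\mathcal C_{0;m})$. A commutator is a generator or a bracket of two commutators. For a commutator $g$ with generators $f^{(k_1)}_{i_1},\dots,f^{(k_l)}_{i_l}$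 let $L_g:\omega^{k_1}t_{i_1}=\dots=\omega^{k_l}t_{i_l}$ and $L_g^0:t_{i_1}=\dots=t_{i_l}=0$. The $\psi_p$ are the linear maps determined by $\psi_m(\bar f_1\wedge\dots\wedge\bar f_m\otimes1)=(L^0=\mathbb C^m)$ and: whenever $g_i$ are commutators, $x_0$ is a product of elements $\bar g$ ($g$ commutators) and $\psi_{p+1}(\bar g_{p+1}\wedge\dots\wedge\bar g_1\otimes x_0)=\pm(L^0\supset\dots\supset L^q)$, $q=m-p-1$, then with the same sign $\psi_p(\bar g_{p+1}\wedge\dots\wedge\bar g_2\otimes\bar g_1x_0)=\pm(\dots\supset L^q\supset L^q\cap L^0_{g_1})$ and $\psi_p(\bar g_{p+1}\wedge\dots\wedge\bar g_3\wedge\overline{[g_1,g_2]}\otimes x_0)=\pm(\dots\supset L^q\supset L^q\cap L_{[g_1,g_2]})$. The form $\Omega$. $\Omega$ is the skew-symmetric bilinear form on $\mathfrak g^\sigma$ with $\Omega(\varphi(x),y)=-\Omega(y,\varphi(x))=\frac{(-1)^m}{w_\lambda}\,G^m\big(\psi_0(s(x)),\psi_0(s(y))\big)$ for $x,y\in\mathfrak n^\sigma_\lambda$, $\lambda\ne0$ (where $s(x),s(y)\in\bar{\mathfrak a}_{[1^m]}\subset U(\bar{\mathfrak a})_{[1^m]}$), and $\Omega=0$ on all other pairs of components of the decomposition $\mathfrak g^\sigma=\bigoplus_\lambda\mathfrak n^\sigma_\lambda\oplus\mathfrak h^\sigma\oplus\bigoplus_\lambda(\mathfrak n^\sigma_+)_\lambda$.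 *)

theory Defs
  imports Complex_Main "HOL-Library.Poly_Mapping" "HOL-Library.Multiset"
    "HOL-Combinatorics.Permutations" "HOL-Combinatorics.Orbits"
begin

section \<open>Complex vector spaces and Lie algebras\<close>

class complex_vector = ab_group_add +
  fixes scaleC :: "complex \<Rightarrow> 'a \<Rightarrow> 'a"  (infixr \<open>*\<^sub>C\<close> 75)
  assumes scaleC_add_right: "a *\<^sub>C (x + y) = a *\<^sub>C x + a *\<^sub>C y"
    and scaleC_add_left: "(a + b) *\<^sub>C x = a *\<^sub>C x + b *\<^sub>C x"
    and scaleC_scaleC: "a *\<^sub>C b *\<^sub>C x = (a * b) *\<^sub>C x"
    and scaleC_one: "1 *\<^sub>C x = x"

global_interpretation cvec: vector_space "scaleC :: complex \<Rightarrow> 'a \<Rightarrow> 'a::complex_vector"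
  by unfold_locales
    (simp_all add: scaleC_add_right scaleC_add_left scaleC_scaleC scaleC_one)

abbreviation clinear :: "('a::complex_vector \<Rightarrow> 'b::complex_vector) \<Rightarrow> bool" where
  "clinear \<equiv> Vector_Spaces.linear scaleC scaleC"

class lie_algebra = complex_vector +
  fixes bracket :: "'a \<Rightarrow> 'a \<Rightarrow> 'a"
  assumes bracket_add_left: "bracket (x + y) z = bracket x z + bracket y z"
    and bracket_add_right: "bracket x (y + z) = bracket x y + bracket x z"
    and bracket_scale_left: "bracket (c *\<^sub>C x) y = c *\<^sub>C bracket x y"
    and bracket_scale_right: "bracket x (c *\<^sub>C y) = c *\<^sub>C bracket x y"
    and bracket_self: "bracket x x = 0"
    and jacobi: "bracket x (bracket y z) + bracket y (bracket z x) + bracket z (bracket x y) = 0"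

instantiation complex :: complex_vector
begin
definition scaleC_complex :: "complex \<Rightarrow> complex \<Rightarrow> complex" where
  "scaleC_complex = (*)"
instance by standard (simp_all add: scaleC_complex_def algebra_simps)
end

instantiation poly_mapping :: (type, complex_vector) complex_vector
begin
lift_definition scaleC_poly_mapping :: "complex \<Rightarrow> ('a \<Rightarrow>\<^sub>0 'b) \<Rightarrow> ('a \<Rightarrow>\<^sub>0 'b)"
  is "\<lambda>c f x. c *\<^sub>C f x"
  by (rule finite_subset[rotated]) (auto simp: cvec.scale_zero_right)
instance
  by standard (transfer; simp add: fun_eq_iff scaleC_add_right scaleC_add_left
      scaleC_scaleC scaleC_one)+
end

definition lie_subalgebra :: "'g::lie_algebra set \<Rightarrow> bool" where
  "lie_subalgebra A \<longleftrightarrow> cvec.subspace A \<and> (\<forall>x\<in>A. \<forall>y\<in>A. bracket x y \<in> A)"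

definition lie_ideal :: "'g::lie_algebra set \<Rightarrow> bool" where
  "lie_ideal I \<longleftrightarrow> cvec.subspace I \<and> (\<forall>x. \<forall>y\<in>I. bracket x y \<in> I)"

definition subalgebra_generated :: "'g::lie_algebra set \<Rightarrow> 'g set" where
  "subalgebra_generated S = \<Inter>{A. lie_subalgebra A \<and> S \<subseteq> A}"

definition ideal_generated :: "'g::lie_algebra set \<Rightarrow> 'g set" where
  "ideal_generated S = \<Inter>{I. lie_ideal I \<and> S \<subseteq> I}"

definition lie_hom_on :: "'g::lie_algebra set \<Rightarrow> ('g \<Rightarrow> 'l::lie_algebra) \<Rightarrow> bool" where
  "lie_hom_on A f \<longleftrightarrow>
     (\<forall>x\<in>A. \<forall>y\<in>A. f (x + y) = f x + f y \<and> f (bracket x y) = bracket (f x) (f y)) \<and>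
     (\<forall>c. \<forall>x\<in>A. f (c *\<^sub>C x) = c *\<^sub>C f x)"

definition lie_automorphism :: "('g::lie_algebra \<Rightarrow> 'g) \<Rightarrow> bool" where
  "lie_automorphism f \<longleftrightarrow> lie_hom_on UNIV f \<and> bij f"

definition fixed_points :: "('a \<Rightarrow> 'a) \<Rightarrow> 'a set" where
  "fixed_points f = {x. f x = x}"

text \<open>The sum of the first \<open>n\<close> iterates, written \<open>x\<close> with a bar when \<open>f\<close> has order \<open>n\<close>.\<close>

definition bar :: "nat \<Rightarrow> ('a \<Rightarrow> 'a) \<Rightarrow> 'a \<Rightarrow> 'a::comm_monoid_add" where
  "bar n f x = (\<Sum>k<n. (f ^^ k) x)"


section \<open>Free Lie algebras and presentations\<close>

datatype 'x lie_term =
    TGen 'x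
  | TZero
  | TNeg "'x lie_term"
  | TAdd "'x lie_term" "'x lie_term"
  | TScale complex "'x lie_term"
  | TBr "'x lie_term" "'x lie_term"

text \<open>The least congruence for which the quotient of the terms is a complex Lie algebra.\<close>

inductive lie_eq :: "'x lie_term \<Rightarrow> 'x lie_term \<Rightarrow> bool" where
  refl: "lie_eq s s"
| sym: "lie_eq s t \<Longrightarrow> lie_eq t s"
| trans: "lie_eq s t \<Longrightarrow> lie_eq t u \<Longrightarrow> lie_eq s u"
| neg: "lie_eq s s' \<Longrightarrow> lie_eq (TNeg s) (TNeg s')"
| add: "lie_eq s s' \<Longrightarrow> lie_eq t t' \<Longrightarrow> lie_eq (TAdd s t) (TAdd s' t')"
| scale: "lie_eq s s' \<Longrightarrow> lie_eq (TScale c s) (TScale c s')"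
| br: "lie_eq s s' \<Longrightarrow> lie_eq t t' \<Longrightarrow> lie_eq (TBr s t) (TBr s' t')"
| add_assoc: "lie_eq (TAdd (TAdd s t) u) (TAdd s (TAdd t u))"
| add_commute: "lie_eq (TAdd s t) (TAdd t s)"
| add_zero: "lie_eq (TAdd TZero s) s"
| add_neg: "lie_eq (TAdd (TNeg s) s) TZero"
| scale_add_right: "lie_eq (TScale c (TAdd s t)) (TAdd (TScale c s) (TScale c t))"
| scale_add_left: "lie_eq (TScale (c + d) s) (TAdd (TScale c s) (TScale d s))"
| scale_scale: "lie_eq (TScale c (TScale d s)) (TScale (c * d) s)"
| scale_one: "lie_eq (TScale 1 s) s"
| br_add_left: "lie_eq (TBr (TAdd s t) u) (TAdd (TBr s u) (TBr t u))"
| br_add_right: "lie_eq (TBr s (TAdd t u)) (TAdd (TBr s t) (TBr s u))"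
| br_scale_left: "lie_eq (TBr (TScale c s) t) (TScale c (TBr s t))"
| br_scale_right: "lie_eq (TBr s (TScale c t)) (TScale c (TBr s t))"
| br_self: "lie_eq (TBr s s) TZero"
| br_jacobi: "lie_eq (TAdd (TAdd (TBr s (TBr t u)) (TBr t (TBr u s))) (TBr u (TBr s t))) TZero"

quotient_type 'x free_lie = "'x lie_term" / lie_eq
  by (intro equivpI reflpI sympI transpI) (erule (1) lie_eq.trans | erule lie_eq.sym | rule lie_eq.refl)+

instantiation free_lie :: (type) lie_algebra
begin

lift_definition zero_free_lie :: "'a free_lie" is TZero .
lift_definition uminus_free_lie :: "'a free_lie \<Rightarrow> 'a free_lie" is TNeg
  by (rule lie_eq.neg)
lift_definition plus_free_lie :: "'a free_lie \<Rightarrow> 'a free_lie \<Rightarrow> 'a free_lie" is TAdd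
  by (rule lie_eq.add)
definition minus_free_lie :: "'a free_lie \<Rightarrow> 'a free_lie \<Rightarrow> 'a free_lie" where
  "minus_free_lie x y = x + - y"
lift_definition scaleC_free_lie :: "complex \<Rightarrow> 'a free_lie \<Rightarrow> 'a free_lie" is TScale
  by (rule lie_eq.scale)
lift_definition bracket_free_lie :: "'a free_lie \<Rightarrow> 'a free_lie \<Rightarrow> 'a free_lie" is TBr
  by (rule lie_eq.br)

instance
proof
  fix x y z :: "'a free_lie" and c d :: complex
  show "x + y + z = x + (y + z)" by transfer (rule lie_eq.add_assoc)
  show "x + y = y + x" by transfer (rule lie_eq.add_commute)
  show "0 + x = x" by transfer (rule lie_eq.add_zero)
  show "- x + x = 0" by transfer (rule lie_eq.add_neg)
  show "x - y = x + - y" by (rule minus_free_lie_def)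
  show "c *\<^sub>C (x + y) = c *\<^sub>C x + c *\<^sub>C y" by transfer (rule lie_eq.scale_add_right)
  show "(c + d) *\<^sub>C x = c *\<^sub>C x + d *\<^sub>C x" by transfer (rule lie_eq.scale_add_left)
  show "c *\<^sub>C d *\<^sub>C x = (c * d) *\<^sub>C x" by transfer (rule lie_eq.scale_scale)
  show "1 *\<^sub>C x = x" by transfer (rule lie_eq.scale_one)
  show "bracket (x + y) z = bracket x z + bracket y z" by transfer (rule lie_eq.br_add_left)
  show "bracket x (y + z) = bracket x y + bracket x z" by transfer (rule lie_eq.br_add_right)
  show "bracket (c *\<^sub>C x) y = c *\<^sub>C bracket x y" by transfer (rule lie_eq.br_scale_left)
  show "bracket x (c *\<^sub>C y) = c *\<^sub>C bracket x y" by transfer (rule lie_eq.br_scale_right)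
  show "bracket x x = 0" by transfer (rule lie_eq.br_self)
  show "bracket x (bracket y z) + bracket y (bracket z x) + bracket z (bracket x y) = 0"
    by transfer (rule lie_eq.br_jacobi)
qed

end

lift_definition free_gen :: "'x \<Rightarrow> 'x free_lie" is TGen .

primrec lie_eval :: "('x \<Rightarrow> 'l::lie_algebra) \<Rightarrow> 'x lie_term \<Rightarrow> 'l" where
  "lie_eval f (TGen x) = f x"
| "lie_eval f TZero = 0"
| "lie_eval f (TNeg s) = - lie_eval f s"
| "lie_eval f (TAdd s t) = lie_eval f s + lie_eval f t"
| "lie_eval f (TScale c s) = c *\<^sub>C lie_eval f s"
| "lie_eval f (TBr s t) = bracket (lie_eval f s) (lie_eval f t)"

lemma lie_eval_cong: "lie_eq s t \<Longrightarrow> lie_eval f s = lie_eval f t"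
proof (induction rule: lie_eq.induct)
  case add_assoc
  show ?case unfolding lie_eval.simps by (rule add.assoc)
next
  case add_commute
  show ?case unfolding lie_eval.simps by (rule add.commute)
next
  case add_zero
  show ?case unfolding lie_eval.simps by (rule add_0_left)
next
  case add_neg
  show ?case unfolding lie_eval.simps by (rule left_minus)
next
  case scale_add_right
  show ?case unfolding lie_eval.simps by (rule scaleC_add_right)
next
  case scale_add_left
  show ?case unfolding lie_eval.simps by (rule scaleC_add_left)
next
  case scale_scale
  show ?case unfolding lie_eval.simps by (rule scaleC_scaleC)
next
  case scale_one
  show ?case unfolding lie_eval.simps by (rule scaleC_one)
next
  case br_add_left
  show ?case unfolding lie_eval.simps by (rule bracket_add_left)
next
  case br_add_right
  show ?case unfolding lie_eval.simps by (rule bracket_add_right)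
next
  case br_scale_left
  show ?case unfolding lie_eval.simps by (rule bracket_scale_left)
next
  case br_scale_right
  show ?case unfolding lie_eval.simps by (rule bracket_scale_right)
next
  case br_self
  show ?case unfolding lie_eval.simps by (rule bracket_self)
next
  case br_jacobi
  show ?case unfolding lie_eval.simps by (rule jacobi)
qed (simp_all only: lie_eval.simps)

lift_definition lie_extend :: "('x \<Rightarrow> 'l::lie_algebra) \<Rightarrow> 'x free_lie \<Rightarrow> 'l" is lie_eval
  by (rule lie_eval_cong)

lemma lie_extend_gen: "lie_extend f (free_gen x) = f x"
  by transfer simp

lemma lie_extend_hom: "lie_hom_on UNIV (lie_extend f)"
proof -
  have "lie_extend f (x + y) = lie_extend f x + lie_extend f y" for x y
    by transfer (rule lie_eval.simps)
  moreover have "lie_extend f (bracket x y) = bracket (lie_extend f x) (lie_extend f y)" for x y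
    by transfer (rule lie_eval.simps)
  moreover have "lie_extend f (c *\<^sub>C x) = c *\<^sub>C lie_extend f x" for c x
    by transfer (rule lie_eval.simps)
  ultimately show ?thesis by (simp add: lie_hom_on_def)
qed

text \<open>The elements \<open>f x\<close> and the relators \<open>R\<close> (elements of the free Lie algebra on the
  generating symbols, to be equated with \<open>0\<close>) present the whole Lie algebra.\<close>

definition lie_presentation :: "('x \<Rightarrow> 'l::lie_algebra) \<Rightarrow> 'x free_lie set \<Rightarrow> bool" where
  "lie_presentation f R \<longleftrightarrow>
     surj (lie_extend f) \<and> {x. lie_extend f x = 0} = ideal_generated R"

datatype 'x commutator = Leaf 'x | Comm "'x commutator" "'x commutator"

primrec letters :: "'x commutator \<Rightarrow> 'x list" where
  "letters (Leaf x) = [x]"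
| "letters (Comm a b) = letters a @ letters b"

primrec comm_eval :: "('x \<Rightarrow> 'l::lie_algebra) \<Rightarrow> 'x commutator \<Rightarrow> 'l" where
  "comm_eval f (Leaf x) = f x"
| "comm_eval f (Comm a b) = bracket (comm_eval f a) (comm_eval f b)"


section \<open>The Lie algebra and its diagram automorphism\<close>

definition bilinear_form :: "('h::complex_vector \<Rightarrow> 'h \<Rightarrow> complex) \<Rightarrow> bool" where
  "bilinear_form B \<longleftrightarrow> (\<forall>x. clinear (B x)) \<and> (\<forall>y. clinear (\<lambda>x. B x y))"

text \<open>A form on \<open>\<hh>\<close> is transported to the dual space along
  the isomorphism taking \<open>x\<close> to \<open>B x\<close>.\<close>

definition dual_vector :: "('h \<Rightarrow> 'h \<Rightarrow> complex) \<Rightarrow> ('h \<Rightarrow> complex) \<Rightarrow> 'h" where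
  "dual_vector B f = (THE x. B x = f)"

definition dual_form :: "('h \<Rightarrow> 'h \<Rightarrow> complex) \<Rightarrow> ('h \<Rightarrow> complex) \<Rightarrow> ('h \<Rightarrow> complex) \<Rightarrow> complex" where
  "dual_form B f g = B (dual_vector B f) (dual_vector B g)"

definition cartan_data ::
  "('h::complex_vector \<Rightarrow> 'h \<Rightarrow> complex) \<Rightarrow> ('i::finite \<Rightarrow> 'h \<Rightarrow> complex) \<Rightarrow> ('i \<Rightarrow> 'h) \<Rightarrow> bool" where
  "cartan_data B \<alpha> Hc \<longleftrightarrow>
     (\<exists>S. finite S \<and> cvec.span S = (UNIV :: 'h set)) \<and>
     bilinear_form B \<and> (\<forall>x y. B x y = B y x) \<and> (\<forall>x. (\<forall>y. B x y = 0) \<longrightarrow> x = 0) \<and>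
     (\<forall>i. clinear (\<alpha> i)) \<and>
     (\<forall>c. (\<forall>x. (\<Sum>i\<in>UNIV. c i * \<alpha> i x) = 0) \<longrightarrow> (\<forall>i. c i = 0)) \<and>
     (\<forall>i f. clinear f \<longrightarrow> f (Hc i) = dual_form B (\<alpha> i) f)"

datatype ('h, 'i) gsym = HSym 'h | ESym 'i | FSym 'i

text \<open>The first two families of relators express that \<open>\<hh>\<close> enters as a vector space.\<close>

definition g_relators ::
  "('i \<Rightarrow> 'h::complex_vector \<Rightarrow> complex) \<Rightarrow> ('i \<Rightarrow> 'h) \<Rightarrow> ('h, 'i) gsym free_lie set" where
  "g_relators \<alpha> Hc =
     {free_gen (HSym (x + y)) - (free_gen (HSym x) + free_gen (HSym y)) | x y. True} \<union>
     {free_gen (HSym (c *\<^sub>C x)) - c *\<^sub>C free_gen (HSym x) | c x. True} \<union>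
     {bracket (free_gen (ESym i)) (free_gen (FSym j))
        - (if i = j then free_gen (HSym (Hc i)) else 0) | i j. True} \<union>
     {bracket (free_gen (HSym x)) (free_gen (ESym i)) - \<alpha> i x *\<^sub>C free_gen (ESym i) | x i. True} \<union>
     {bracket (free_gen (HSym x)) (free_gen (FSym i)) + \<alpha> i x *\<^sub>C free_gen (FSym i) | x i. True} \<union>
     {bracket (free_gen (HSym x)) (free_gen (HSym y)) | x y. True}"

text \<open>\<open>hh\<close> is the canonical map from \<open>\<hh>\<close> to the presented Lie algebra.\<close>

definition g_presentation ::
  "('i \<Rightarrow> 'h::complex_vector \<Rightarrow> complex) \<Rightarrow> ('i \<Rightarrow> 'h) \<Rightarrow>
   ('h \<Rightarrow> 'g::lie_algebra) \<Rightarrow> ('i \<Rightarrow> 'g) \<Rightarrow> ('i \<Rightarrow> 'g) \<Rightarrow> bool" where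
  "g_presentation \<alpha> Hc hh E F \<longleftrightarrow>
     lie_presentation (case_gsym hh E F) (g_relators \<alpha> Hc)"

definition chevalley_anti_automorphism ::
  "('h \<Rightarrow> 'g::lie_algebra) \<Rightarrow> ('i \<Rightarrow> 'g) \<Rightarrow> ('i \<Rightarrow> 'g) \<Rightarrow> ('g \<Rightarrow> 'g) \<Rightarrow> bool" where
  "chevalley_anti_automorphism hh E F \<phi> \<longleftrightarrow>
     clinear \<phi> \<and> bij \<phi> \<and> (\<forall>x y. \<phi> (bracket x y) = bracket (\<phi> y) (\<phi> x)) \<and>
     (\<forall>i. \<phi> (E i) = F i \<and> \<phi> (F i) = E i) \<and> (\<forall>x. \<phi> (hh x) = hh x)"

definition diagram_automorphism ::
  "('h \<Rightarrow> 'h \<Rightarrow> complex) \<Rightarrow> ('i \<Rightarrow> 'h) \<Rightarrow> ('h \<Rightarrow> 'g::lie_algebra) \<Rightarrow> ('i \<Rightarrow> 'g) \<Rightarrow> ('i \<Rightarrow> 'g) \<Rightarrow>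
   nat \<Rightarrow> ('g \<Rightarrow> 'g) \<Rightarrow> ('i \<Rightarrow> 'i) \<Rightarrow> bool" where
  "diagram_automorphism B Hc hh E F T \<sigma> \<pi> \<longleftrightarrow>
     lie_automorphism \<sigma> \<and>
     0 < T \<and> \<sigma> ^^ T = id \<and> (\<forall>k. 0 < k \<and> k < T \<longrightarrow> \<sigma> ^^ k \<noteq> id) \<and>
     \<sigma> ` range hh = range hh \<and>
     (\<forall>x y x' y'. \<sigma> (hh x) = hh x' \<and> \<sigma> (hh y) = hh y' \<longrightarrow> B x' y' = B x y) \<and>
     bij \<pi> \<and>
     (\<forall>i. \<sigma> (E i) = E (\<pi> i) \<and> \<sigma> (F i) = F (\<pi> i) \<and> \<sigma> (hh (Hc i)) = hh (Hc (\<pi> i)))"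

definition primitive_root :: "nat \<Rightarrow> complex \<Rightarrow> bool" where
  "primitive_root T \<omega> \<longleftrightarrow> 0 < T \<and> \<omega> ^ T = 1 \<and> (\<forall>k. 0 < k \<and> k < T \<longrightarrow> \<omega> ^ k \<noteq> 1)"

definition num_cycles :: "('i \<Rightarrow> 'i) \<Rightarrow> nat" where
  "num_cycles \<pi> = card (range (orbit \<pi>))"

definition cycle_representatives :: "('i \<Rightarrow> 'i) \<Rightarrow> (nat \<Rightarrow> 'i) \<Rightarrow> bool" where
  "cycle_representatives \<pi> \<iota> \<longleftrightarrow>
     bij_betw (\<lambda>i. orbit \<pi> (\<iota> i)) {1..num_cycles \<pi>} (range (orbit \<pi>))"

definition cycle_length :: "('i \<Rightarrow> 'i) \<Rightarrow> (nat \<Rightarrow> 'i) \<Rightarrow> nat \<Rightarrow> nat" where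
  "cycle_length \<pi> \<iota> i = card (orbit \<pi> (\<iota> i))"

text \<open>Non-zero multidegrees, with coordinates numbered \<open>1, \<dots>, r\<close>.\<close>

definition multidegrees :: "nat \<Rightarrow> (nat \<Rightarrow> nat) set" where
  "multidegrees r = {d. (\<forall>i. i \<notin> {1..r} \<longrightarrow> d i = 0) \<and> (\<exists>i. d i \<noteq> 0)}"

text \<open>The degree \<open>d\<close> component of the subalgebra generated by \<open>X = E\<close> or \<open>X = F\<close>.\<close>

definition n_component ::
  "('i \<Rightarrow> 'i) \<Rightarrow> (nat \<Rightarrow> 'i) \<Rightarrow> ('i \<Rightarrow> 'g::lie_algebra) \<Rightarrow> (nat \<Rightarrow> nat) \<Rightarrow> 'g set" where
  "n_component \<pi> \<iota> X d = cvec.span {comm_eval X c | c.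
     \<forall>i\<in>{1..num_cycles \<pi>}. length (filter (\<lambda>l. l \<in> orbit \<pi> (\<iota> i)) (letters c)) = d i}"

definition n_fixed_component ::
  "('i \<Rightarrow> 'i) \<Rightarrow> (nat \<Rightarrow> 'i) \<Rightarrow> ('g \<Rightarrow> 'g) \<Rightarrow> ('i \<Rightarrow> 'g::lie_algebra) \<Rightarrow> (nat \<Rightarrow> nat) \<Rightarrow> 'g set" where
  "n_fixed_component \<pi> \<iota> \<sigma> X d = n_component \<pi> \<iota> X d \<inter> fixed_points \<sigma>"

definition h_fixed :: "('h \<Rightarrow> 'g) \<Rightarrow> ('g \<Rightarrow> 'g) \<Rightarrow> 'g set" where
  "h_fixed hh \<sigma> = range hh \<inter> fixed_points \<sigma>"

definition g_B\<sigma> ::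
  "('h \<Rightarrow> 'g::lie_algebra) \<Rightarrow> ('i \<Rightarrow> 'g) \<Rightarrow> ('i \<Rightarrow> 'g) \<Rightarrow> nat \<Rightarrow> ('g \<Rightarrow> 'g) \<Rightarrow> 'g set" where
  "g_B\<sigma> hh E F T \<sigma> = subalgebra_generated
     (h_fixed hh \<sigma> \<union> range (\<lambda>i. bar T \<sigma> (E i)) \<union> range (\<lambda>i. bar T \<sigma> (F i)))"


section \<open>The algebra \<open>\<aa>\<close> and the map from \<open>\<nn>\<close>\<close>

definition total_degree :: "nat \<Rightarrow> (nat \<Rightarrow> nat) \<Rightarrow> nat" where
  "total_degree r d = (\<Sum>i=1..r. d i)"

text \<open>The index \<open>i_n\<close>, and the block \<open>i\<close> to which an index belongs.\<close>

definition idx :: "(nat \<Rightarrow> nat) \<Rightarrow> nat \<Rightarrow> nat \<Rightarrow> nat" where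
  "idx d i n = (\<Sum>j=1..<i. d j) + n"

definition block :: "(nat \<Rightarrow> nat) \<Rightarrow> nat \<Rightarrow> nat" where
  "block d p = (THE i. 1 \<le> i \<and> (\<exists>n\<in>{1..d i}. p = idx d i n))"

text \<open>All the algebras \<open>\<aa>\<close> (for varying \<open>m\<close>) are taken inside one free Lie algebra: \<open>\<aa>\<close> is the
  subalgebra generated by the free generators \<open>(i, k)\<close> with \<open>1 \<le> i \<le> m\<close> and \<open>k < T\<close>, where \<open>k\<close>
  stands for its residue class.\<close>

definition f_gen :: "nat \<Rightarrow> nat \<Rightarrow> nat \<Rightarrow> (nat \<times> nat) free_lie" where
  "f_gen T i k = free_gen (i, k mod T)"

definition a_alg :: "nat \<Rightarrow> nat \<Rightarrow> (nat \<times> nat) free_lie set" where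
  "a_alg T m = subalgebra_generated {f_gen T i k | i k. i \<in> {1..m} \<and> k < T}"

definition \<tau> :: "nat \<Rightarrow> (nat \<times> nat) free_lie \<Rightarrow> (nat \<times> nat) free_lie" where
  "\<tau> T = lie_extend (\<lambda>(i, k). f_gen T i (k + 1))"

definition abar_alg :: "nat \<Rightarrow> nat \<Rightarrow> (nat \<times> nat) free_lie set" where
  "abar_alg T m = a_alg T m \<inter> fixed_points (\<tau> T)"

definition a_component :: "nat \<Rightarrow> nat \<Rightarrow> (nat \<Rightarrow> nat) \<Rightarrow> (nat \<times> nat) free_lie set" where
  "a_component T m d = cvec.span {comm_eval free_gen c | c.
     set (letters c) \<subseteq> {1..m} \<times> {..<T} \<and> (\<forall>i. count_list (map fst (letters c)) i = d i)}"

definition one_m :: "nat \<Rightarrow> nat \<Rightarrow> nat" where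
  "one_m m i = (if i \<in> {1..m} then 1 else 0)"

definition a_projection :: "nat \<Rightarrow> nat \<Rightarrow> (nat \<times> nat) free_lie \<Rightarrow> (nat \<times> nat) free_lie" where
  "a_projection T m x = (THE y. y \<in> a_component T m (one_m m) \<and>
     x - y \<in> cvec.span (\<Union>d\<in>- {one_m m}. a_component T m d))"

definition is_jmath ::
  "('i \<Rightarrow> 'i) \<Rightarrow> (nat \<Rightarrow> 'i) \<Rightarrow> ('i \<Rightarrow> 'g::lie_algebra) \<Rightarrow> nat \<Rightarrow> (nat \<Rightarrow> nat) \<Rightarrow>
   ('g \<Rightarrow> (nat \<times> nat) free_lie) \<Rightarrow> bool" where
  "is_jmath \<pi> \<iota> F T d j \<longleftrightarrow>
     lie_hom_on (subalgebra_generated (range F)) j \<and>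
     (\<forall>i\<in>{1..num_cycles \<pi>}. \<forall>k<cycle_length \<pi> \<iota> i.
        j (F ((\<pi> ^^ k) (\<iota> i))) =
        (\<Sum>l<T div cycle_length \<pi> \<iota> i. \<Sum>n=1..d i. f_gen T (idx d i n) (k + cycle_length \<pi> \<iota> i * l)))"


section \<open>Flags of the arrangement\<close>

text \<open>\<open>\<complex>\<^sup>m\<close> is the space of finitely supported functions with support in \<open>{1..m}\<close>.
  \<open>Diag i j k\<close> labels the hyperplane \<open>t\<^sub>i = \<omega>\<^sup>k t\<^sub>j\<close> (\<open>i < j\<close>, \<open>k < T\<close>), and \<open>Coord i\<close> the hyperplane
  \<open>t\<^sub>i = 0\<close>; different labels give different hyperplanes.\<close>

type_synonym point = "nat \<Rightarrow>\<^sub>0 complex"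

definition Cm :: "nat \<Rightarrow> point set" where
  "Cm m = {t. Poly_Mapping.keys t \<subseteq> {1..m}}"

datatype hyperplane = Diag nat nat nat | Coord nat

primrec on_hyperplane :: "complex \<Rightarrow> hyperplane \<Rightarrow> point \<Rightarrow> bool" where
  "on_hyperplane \<omega> (Diag i j k) t \<longleftrightarrow>
     Poly_Mapping.lookup t i = \<omega> ^ k * Poly_Mapping.lookup t j"
| "on_hyperplane \<omega> (Coord i) t \<longleftrightarrow> Poly_Mapping.lookup t i = 0"

definition hyperplanes :: "nat \<Rightarrow> nat \<Rightarrow> hyperplane set" where
  "hyperplanes T m = {Diag i j k | i j k. 1 \<le> i \<and> i < j \<and> j \<le> m \<and> k < T} \<union> Coord ` {1..m}"

definition hyp_inter :: "complex \<Rightarrow> nat \<Rightarrow> hyperplane set \<Rightarrow> point set" where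
  "hyp_inter \<omega> m S = {t \<in> Cm m. \<forall>h\<in>S. on_hyperplane \<omega> h t}"

definition edges :: "nat \<Rightarrow> complex \<Rightarrow> nat \<Rightarrow> point set set" where
  "edges T \<omega> m = {hyp_inter \<omega> m S | S. S \<subseteq> hyperplanes T m \<and> hyp_inter \<omega> m S \<noteq> {}}"

definition codim :: "nat \<Rightarrow> point set \<Rightarrow> nat" where
  "codim m L = m - cvec.dim L"

definition flags :: "nat \<Rightarrow> complex \<Rightarrow> nat \<Rightarrow> nat \<Rightarrow> point set list set" where
  "flags T \<omega> m p = {Fl. length Fl = Suc p \<and> Fl ! 0 = Cm m \<and>
     (\<forall>j\<le>p. Fl ! j \<in> edges T \<omega> m \<and> codim m (Fl ! j) = j) \<and> (\<forall>j<p. Fl ! Suc j \<subseteq> Fl ! j)}"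

text \<open>\<open>\<F>\<^sup>p\<close> is the quotient of \<open>flag_space\<close> by \<open>flag_relations\<close>; its elements are handled through
  representatives in \<open>flag_space\<close>, and \<open>flag_equiv\<close> is equality in \<open>\<F>\<^sup>p\<close>. In
  \<open>flag_relations\<close>, the chain with its \<open>i\<close>-th edge missing is obtained by deleting the \<open>i\<close>-th edge of \<open>Fl\<close>;
  chains that no edge completes would only contribute an empty sum.\<close>

definition flag_space ::
  "nat \<Rightarrow> complex \<Rightarrow> nat \<Rightarrow> nat \<Rightarrow> (point set list \<Rightarrow>\<^sub>0 complex) set" where
  "flag_space T \<omega> m p = cvec.span ((\<lambda>Fl. Poly_Mapping.single Fl 1) ` flags T \<omega> m p)"

definition flag_relations ::
  "nat \<Rightarrow> complex \<Rightarrow> nat \<Rightarrow> nat \<Rightarrow> (point set list \<Rightarrow>\<^sub>0 complex) set" where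
  "flag_relations T \<omega> m p = cvec.span
     {(\<Sum>L | Fl[i := L] \<in> flags T \<omega> m p. Poly_Mapping.single (Fl[i := L]) 1) | Fl i.
        Fl \<in> flags T \<omega> m p \<and> 0 < i \<and> i < p}"

definition flag_equiv ::
  "nat \<Rightarrow> complex \<Rightarrow> nat \<Rightarrow> nat \<Rightarrow> (point set list \<Rightarrow>\<^sub>0 complex) \<Rightarrow> (point set list \<Rightarrow>\<^sub>0 complex) \<Rightarrow> bool" where
  "flag_equiv T \<omega> m p x y \<longleftrightarrow> x - y \<in> flag_relations T \<omega> m p"

definition flag_order ::
  "complex \<Rightarrow> nat \<Rightarrow> point set list \<Rightarrow> hyperplane list \<Rightarrow> (nat \<Rightarrow> nat) \<Rightarrow> bool" where
  "flag_order \<omega> m Fl hs s \<longleftrightarrow> s permutes {..<length hs} \<and>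
     length Fl = Suc (length hs) \<and>
     (\<forall>i\<le>length hs. Fl ! i = hyp_inter \<omega> m ((\<lambda>j. hs ! s j) ` {..<i}))"

definition flag_pairing :: "complex \<Rightarrow> nat \<Rightarrow> point set list \<Rightarrow> hyperplane list \<Rightarrow> complex" where
  "flag_pairing \<omega> m Fl hs =
     (if \<exists>s. flag_order \<omega> m Fl hs s then of_int (sign (THE s. flag_order \<omega> m Fl hs s)) else 0)"

definition pairing ::
  "complex \<Rightarrow> nat \<Rightarrow> (point set list \<Rightarrow>\<^sub>0 complex) \<Rightarrow> hyperplane list \<Rightarrow> complex" where
  "pairing \<omega> m x hs =
     (\<Sum>Fl\<in>Poly_Mapping.keys x. Poly_Mapping.lookup x Fl * flag_pairing \<omega> m Fl hs)"

text \<open>The chosen enumeration of the set \<open>S\<close> of hyperplanes is immaterial, since reordering it changes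
  both pairings by the same sign.\<close>

definition G_form ::
  "nat \<Rightarrow> complex \<Rightarrow> nat \<Rightarrow> (hyperplane \<Rightarrow> complex) \<Rightarrow> nat \<Rightarrow>
   (point set list \<Rightarrow>\<^sub>0 complex) \<Rightarrow> (point set list \<Rightarrow>\<^sub>0 complex) \<Rightarrow> complex" where
  "G_form T \<omega> m a p x y =
     (\<Sum>S | S \<subseteq> hyperplanes T m \<and> card S = p.
        let hs = (SOME hs. distinct hs \<and> set hs = S)
        in pairing \<omega> m x hs * pairing \<omega> m y hs * (\<Prod>h\<in>S. a h))"

primrec weight ::
  "('h \<Rightarrow> 'h \<Rightarrow> complex) \<Rightarrow> ('i \<Rightarrow> 'h \<Rightarrow> complex) \<Rightarrow> ('i \<Rightarrow> 'i) \<Rightarrow> (nat \<Rightarrow> 'i) \<Rightarrow> (nat \<Rightarrow> nat) \<Rightarrow>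
   hyperplane \<Rightarrow> complex" where
  "weight B \<alpha> \<pi> \<iota> d (Diag p q k) =
     dual_form B (\<alpha> (\<iota> (block d p))) (\<alpha> ((\<pi> ^^ k) (\<iota> (block d q))))"
| "weight B \<alpha> \<pi> \<iota> d (Coord p) = 0"


section \<open>The maps \<open>\<psi>\<^sub>p\<close>\<close>

text \<open>\<open>\<And>\<^sup>p A \<otimes> U(A)\<close>, for a Lie subalgebra \<open>A\<close>, is the quotient of the formal linear combinations of
  symbols \<open>g\<^sub>1 \<and> \<dots> \<and> g\<^sub>p \<otimes> u\<^sub>1 \<cdots> u\<^sub>k\<close> with all \<open>g\<^sub>i, u\<^sub>i \<in> A\<close> by the subspace \<open>wu_relations A p\<close>:
  multilinearity, vanishing on repeated wedge factors, and \<open>x y - y x = [x, y]\<close> in \<open>U(A)\<close>.\<close>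

definition wu_symbol :: "'l list \<Rightarrow> 'l list \<Rightarrow> ('l list \<times> 'l list) \<Rightarrow>\<^sub>0 complex" where
  "wu_symbol gs us = Poly_Mapping.single (gs, us) 1"

definition wu_relations :: "'l::lie_algebra set \<Rightarrow> nat \<Rightarrow> (('l list \<times> 'l list) \<Rightarrow>\<^sub>0 complex) set" where
  "wu_relations A p = cvec.span (
     {wu_symbol (gs @ (x + y) # gs') us - (wu_symbol (gs @ x # gs') us + wu_symbol (gs @ y # gs') us)
        | gs x y gs' us. length gs + length gs' + 1 = p \<and> {x, y} \<union> set gs \<union> set gs' \<union> set us \<subseteq> A} \<union>
     {wu_symbol (gs @ (c *\<^sub>C x) # gs') us - c *\<^sub>C wu_symbol (gs @ x # gs') us
        | gs c x gs' us. length gs + length gs' + 1 = p \<and> {x} \<union> set gs \<union> set gs' \<union> set us \<subseteq> A} \<union>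
     {wu_symbol gs us
        | gs us. length gs = p \<and> \<not> distinct gs \<and> set gs \<union> set us \<subseteq> A} \<union>
     {wu_symbol gs (us @ (x + y) # us') - (wu_symbol gs (us @ x # us') + wu_symbol gs (us @ y # us'))
        | gs us x y us'. length gs = p \<and> {x, y} \<union> set gs \<union> set us \<union> set us' \<subseteq> A} \<union>
     {wu_symbol gs (us @ (c *\<^sub>C x) # us') - c *\<^sub>C wu_symbol gs (us @ x # us')
        | gs us c x us'. length gs = p \<and> {x} \<union> set gs \<union> set us \<union> set us' \<subseteq> A} \<union>
     {wu_symbol gs (us @ x # y # us') - wu_symbol gs (us @ y # x # us')
          - wu_symbol gs (us @ bracket x y # us')
        | gs us x y us'. length gs = p \<and> {x, y} \<union> set gs \<union> set us \<union> set us' \<subseteq> A})"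

text \<open>Representatives of the degree \<open>(1, \<dots>, 1)\<close> part: symbols with homogeneous entries.\<close>

definition wu_component ::
  "nat \<Rightarrow> nat \<Rightarrow> nat \<Rightarrow> (((nat \<times> nat) free_lie list \<times> (nat \<times> nat) free_lie list) \<Rightarrow>\<^sub>0 complex) set" where
  "wu_component T m p = cvec.span {wu_symbol gs us | gs us. length gs = p \<and>
     (\<exists>ds. list_all2 (\<lambda>x d. x \<in> abar_alg T m \<inter> a_component T m d) (gs @ us) ds \<and>
           (\<forall>i. (\<Sum>d\<leftarrow>ds. d i) = one_m m i))}"

definition L_edge :: "complex \<Rightarrow> nat \<Rightarrow> (nat \<times> nat) commutator \<Rightarrow> point set" where
  "L_edge \<omega> m g = {t \<in> Cm m. \<forall>(i, k)\<in>set (letters g). \<forall>(j, l)\<in>set (letters g).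
     \<omega> ^ k * Poly_Mapping.lookup t i = \<omega> ^ l * Poly_Mapping.lookup t j}"

definition L0_edge :: "nat \<Rightarrow> (nat \<times> nat) commutator \<Rightarrow> point set" where
  "L0_edge m g = {t \<in> Cm m. \<forall>(i, k)\<in>set (letters g). Poly_Mapping.lookup t i = 0}"

definition comm_bar :: "nat \<Rightarrow> (nat \<times> nat) commutator \<Rightarrow> (nat \<times> nat) free_lie" where
  "comm_bar T g = bar T (\<tau> T) (comm_eval free_gen g)"

text \<open>The commutators \<open>cs\<close> have generators \<open>f\<^sub>i\<^sup>k\<close> whose indices \<open>i\<close> run exactly once through
  \<open>1, \<dots>, m\<close>, so their total degree is \<open>(1, \<dots>, 1)\<close>.\<close>

definition multilinear_comms :: "nat \<Rightarrow> nat \<Rightarrow> (nat \<times> nat) commutator list \<Rightarrow> bool" where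
  "multilinear_comms T m cs \<longleftrightarrow>
     (\<forall>c\<in>set cs. \<forall>(i, k)\<in>set (letters c). k < T) \<and>
     mset (map fst (concat (map letters cs))) = mset [1..<Suc m]"

text \<open>A linear map between the quotients is given by a linear map on representatives that respects
  the relations; its values outside \<open>wu_component\<close> are irrelevant.\<close>

definition is_psi ::
  "nat \<Rightarrow> complex \<Rightarrow> nat \<Rightarrow>
   (nat \<Rightarrow> (((nat \<times> nat) free_lie list \<times> (nat \<times> nat) free_lie list) \<Rightarrow>\<^sub>0 complex) \<Rightarrow>
      (point set list \<Rightarrow>\<^sub>0 complex)) \<Rightarrow> bool" where
  "is_psi T \<omega> m \<psi> \<longleftrightarrow>
     (\<forall>p\<le>m. clinear (\<psi> p) \<and>
        \<psi> p ` wu_component T m p \<subseteq> flag_space T \<omega> m (m - p) \<and>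
        \<psi> p ` (wu_component T m p \<inter> wu_relations (abar_alg T m) p) \<subseteq> flag_relations T \<omega> m (m - p)) \<and>
     flag_equiv T \<omega> m 0
       (\<psi> m (wu_symbol (map (\<lambda>i. bar T (\<tau> T) (f_gen T i 0)) [1..<Suc m]) []))
       (Poly_Mapping.single [Cm m] 1) \<and>
     (\<forall>p q gs g\<^sub>1 us \<epsilon> Fl.
        length gs = p \<and> q + p + 1 = m \<and> multilinear_comms T m (gs @ [g\<^sub>1] @ us) \<and>
        \<epsilon> \<in> {1, -1} \<and> Fl \<in> flags T \<omega> m q \<and>
        flag_equiv T \<omega> m q
          (\<psi> (p + 1) (wu_symbol (map (comm_bar T) (gs @ [g\<^sub>1])) (map (comm_bar T) us)))
          (\<epsilon> *\<^sub>C Poly_Mapping.single Fl 1)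
        \<longrightarrow> flag_equiv T \<omega> m (q + 1)
          (\<psi> p (wu_symbol (map (comm_bar T) gs) (comm_bar T g\<^sub>1 # map (comm_bar T) us)))
          (\<epsilon> *\<^sub>C Poly_Mapping.single (Fl @ [last Fl \<inter> L0_edge m g\<^sub>1]) 1)) \<and>
     (\<forall>p q gs g\<^sub>1 g\<^sub>2 us \<epsilon> Fl.
        length gs + 1 = p \<and> q + p + 1 = m \<and> multilinear_comms T m (gs @ [g\<^sub>2, g\<^sub>1] @ us) \<and>
        \<epsilon> \<in> {1, -1} \<and> Fl \<in> flags T \<omega> m q \<and>
        flag_equiv T \<omega> m q
          (\<psi> (p + 1) (wu_symbol (map (comm_bar T) (gs @ [g\<^sub>2, g\<^sub>1])) (map (comm_bar T) us)))
          (\<epsilon> *\<^sub>C Poly_Mapping.single Fl 1)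
        \<longrightarrow> flag_equiv T \<omega> m (q + 1)
          (\<psi> p (wu_symbol (map (comm_bar T) (gs @ [Comm g\<^sub>1 g\<^sub>2])) (map (comm_bar T) us)))
          (\<epsilon> *\<^sub>C Poly_Mapping.single (Fl @ [last Fl \<inter> L_edge \<omega> m (Comm g\<^sub>1 g\<^sub>2)]) 1))"


section \<open>The form \<open>\<Omega>\<close>\<close>

definition w_factor :: "('i \<Rightarrow> 'i) \<Rightarrow> (nat \<Rightarrow> 'i) \<Rightarrow> nat \<Rightarrow> (nat \<Rightarrow> nat) \<Rightarrow> complex" where
  "w_factor \<pi> \<iota> T d =
     (\<Prod>i=1..num_cycles \<pi>. (of_nat T / of_nat (cycle_length \<pi> \<iota> i)) ^ d i * fact (d i))"

text \<open>The right-hand side of the formula for \<open>\<Omega> (\<phi> x) y\<close> with \<open>x, y\<close> of degree \<open>d\<close>; the elements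
  \<open>s x\<close> and \<open>s y\<close> are viewed in \<open>U\<close> as words of length one.\<close>

definition omega_value ::
  "('h \<Rightarrow> 'h \<Rightarrow> complex) \<Rightarrow> ('i \<Rightarrow> 'h \<Rightarrow> complex) \<Rightarrow> ('i \<Rightarrow> 'i) \<Rightarrow> (nat \<Rightarrow> 'i) \<Rightarrow> nat \<Rightarrow> complex \<Rightarrow>
   ((nat \<Rightarrow> nat) \<Rightarrow> 'g \<Rightarrow> (nat \<times> nat) free_lie) \<Rightarrow>
   (nat \<Rightarrow> nat \<Rightarrow> (((nat \<times> nat) free_lie list \<times> (nat \<times> nat) free_lie list) \<Rightarrow>\<^sub>0 complex) \<Rightarrow>
      (point set list \<Rightarrow>\<^sub>0 complex)) \<Rightarrow>
   (nat \<Rightarrow> nat) \<Rightarrow> 'g \<Rightarrow> 'g \<Rightarrow> complex" where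
  "omega_value B \<alpha> \<pi> \<iota> T \<omega> j \<psi> d x y =
     (let m = total_degree (num_cycles \<pi>) d;
          s = (\<lambda>z. a_projection T m (j d z))
      in (-1) ^ m / w_factor \<pi> \<iota> T d *
         G_form T \<omega> m (weight B \<alpha> \<pi> \<iota> d) m
           (\<psi> m 0 (wu_symbol [] [s x])) (\<psi> m 0 (wu_symbol [] [s y])))"

definition is_Omega ::
  "('h \<Rightarrow> 'h \<Rightarrow> complex) \<Rightarrow> ('i \<Rightarrow> 'h \<Rightarrow> complex) \<Rightarrow>
   ('h \<Rightarrow> 'g::lie_algebra) \<Rightarrow> ('i \<Rightarrow> 'g) \<Rightarrow> ('i \<Rightarrow> 'g) \<Rightarrow> ('g \<Rightarrow> 'g) \<Rightarrow>
   nat \<Rightarrow> complex \<Rightarrow> ('g \<Rightarrow> 'g) \<Rightarrow> ('i \<Rightarrow> 'i) \<Rightarrow> (nat \<Rightarrow> 'i) \<Rightarrow>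
   ((nat \<Rightarrow> nat) \<Rightarrow> 'g \<Rightarrow> (nat \<times> nat) free_lie) \<Rightarrow>
   (nat \<Rightarrow> nat \<Rightarrow> (((nat \<times> nat) free_lie list \<times> (nat \<times> nat) free_lie list) \<Rightarrow>\<^sub>0 complex) \<Rightarrow>
      (point set list \<Rightarrow>\<^sub>0 complex)) \<Rightarrow>
   ('g \<Rightarrow> 'g \<Rightarrow> complex) \<Rightarrow> bool" where
  "is_Omega B \<alpha> hh E F \<phi> T \<omega> \<sigma> \<pi> \<iota> j \<psi> \<Omega> \<longleftrightarrow>
     (let g\<sigma> = fixed_points \<sigma>;
          h\<sigma> = h_fixed hh \<sigma>;
          nm = n_fixed_component \<pi> \<iota> \<sigma> F;
          np = n_fixed_component \<pi> \<iota> \<sigma> E;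
          D = multidegrees (num_cycles \<pi>)
      in (\<forall>x\<in>g\<sigma>. \<forall>y\<in>g\<sigma>. \<forall>z\<in>g\<sigma>. \<Omega> (x + y) z = \<Omega> x z + \<Omega> y z \<and> \<Omega> x (y + z) = \<Omega> x y + \<Omega> x z) \<and>
         (\<forall>c. \<forall>x\<in>g\<sigma>. \<forall>y\<in>g\<sigma>. \<Omega> (c *\<^sub>C x) y = c * \<Omega> x y \<and> \<Omega> x (c *\<^sub>C y) = c * \<Omega> x y) \<and>
         (\<forall>x\<in>g\<sigma>. \<forall>y\<in>g\<sigma>. \<Omega> y x = - \<Omega> x y) \<and>
         (\<forall>d\<in>D. \<forall>x\<in>nm d. \<forall>y\<in>nm d.
            \<Omega> (\<phi> x) y = omega_value B \<alpha> \<pi> \<iota> T \<omega> j \<psi> d x y \<and>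
            - \<Omega> y (\<phi> x) = omega_value B \<alpha> \<pi> \<iota> T \<omega> j \<psi> d x y) \<and>
         (\<forall>d\<in>D. \<forall>d'\<in>D. d \<noteq> d' \<longrightarrow> (\<forall>x\<in>np d. \<forall>y\<in>nm d'. \<Omega> x y = 0 \<and> \<Omega> y x = 0)) \<and>
         (\<forall>d\<in>D. \<forall>d'\<in>D. (\<forall>x\<in>nm d. \<forall>y\<in>nm d'. \<Omega> x y = 0) \<and> (\<forall>x\<in>np d. \<forall>y\<in>np d'. \<Omega> x y = 0)) \<and>
         (\<forall>d\<in>D. \<forall>x\<in>h\<sigma>. \<forall>y\<in>nm d \<union> np d. \<Omega> x y = 0 \<and> \<Omega> y x = 0) \<and>
         (\<forall>x\<in>h\<sigma>. \<forall>y\<in>h\<sigma>. \<Omega> x y = 0))"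

end

theory Submission
  imports Defs
begin

text \<open>If \<open>\<gg>\<^sup>\<sigma>\<close> is generated by \<open>\<hh>\<^sup>\<sigma>\<close> and the barred generators, then it is spanned by \<open>\<hh>\<^sup>\<sigma>\<close>
  and the commutators in the \<open>F\<^sub>i\<close> with a bar and in the \<open>E\<^sub>i\<close> with a bar, so it suffices to show
  \<open>\<Omega> (\<phi> x) y = 0\<close> when \<open>x\<close> is a commutator in the barred \<open>F\<^sub>i\<close>. The map \<open>\<jmath>\<close> sends a barred \<open>F\<^sub>i\<close> to a
  combination of barred generators of \<open>\<aa>\<close>, hence \<open>s x\<close> is a combination of commutators in these,
  and in the enveloping algebra a combination of words \<open>u\<^sub>1 \<cdots> u\<^sub>m\<close> whose letters are the \<open>m\<close> barred
  generators in some order. Up to sign, \<open>\<psi>\<^sub>0\<close> maps such a word to a flag of intersections of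
  coordinate hyperplanes. Its first edge is a hyperplane \<open>t\<^sub>p = 0\<close>, so it pairs to zero with all
  families of hyperplanes that avoid the coordinate hyperplanes, while all other families contribute
  nothing to the form \<open>G\<close> because the coordinate hyperplanes have weight zero.\<close>

section \<open>Spans of commutators\<close>

text \<open>What the hypothesis provides is the order of two operations. In general an element of
  \<open>\<nn>\<^sup>\<sigma>\<close> is a combination of bars of brackets, and these produce flags
  through the diagonal edges of commutators. If the barred generators suffice, only brackets of bars
  occur, and in the enveloping algebra these unfold through [x, y] = x y - y x into words without
  brackets. One argument of this kind already makes G vanish, so the other may stay arbitrary.

  Two obstacles shape the rest. Elements of \<open>\<And>\<^sup>p A \<otimes> U(A)\<close> and of
  \<open>\<F>\<^sup>p\<close> are handled through representatives: identities hold modulo relations,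
  which must be homogeneous of degree (1, ..., 1) before \<open>\<psi>\<close> may be applied, and
  the pairing must be shown to vanish on the flag relations. And the projection to degree (1, ...,
  1) is meaningful only once the graded pieces of the free Lie algebra, a quotient of terms, are
  known to be independent; commuting operators that rescale the generators supply this.\<close>

lemma clinear_iff:
  "clinear f \<longleftrightarrow> (\<forall>x y. f (x + y) = f x + f y) \<and> (\<forall>c x. f (c *\<^sub>C x) = c *\<^sub>C f x)"
  by (simp add: Vector_Spaces.linear_iff cvec.vector_space_axioms)

lemma clinearI:
  assumes "\<And>x y. f (x + y) = f x + f y" and "\<And>c x. f (c *\<^sub>C x) = c *\<^sub>C f x"
  shows "clinear f"
  using assms by (simp add: clinear_iff)

lemma clinear_add: "clinear f \<Longrightarrow> f (x + y) = f x + f y"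
  and clinear_scale: "clinear f \<Longrightarrow> f (c *\<^sub>C x) = c *\<^sub>C f x"
  by (simp_all add: clinear_iff)

lemma clinear_0: "clinear f \<Longrightarrow> f 0 = 0"
  and clinear_neg: "clinear f \<Longrightarrow> f (- x) = - f x"
  and clinear_diff: "clinear f \<Longrightarrow> f (x - y) = f x - f y"
  and clinear_sum: "clinear f \<Longrightarrow> f (sum g A) = (\<Sum>a\<in>A. f (g a))"
  by (simp_all add: module_hom_iff_linear[symmetric] module_hom.zero module_hom.neg
      module_hom.diff module_hom.sum)

lemma clinear_mem_span:
  assumes "clinear f" "x \<in> cvec.span S" "cvec.subspace W" "\<And>s. s \<in> S \<Longrightarrow> f s \<in> W"
  shows "f x \<in> W"
  using assms(2)
proof (induction rule: cvec.span_induct_alt)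
  case base
  show ?case using assms by (simp add: clinear_0 cvec.subspace_0)
next
  case (step c x y)
  then show ?case
    using assms by (simp add: clinear_add clinear_scale cvec.subspace_add cvec.subspace_scale)
qed

lemma clinear_bracket_right: "clinear (bracket x)"
  and clinear_bracket_left: "clinear (\<lambda>x. bracket x y)"
  by (auto intro!: clinearI simp: bracket_add_left bracket_add_right bracket_scale_left
      bracket_scale_right)

lemmas bracket_sum_right = clinear_sum[OF clinear_bracket_right]
  and bracket_sum_left = clinear_sum[OF clinear_bracket_left]
  and bracket_neg_right = clinear_neg[OF clinear_bracket_right]
  and bracket_0_left = clinear_0[OF clinear_bracket_left]

section \<open>Identities for the bracket\<close>

lemma bracket_skew: "bracket y x = - bracket x (y :: 'g::lie_algebra)"
proof -
  have "bracket (x + y) (x + y) = bracket x y + bracket y x"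
    by (simp only: bracket_add_left bracket_add_right) (simp add: bracket_self)
  then have "bracket x y + bracket y x = 0" by (simp only: bracket_self)
  then show ?thesis by (simp add: eq_neg_iff_add_eq_0 add.commute)
qed

lemma bracket_leibniz:
  "bracket x (bracket y z) = bracket (bracket x y) z + bracket y (bracket x (z :: 'g::lie_algebra))"
proof -
  have "bracket x (bracket y z) + bracket y (- bracket x z) + - bracket (bracket x y) z = 0"
    using jacobi[of x y z] by (simp only: bracket_skew[of z x] bracket_skew[of z "bracket x y"])
  then show ?thesis by (simp add: bracket_neg_right algebra_simps)
qed

lemma bracket_mem_span:
  assumes "x \<in> cvec.span S" "y \<in> cvec.span S'" "cvec.subspace W"
    and "\<And>s s'. s \<in> S \<Longrightarrow> s' \<in> S' \<Longrightarrow> bracket s s' \<in> W"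
  shows "bracket x y \<in> W"
  by (rule clinear_mem_span[OF clinear_bracket_left assms(1,3)],
      rule clinear_mem_span[OF clinear_bracket_right assms(2,3)]) (rule assms(4))

text \<open>A commutator is multilinear in its letters, so each letter can be expanded separately.
  The positionwise relation given by \<open>P\<close> remembers which letters may replace which. One
  lemma thus serves three expansions: of a barred generator of \<open>\<aa>\<close> into its
  residues, of a barred \<open>E\<close> or \<open>F\<close> into its orbit, and of the image under
  \<open>\<jmath>\<close> into barred generators.\<close>

lemma comm_eval_span:
  assumes "\<And>l. l \<in> set (letters c) \<Longrightarrow> f l \<in> cvec.span (g ` P l)"
  shows "comm_eval f c \<in>
    cvec.span {comm_eval g c' | c'. list_all2 (\<lambda>l' l. l' \<in> P l) (letters c') (letters c)}"
  using assms
proof (induction c)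
  case (Leaf l)
  have "f l \<in> cvec.span (g ` P l)" using Leaf by simp
  moreover have "g ` P l \<subseteq>
    {comm_eval g c' | c'. list_all2 (\<lambda>l' l. l' \<in> P l) (letters c') (letters (Leaf l))}"
  proof clarify
    fix l' assume "l' \<in> P l"
    then show "\<exists>c'. g l' = comm_eval g c' \<and>
        list_all2 (\<lambda>l' l. l' \<in> P l) (letters c') (letters (Leaf l))"
      by (intro exI[of _ "Leaf l'"]) simp
  qed
  ultimately have "f l \<in> cvec.span {comm_eval g c' | c'.
      list_all2 (\<lambda>l' l. l' \<in> P l) (letters c') (letters (Leaf l))}"
    by (rule subsetD[OF cvec.span_mono, rotated])
  then show ?case by (simp only: comm_eval.simps)
next
  case (Comm a b)
  have a: "comm_eval f a \<in>
    cvec.span {comm_eval g c' | c'. list_all2 (\<lambda>l' l. l' \<in> P l) (letters c') (letters a)}"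
    and b: "comm_eval f b \<in>
    cvec.span {comm_eval g c' | c'. list_all2 (\<lambda>l' l. l' \<in> P l) (letters c') (letters b)}"
    using Comm by auto
  show ?case unfolding comm_eval.simps
  proof (rule bracket_mem_span[OF a b cvec.subspace_span], clarify)
    fix a' b' assume *: "list_all2 (\<lambda>l' l. l' \<in> P l) (letters a') (letters a)"
      "list_all2 (\<lambda>l' l. l' \<in> P l) (letters b') (letters b)"
    show "bracket (comm_eval g a') (comm_eval g b') \<in> cvec.span
      {comm_eval g c' | c'. list_all2 (\<lambda>l' l. l' \<in> P l) (letters c') (letters (Comm a b))}"
      by (rule cvec.span_base, rule CollectI, rule exI[of _ "Comm a' b'"])
        (use * in \<open>auto intro: list_all2_appendI\<close>)
  qed
qed

section \<open>Generated subalgebras and homomorphisms defined on them\<close>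

lemma lie_subalgebra_generated: "lie_subalgebra (subalgebra_generated S)"
  unfolding subalgebra_generated_def lie_subalgebra_def
  by (intro conjI cvec.subspace_Inter) auto

lemma subalgebra_generated_base: "S \<subseteq> subalgebra_generated S"
  unfolding subalgebra_generated_def by auto

lemma subalgebra_generated_least: "lie_subalgebra A \<Longrightarrow> S \<subseteq> A \<Longrightarrow> subalgebra_generated S \<subseteq> A"
  unfolding subalgebra_generated_def by auto

lemma lie_subalgebraD:
  assumes "lie_subalgebra A"
  shows "cvec.subspace A" "x \<in> A \<Longrightarrow> y \<in> A \<Longrightarrow> bracket x y \<in> A"
  using assms by (auto simp: lie_subalgebra_def)

lemma comm_eval_in_subalgebra:
  assumes "lie_subalgebra A" "\<And>l. l \<in> set (letters c) \<Longrightarrow> f l \<in> A"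
  shows "comm_eval f c \<in> A"
  using assms(2) by (induction c) (auto intro: lie_subalgebraD(2)[OF assms(1)])

lemma lie_hom_on_comm_eval:
  assumes "lie_hom_on A j" "lie_subalgebra A" "\<And>l. l \<in> set (letters c) \<Longrightarrow> f l \<in> A"
  shows "j (comm_eval f c) = comm_eval (\<lambda>l. j (f l)) c"
  using assms(3)
proof (induction c)
  case (Comm a b)
  have "comm_eval f a \<in> A" "comm_eval f b \<in> A"
    using Comm.prems by (auto intro!: comm_eval_in_subalgebra[OF assms(2)])
  then show ?case using Comm assms(1) by (simp add: lie_hom_on_def)
qed simp

lemma lie_hom_on_sum:
  assumes "lie_hom_on A j" "cvec.subspace A" "\<And>l. l \<in> S \<Longrightarrow> f l \<in> A"
  shows "j (sum f S) = (\<Sum>l\<in>S. j (f l))"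
proof -
  \<comment> \<open>Additivity is available only on \<open>A\<close>, so the value at 0 is obtained
    by scaling with 0; it settles the empty sum.\<close>
  have "j 0 = 0"
  proof -
    have "j (0 *\<^sub>C 0) = 0 *\<^sub>C j 0"
      using assms(1) cvec.subspace_0[OF assms(2)] unfolding lie_hom_on_def by blast
    then show ?thesis by simp
  qed
  then show ?thesis using assms(3)
  proof (induction S rule: infinite_finite_induct)
    case (insert x F)
    have "f x \<in> A" "sum f F \<in> A" using insert by (auto intro: cvec.subspace_sum[OF assms(2)])
    then show ?case using insert assms(1) by (simp add: lie_hom_on_def)
  qed simp_all
qed

lemma lie_hom_clinear: "lie_hom_on UNIV f \<Longrightarrow> clinear f"
  by (rule clinearI) (simp_all add: lie_hom_on_def)

text \<open>The span on the right is stable under bracketing with each generator: an element of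
  \<open>h\<close> scales a commutator, a generator of the same kind lengthens it, one of the
  opposite kind shortens it. The brackets of \<open>e i\<close> with \<open>f k\<close> only have to
  lie in \<open>h\<close>; for barred generators they need not vanish when \<open>i\<close> and
  \<open>k\<close> differ.\<close>

lemma triangular_span:
  fixes e f :: "'i \<Rightarrow> 'g::lie_algebra"
  assumes h: "cvec.subspace h" "\<And>x y. x \<in> h \<Longrightarrow> y \<in> h \<Longrightarrow> bracket x y = 0"
    and he: "\<And>x i. x \<in> h \<Longrightarrow> \<exists>c. bracket x (e i) = c *\<^sub>C e i"
    and hf: "\<And>x i. x \<in> h \<Longrightarrow> \<exists>c. bracket x (f i) = c *\<^sub>C f i"
    and ef: "\<And>i k. bracket (e i) (f k) \<in> h"
  shows "subalgebra_generated (h \<union> range e \<union> range f) \<subseteq>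
    cvec.span (h \<union> range (comm_eval e) \<union> range (comm_eval f))"
proof -
  define V where "V = cvec.span (h \<union> range (comm_eval e) \<union> range (comm_eval f))"
  define S where "S = h \<union> range e \<union> range f"
  have V: "cvec.subspace V" unfolding V_def by (rule cvec.subspace_span)
  have VI: "h \<subseteq> V" "comm_eval e c \<in> V" "comm_eval f c \<in> V" for c
    unfolding V_def by (auto intro: cvec.span_base)
  have SV: "S \<subseteq> V"
  proof -
    have "e i \<in> V" "f i \<in> V" for i using VI(2)[of "Leaf i"] VI(3)[of "Leaf i"] by simp_all
    then show ?thesis using VI(1) by (auto simp: S_def)
  qed
  \<comment> \<open>Weights add: an element acting on the generators by scalars acts by a scalar on
    every commutator, by the Leibniz rule.\<close>
  have scal: "\<exists>\<mu>. bracket x (comm_eval g c) = \<mu> *\<^sub>C comm_eval g c"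
    if "\<And>i. \<exists>c. bracket x (g i) = c *\<^sub>C g i" for x :: 'g and g :: "'i \<Rightarrow> 'g" and c
  proof (induction c)
    case (Leaf i)
    show ?case using that by simp
  next
    case (Comm a b)
    then obtain \<mu> \<nu> where "bracket x (comm_eval g a) = \<mu> *\<^sub>C comm_eval g a"
      "bracket x (comm_eval g b) = \<nu> *\<^sub>C comm_eval g b" by blast
    then have "bracket x (comm_eval g (Comm a b)) = (\<mu> + \<nu>) *\<^sub>C comm_eval g (Comm a b)"
      by (simp add: bracket_leibniz[of x "comm_eval g a"] bracket_scale_left bracket_scale_right scaleC_add_left)
    then show ?case ..
  qed
  \<comment> \<open>Stated for arbitrary \<open>y\<close> and \<open>g\<close>, so that it covers
    both \<open>e i\<close> acting on commutators in \<open>f\<close> and \<open>f i\<close> acting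
    on commutators in \<open>e\<close>.\<close>
  have lower: "bracket y (comm_eval g c) \<in> cvec.span (h \<union> range (comm_eval g))"
    if hg: "\<And>x i. x \<in> h \<Longrightarrow> \<exists>c. bracket x (g i) = c *\<^sub>C g i" and yg: "\<And>i. bracket y (g i) \<in> h"
    for y :: 'g and g :: "'i \<Rightarrow> 'g" and c
  proof (induction c)
    case (Leaf i)
    show ?case using yg by (auto intro: cvec.span_base)
  next
    case (Comm a b)
    have 1: "bracket u (comm_eval g c) \<in> cvec.span (h \<union> range (comm_eval g))"
      if "u \<in> cvec.span (h \<union> range (comm_eval g))" for u c
    proof (rule clinear_mem_span[OF clinear_bracket_left that cvec.subspace_span])
      fix s assume "s \<in> h \<union> range (comm_eval g)"
      then consider "s \<in> h" | d where "s = comm_eval g d" by auto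
      then show "bracket s (comm_eval g c) \<in> cvec.span (h \<union> range (comm_eval g))"
      proof cases
        case 1
        then obtain \<mu> where "bracket s (comm_eval g c) = \<mu> *\<^sub>C comm_eval g c"
          using scal[of s g c] hg[OF \<open>s \<in> h\<close>] by blast
        then show ?thesis by (auto intro: cvec.span_scale cvec.span_base)
      next
        case 2
        then have "bracket s (comm_eval g c) = comm_eval g (Comm d c)" by simp
        then show ?thesis by (metis UnI2 cvec.span_base rangeI)
      qed
    qed
    \<comment> \<open>The second Leibniz term is turned round so that the lowered factor stands on
      the left, where fact \<open>1\<close> applies.\<close>
    have "bracket y (comm_eval g (Comm a b)) =
        bracket (bracket y (comm_eval g a)) (comm_eval g b)
        - bracket (bracket y (comm_eval g b)) (comm_eval g a)"
      by (simp only: comm_eval.simps bracket_leibniz[of y "comm_eval g a" "comm_eval g b"]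
          bracket_skew[of "comm_eval g a" "bracket y (comm_eval g b)"] diff_conv_add_uminus)
    then show ?case using 1[OF Comm(1)] 1[OF Comm(2)] by (simp add: cvec.span_diff)
  qed
  have lowerV: "bracket (e i) (comm_eval f c) \<in> V" "bracket (f i) (comm_eval e c) \<in> V" for i c
  proof -
    have "bracket (e i) (comm_eval f c) \<in> cvec.span (h \<union> range (comm_eval f))"
      by (rule lower[OF hf ef])
    then show "bracket (e i) (comm_eval f c) \<in> V"
      unfolding V_def by (rule rev_subsetD) (rule cvec.span_mono, auto)
    have fe: "bracket (f i) (e k) \<in> h" for k
      by (subst bracket_skew) (rule cvec.subspace_neg[OF h(1) ef])
    have "bracket (f i) (comm_eval e c) \<in> cvec.span (h \<union> range (comm_eval e))"
      by (rule lower[OF he fe])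
    then show "bracket (f i) (comm_eval e c) \<in> V"
      unfolding V_def by (rule rev_subsetD) (rule cvec.span_mono, auto)
  qed
  have raise: "bracket (e i) (comm_eval e c) \<in> V" "bracket (f i) (comm_eval f c) \<in> V" for i c
    using VI(2)[of "Comm (Leaf i) c"] VI(3)[of "Comm (Leaf i) c"] by simp_all
  have hV: "bracket x (comm_eval e c) \<in> V" "bracket x (comm_eval f c) \<in> V" if xh: "x \<in> h" for x c
  proof -
    obtain \<mu> \<nu> where "bracket x (comm_eval e c) = \<mu> *\<^sub>C comm_eval e c"
      "bracket x (comm_eval f c) = \<nu> *\<^sub>C comm_eval f c"
      using scal[of x e c] scal[of x f c] he[OF xh] hf[OF xh] by blast
    then show "bracket x (comm_eval e c) \<in> V" "bracket x (comm_eval f c) \<in> V"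
      using VI by (auto intro: cvec.subspace_scale[OF V])
  qed
  have Vh: "bracket s x \<in> V" if "s \<in> S" "x \<in> h" for s x
  proof -
    have "bracket x s \<in> V"
    proof -
      consider "s \<in> h" | i where "s = e i" | i where "s = f i" using \<open>s \<in> S\<close> by (auto simp: S_def)
      then show ?thesis
      proof cases
        case 1
        then show ?thesis using h(2) that(2) cvec.subspace_0[OF V] by simp
      next
        case (2 i)
        then show ?thesis using hV(1)[OF that(2), of "Leaf i"] by simp
      next
        case (3 i)
        then show ?thesis using hV(2)[OF that(2), of "Leaf i"] by simp
      qed
    qed
    then show ?thesis by (subst bracket_skew) (rule cvec.subspace_neg[OF V])
  qed
  have SV2: "bracket s v \<in> V" if "s \<in> S" "v \<in> V" for s v
    using that(2) unfolding V_def
  proof (rule clinear_mem_span[OF clinear_bracket_right])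
    show "cvec.subspace (cvec.span (h \<union> range (comm_eval e) \<union> range (comm_eval f)))"
      by (rule cvec.subspace_span)
    fix v assume "v \<in> h \<union> range (comm_eval e) \<union> range (comm_eval f)"
    then show "bracket s v \<in> cvec.span (h \<union> range (comm_eval e) \<union> range (comm_eval f))"
      unfolding V_def[symmetric]
    proof (elim UnE rangeE)
      assume "v \<in> h"
      then show "bracket s v \<in> V" by (rule Vh[OF that(1)])
    next
      fix c assume v: "v = comm_eval e c"
      show "bracket s v \<in> V"
        using that(1) unfolding S_def v by (elim UnE rangeE) (simp_all only: hV lowerV raise)
    next
      fix c assume v: "v = comm_eval f c"
      show "bracket s v \<in> V"
        using that(1) unfolding S_def v by (elim UnE rangeE) (simp_all only: hV lowerV raise)
    qed
  qed
  \<comment> \<open>By Jacobi, the elements that bracket \<open>V\<close> into itself form a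
    subalgebra. It contains the generators, hence the algebra they generate, which in turn contains
    \<open>V\<close>; so \<open>V\<close> is closed under brackets.\<close>
  define N where "N = {x. \<forall>v\<in>V. bracket x v \<in> V}"
  have N: "lie_subalgebra N"
    unfolding lie_subalgebra_def
  proof (intro conjI ballI)
    show "cvec.subspace N"
      unfolding N_def
      by (rule cvec.subspaceI) (simp_all add: bracket_0_left bracket_add_left
          bracket_scale_left cvec.subspace_0[OF V] cvec.subspace_add[OF V] cvec.subspace_scale[OF V])
    fix x y assume xy: "x \<in> N" "y \<in> N"
    have "bracket (bracket x y) v = bracket x (bracket y v) - bracket y (bracket x v)" for v
      by (simp add: bracket_leibniz[of x y v])
    then show "bracket x y \<in> N" using xy by (simp add: N_def cvec.subspace_diff[OF V])
  qed
  have genN: "subalgebra_generated S \<subseteq> N"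
    by (rule subalgebra_generated_least[OF N]) (auto simp: N_def SV2)
  have "V \<subseteq> subalgebra_generated S"
    unfolding V_def
  proof (rule cvec.span_minimal)
    have "S \<subseteq> subalgebra_generated S" by (rule subalgebra_generated_base)
    then have "e i \<in> subalgebra_generated S" "f i \<in> subalgebra_generated S"
      "h \<subseteq> subalgebra_generated S" for i by (auto simp: S_def)
    then show "h \<union> range (comm_eval e) \<union> range (comm_eval f) \<subseteq> subalgebra_generated S"
      by (intro Un_least image_subsetI comm_eval_in_subalgebra[OF lie_subalgebra_generated]) auto
  qed (rule lie_subalgebraD(1)[OF lie_subalgebra_generated])
  then have "lie_subalgebra V"
    using genN V by (auto simp: lie_subalgebra_def N_def)
  then have "subalgebra_generated S \<subseteq> V"
    using SV by (rule subalgebra_generated_least)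
  then show ?thesis
    unfolding S_def V_def .
qed

section \<open>The pairing on flags\<close>

lemma lookup_scaleC: "Poly_Mapping.lookup (c *\<^sub>C x) k = c *\<^sub>C Poly_Mapping.lookup x k"
  by (simp add: scaleC_poly_mapping.rep_eq)

text \<open>\<open>pairing\<close> sums over the support, which changes under addition; linearity
  needs a common finite index set.\<close>

lemma pairing_superset:
  assumes "finite A" "Poly_Mapping.keys x \<subseteq> A"
  shows "pairing \<omega> m x hs = (\<Sum>Fl\<in>A. Poly_Mapping.lookup x Fl * flag_pairing \<omega> m Fl hs)"
  unfolding pairing_def using assms by (intro sum.mono_neutral_left) (auto simp: in_keys_iff)

lemma clinear_pairing: "clinear (\<lambda>x. pairing \<omega> m x hs)"
proof (rule clinearI)
  fix x y :: "point set list \<Rightarrow>\<^sub>0 complex" and c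
  let ?A = "Poly_Mapping.keys x \<union> Poly_Mapping.keys y"
  have "Poly_Mapping.keys (x + y) \<subseteq> ?A" by (rule Poly_Mapping.keys_add)
  then show "pairing \<omega> m (x + y) hs = pairing \<omega> m x hs + pairing \<omega> m y hs"
    by (simp add: pairing_superset[of ?A] lookup_add algebra_simps sum.distrib)
  have "Poly_Mapping.keys (c *\<^sub>C x) \<subseteq> Poly_Mapping.keys x"
    by (auto simp: in_keys_iff lookup_scaleC scaleC_complex_def)
  then show "pairing \<omega> m (c *\<^sub>C x) hs = c *\<^sub>C pairing \<omega> m x hs"
    by (simp add: pairing_superset[of "Poly_Mapping.keys x"] lookup_scaleC scaleC_complex_def
        sum_distrib_left mult.assoc)
qed

lemma pairing_single: "pairing \<omega> m (Poly_Mapping.single Fl c) hs = c * flag_pairing \<omega> m Fl hs"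
  by (simp add: pairing_superset[of "{Fl}"])

section \<open>Dimensions and coordinate flats\<close>

lemma cvec_dim_psubset:
  fixes S T :: "'a::complex_vector set"
  assumes "cvec.subspace S" "S \<subset> T" "T \<subseteq> cvec.span F" "finite F"
  shows "cvec.dim S < cvec.dim T"
proof -
  obtain b where b: "b \<subseteq> S" "cvec.independent b" "S \<subseteq> cvec.span b" "card b = cvec.dim S"
    using cvec.basis_exists by blast
  obtain c where c: "c \<subseteq> T" "cvec.independent c" "T \<subseteq> cvec.span c" "card c = cvec.dim T"
    using cvec.basis_exists by blast
  obtain v where v: "v \<in> T" "v \<notin> S" using assms(2) by blast
  have "cvec.span b \<subseteq> S" using b(1) assms(1) by (rule cvec.span_minimal)
  then have "v \<notin> cvec.span b" using v by blast
  then have ind: "cvec.independent (insert v b)" using b(2) by (rule cvec.independent_insertI)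
  \<comment> \<open>The ambient space may be infinite-dimensional; the basis of \<open>T\<close> is
    finite because \<open>T\<close> lies in the span of the finite set \<open>F\<close>.\<close>
  have fc: "finite c"
    using cvec.independent_span_bound[OF assms(4) c(2)] c(1) assms(3) by blast
  have "insert v b \<subseteq> cvec.span c" using b(1) assms(2) v(1) c(3) by blast
  then have fb: "finite (insert v b)" "card (insert v b) \<le> card c"
    using cvec.independent_span_bound[OF fc ind] by auto
  have "v \<notin> b" using b(1) v(2) by blast
  then show ?thesis using fb b(4) c(4) by simp
qed

definition coord_flat :: "nat \<Rightarrow> nat set \<Rightarrow> point set" where
  "coord_flat m P = {t \<in> Cm m. \<forall>p\<in>P. Poly_Mapping.lookup t p = 0}"

text \<open>The unit vectors outside \<open>P\<close> yield the subspace property and, with their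
  independence, the dimension. The case \<open>P = {}\<close> bounds every intersection of
  hyperplanes by a finitely spanned space.\<close>

lemma coord_flat_eq_span:
  "coord_flat m P = cvec.span ((\<lambda>i. Poly_Mapping.single i 1) ` ({1..m} - P))"
proof
  show "cvec.span ((\<lambda>i. Poly_Mapping.single i 1) ` ({1..m} - P)) \<subseteq> coord_flat m P"
  proof (rule cvec.span_minimal)
    show "(\<lambda>i. Poly_Mapping.single i 1) ` ({1..m} - P) \<subseteq> coord_flat m P"
      by (auto simp: coord_flat_def Cm_def lookup_single when_def)
    show "cvec.subspace (coord_flat m P)"
    proof (rule cvec.subspaceI)
      fix x y assume xy: "x \<in> coord_flat m P" "y \<in> coord_flat m P"
      have "Poly_Mapping.keys (x + y) \<subseteq> Poly_Mapping.keys x \<union> Poly_Mapping.keys y"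
        by (rule Poly_Mapping.keys_add)
      then show "x + y \<in> coord_flat m P" using xy by (auto simp: coord_flat_def Cm_def lookup_add)
    next
      fix c x assume x: "x \<in> coord_flat m P"
      have "Poly_Mapping.keys (c *\<^sub>C x) \<subseteq> Poly_Mapping.keys x"
        by (auto simp: in_keys_iff lookup_scaleC scaleC_complex_def)
      then show "c *\<^sub>C x \<in> coord_flat m P"
        using x by (auto simp: coord_flat_def Cm_def lookup_scaleC scaleC_complex_def)
    qed (simp add: coord_flat_def Cm_def)
  qed
  show "coord_flat m P \<subseteq> cvec.span ((\<lambda>i. Poly_Mapping.single i 1) ` ({1..m} - P))"
  proof
    fix t assume t: "t \<in> coord_flat m P"
    have "t = (\<Sum>i\<in>{1..m} - P. Poly_Mapping.lookup t i *\<^sub>C Poly_Mapping.single i 1)"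
    proof (rule poly_mapping_eqI)
      fix k
      have "k \<in> {1..m} - P" if "Poly_Mapping.lookup t k \<noteq> 0"
        using t that by (force simp: coord_flat_def Cm_def in_keys_iff)
      moreover have "Poly_Mapping.lookup
          (\<Sum>i\<in>{1..m} - P. Poly_Mapping.lookup t i *\<^sub>C Poly_Mapping.single i 1) k =
          (\<Sum>i\<in>{1..m} - P. if i = k then Poly_Mapping.lookup t i else 0)"
        unfolding lookup_sum
        by (intro sum.cong) (simp_all add: lookup_scaleC lookup_single scaleC_complex_def when_def)
      ultimately show "Poly_Mapping.lookup t k = Poly_Mapping.lookup
          (\<Sum>i\<in>{1..m} - P. Poly_Mapping.lookup t i *\<^sub>C Poly_Mapping.single i 1) k"
        by (auto simp: sum.delta)
    qed
    then show "t \<in> cvec.span ((\<lambda>i. Poly_Mapping.single i 1) ` ({1..m} - P))"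
      by (metis (no_types, lifting) cvec.span_base cvec.span_scale cvec.span_sum imageI)
  qed
qed

lemma inj_single: "inj (\<lambda>i. Poly_Mapping.single i (1::complex))"
  by (rule injI) (metis lookup_single_eq lookup_single_not_eq one_neq_zero)

lemma dim_coord_flat: "cvec.dim (coord_flat m P) = card ({1..m} - P)"
proof -
  let ?e = "\<lambda>i::nat. Poly_Mapping.single i (1::complex)"
  have "cvec.independent (?e ` ({1..m} - P))"
  proof (rule cvec.independent_if_scalars_zero)
    fix f x assume 0: "(\<Sum>y\<in>?e ` ({1..m} - P). f y *\<^sub>C y) = 0" and "x \<in> ?e ` ({1..m} - P)"
    then obtain k where k: "x = ?e k" "k \<in> {1..m} - P" by blast
    have "Poly_Mapping.lookup (\<Sum>i\<in>{1..m} - P. f (?e i) *\<^sub>C ?e i) k = 0"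
      using 0 by (simp add: sum.reindex[OF inj_on_subset[OF inj_single]])
    moreover have "Poly_Mapping.lookup (\<Sum>i\<in>{1..m} - P. f (?e i) *\<^sub>C ?e i) k =
        (\<Sum>i\<in>{1..m} - P. if i = k then f (?e i) else 0)"
      unfolding lookup_sum
      by (intro sum.cong) (simp_all add: lookup_scaleC lookup_single scaleC_complex_def when_def)
    ultimately show "f x = 0" using k by (simp add: sum.delta)
  qed simp
  then have "cvec.dim (coord_flat m P) = card (?e ` ({1..m} - P))"
    unfolding coord_flat_eq_span by (rule cvec.dim_span_eq_card_independent)
  then show ?thesis
    by (simp only: card_image[OF inj_on_subset[OF inj_single subset_UNIV]])
qed

lemma codim_coord_flat:
  assumes "P \<subseteq> {1..m}"
  shows "codim m (coord_flat m P) = card P"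
proof -
  have "finite P" "card P \<le> m"
    using assms finite_subset card_mono[OF _ assms] by auto
  then show ?thesis
    by (simp add: codim_def dim_coord_flat card_Diff_subset[OF _ assms] del: One_nat_def)
qed

lemma coord_flat_eq_hyp_inter: "coord_flat m P = hyp_inter \<omega> m (Coord ` P)"
  by (simp add: coord_flat_def hyp_inter_def)

lemma coord_flat_empty: "coord_flat m {} = Cm m"
  by (simp add: coord_flat_def)

section \<open>Intersections of hyperplanes\<close>

lemma subspace_hyp_inter: "cvec.subspace (hyp_inter \<omega> m S)"
proof (rule cvec.subspaceI)
  have Cm: "cvec.subspace (Cm m)"
    using coord_flat_eq_span[of m "{}"] by (simp add: coord_flat_empty)
  have on: "on_hyperplane \<omega> h 0"
    "on_hyperplane \<omega> h x \<Longrightarrow> on_hyperplane \<omega> h y \<Longrightarrow> on_hyperplane \<omega> h (x + y)"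
    "on_hyperplane \<omega> h x \<Longrightarrow> on_hyperplane \<omega> h (c *\<^sub>C x)" for h x y c
    by (cases h; simp add: lookup_add lookup_scaleC scaleC_complex_def algebra_simps)+
  show "0 \<in> hyp_inter \<omega> m S" using Cm by (simp add: hyp_inter_def on cvec.subspace_0)
  fix x y c assume "x \<in> hyp_inter \<omega> m S" 
  then show "c *\<^sub>C x \<in> hyp_inter \<omega> m S" using Cm by (simp add: hyp_inter_def on cvec.subspace_scale)
  assume "x \<in> hyp_inter \<omega> m S" "y \<in> hyp_inter \<omega> m S"
  then show "x + y \<in> hyp_inter \<omega> m S" using Cm by (simp add: hyp_inter_def on cvec.subspace_add)
qed

lemma hyp_inter_insert: "hyp_inter \<omega> m (insert h S) = hyp_inter \<omega> m S \<inter> hyp_inter \<omega> m {h}"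
  by (auto simp: hyp_inter_def)

lemma hyp_inter_psubset_dim:
  assumes "hyp_inter \<omega> m S \<subset> hyp_inter \<omega> m S'"
  shows "cvec.dim (hyp_inter \<omega> m S) < cvec.dim (hyp_inter \<omega> m S')"
proof (rule cvec_dim_psubset[OF subspace_hyp_inter assms])
  show "hyp_inter \<omega> m S' \<subseteq> cvec.span ((\<lambda>i. Poly_Mapping.single i 1) ` ({1..m} - {}))"
    unfolding coord_flat_eq_span[symmetric] by (auto simp: hyp_inter_def coord_flat_def)
qed simp

text \<open>Move \<open>u\<close> along \<open>v\<close> until it meets \<open>b\<close>: since
  \<open>v\<close> lies on \<open>a\<close>, the equation of \<open>a\<close> keeps its non-zero
  value on the way. This is what allows two consecutive hyperplanes of a flag to be exchanged
  without losing strictness.\<close>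

lemma hyp_inter_not_between:
  assumes "X = hyp_inter \<omega> m S" "v \<in> X" "v \<in> hyp_inter \<omega> m {a}" "v \<notin> hyp_inter \<omega> m {b}"
    and "u \<in> X" "u \<notin> hyp_inter \<omega> m {a}"
  shows "\<exists>w\<in>X. w \<in> hyp_inter \<omega> m {b} \<and> w \<notin> hyp_inter \<omega> m {a}"
proof -
  define f where "f h t = (case h of Diag i j k \<Rightarrow> Poly_Mapping.lookup t i - \<omega> ^ k * Poly_Mapping.lookup t j
    | Coord i \<Rightarrow> Poly_Mapping.lookup t i)" for h and t :: point
  have on: "on_hyperplane \<omega> h t \<longleftrightarrow> f h t = 0" for h t by (cases h) (simp_all add: f_def)
  have lin: "f h (x - c *\<^sub>C y) = f h x - c * f h y" for h x y c
    by (cases h) (simp_all add: f_def lookup_minus lookup_scaleC scaleC_complex_def algebra_simps)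
  have X: "cvec.subspace X" unfolding assms(1) by (rule subspace_hyp_inter)
  have XC: "X \<subseteq> Cm m" by (auto simp: assms(1) hyp_inter_def)
  define w where "w = u - (f b u / f b v) *\<^sub>C v"
  have "w \<in> X" unfolding w_def using assms by (intro cvec.subspace_diff cvec.subspace_scale X)
  moreover have "f b v \<noteq> 0" "f a v = 0" "f a u \<noteq> 0"
    using assms XC by (auto simp: hyp_inter_def on)
  then have "f b w = 0" "f a w \<noteq> 0" by (simp_all add: w_def lin)
  ultimately show ?thesis using XC by (intro bexI[of _ w]) (auto simp: hyp_inter_def on)
qed

section \<open>Flags and their orderings by hyperplanes\<close>

lemma flags_strict:
  assumes "Fl \<in> flags T \<omega> m p" "k < p"
  shows "Fl ! Suc k \<subset> Fl ! k"
proof -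
  have "Fl ! Suc k \<subseteq> Fl ! k" "codim m (Fl ! Suc k) = Suc k" "codim m (Fl ! k) = k"
    using assms by (auto simp: flags_def)
  then show ?thesis by (metis n_not_Suc_n psubsetI)
qed

lemma flags_mono:
  assumes "Fl \<in> flags T \<omega> m p" "a \<le> b" "b \<le> p"
  shows "Fl ! b \<subseteq> Fl ! a"
  using assms(2,3)
proof (induction b rule: dec_induct)
  case (step n)
  then show ?case using flags_strict[OF assms(1), of n] by auto
qed simp

lemma flag_order_Suc:
  assumes "flag_order \<omega> m Fl hs s" "k < length hs"
  shows "Fl ! Suc k = Fl ! k \<inter> hyp_inter \<omega> m {hs ! s k}"
proof -
  have "Fl ! Suc k = hyp_inter \<omega> m (insert (hs ! s k) ((\<lambda>j. hs ! s j) ` {..<k}))"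
    "Fl ! k = hyp_inter \<omega> m ((\<lambda>j. hs ! s j) ` {..<k})"
    using assms by (auto simp: flag_order_def lessThan_Suc)
  then show ?thesis by (simp only: hyp_inter_insert[symmetric])
qed

text \<open>The inclusions of a flag are strict, so a hyperplane cannot contain an edge before the
  step that adds it. Its position in the ordering is therefore visible from the edges alone.\<close>

lemma flag_order_subset_iff:
  assumes "Fl \<in> flags T \<omega> m p" "length hs = p" "flag_order \<omega> m Fl hs s" "k < p" "a \<le> p"
  shows "Fl ! a \<subseteq> hyp_inter \<omega> m {hs ! s k} \<longleftrightarrow> k < a"
proof
  assume *: "Fl ! a \<subseteq> hyp_inter \<omega> m {hs ! s k}"
  show "k < a"
  proof (rule ccontr)
    assume "\<not> k < a"
    then have "Fl ! k \<subseteq> hyp_inter \<omega> m {hs ! s k}"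
      using * flags_mono[OF assms(1), of a k] assms(4) by auto
    moreover have "Fl ! Suc k = Fl ! k \<inter> hyp_inter \<omega> m {hs ! s k}"
      using flag_order_Suc[OF assms(3)] assms(2,4) by simp
    ultimately show False using flags_strict[OF assms(1,4)] by auto
  qed
next
  assume "k < a"
  then show "Fl ! a \<subseteq> hyp_inter \<omega> m {hs ! s k}"
    using assms(2-5) by (auto simp: flag_order_def hyp_inter_def)
qed

text \<open>Among the given hyperplanes, the one in position \<open>k\<close> is singled out by
  containing edge \<open>k + 1\<close> but not edge \<open>k\<close>. With \<open>Fl = Fl'\<close>
  this gives uniqueness of the ordering; for flags differing in one edge it controls all but two
  positions.\<close>

lemma flag_order_agree:
  assumes "Fl \<in> flags T \<omega> m p" "Fl' \<in> flags T \<omega> m p" "length hs = p"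
    and "flag_order \<omega> m Fl hs s" "flag_order \<omega> m Fl' hs r"
    and "k < p" "Fl ! k = Fl' ! k" "Fl ! Suc k = Fl' ! Suc k"
  shows "r k = s k"
proof -
  have perm: "s permutes {..<p}" "r permutes {..<p}"
    using assms(3-5) by (auto simp: flag_order_def)
  have "r k < p" using permutes_in_image[OF perm(2), of k] assms(6) by simp
  then have "r k \<in> s ` {..<p}" using permutes_image[OF perm(1)] by simp
  then obtain k' where k': "k' < p" "r k = s k'" by auto
  have "k' < Suc k"
    using flag_order_subset_iff[OF assms(1,3,4) k'(1), of "Suc k"]
      flag_order_subset_iff[OF assms(2,3,5,6), of "Suc k"] assms(6,8) k' by simp
  moreover have "\<not> k' < k"
    using flag_order_subset_iff[OF assms(1,3,4) k'(1), of k]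
      flag_order_subset_iff[OF assms(2,3,5,6), of k] assms(6,7) k' by simp
  ultimately have "k' = k" by linarith
  then show ?thesis using k'(2) by simp
qed

lemma flag_pairing_eq:
  assumes "Fl \<in> flags T \<omega> m p" "length hs = p" "flag_order \<omega> m Fl hs s"
  shows "flag_pairing \<omega> m Fl hs = of_int (sign s)"
proof -
  have "r = s" if "flag_order \<omega> m Fl hs r" for r
  proof
    fix k
    have "s permutes {..<p}" "r permutes {..<p}"
      using assms that by (auto simp: flag_order_def)
    then show "r k = s k"
      using flag_order_agree[OF assms(1,1,2,3) that, of k] by (cases "k < p") (auto simp: permutes_not_in)
  qed
  then have "(THE s. flag_order \<omega> m Fl hs s) = s" using assms(3) by blast
  then show ?thesis using assms(3) by (auto simp: flag_pairing_def)
qed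

text \<open>If one completion pairs non-trivially, with ordering \<open>s\<close>, then exactly one other does: its ordering
  is \<open>s\<close> composed with a transposition, so the two values cancel.\<close>

lemma sum_flag_pairing_completions:
  assumes Fl: "Fl \<in> flags T \<omega> m p" and i: "0 < i" "i < p" "p \<le> m"
    and hs: "length hs = p" "set hs \<subseteq> hyperplanes T m"
  shows "(\<Sum>L | Fl[i := L] \<in> flags T \<omega> m p. flag_pairing \<omega> m (Fl[i := L]) hs) = 0"
proof (cases "\<exists>L s. Fl[i := L] \<in> flags T \<omega> m p \<and> flag_order \<omega> m (Fl[i := L]) hs s")
  case False
  then show ?thesis by (intro sum.neutral) (auto simp: flag_pairing_def)
next
  case True
  note One_nat_def [simp del]
  from True obtain L\<^sub>0 s where L0: "Fl[i := L\<^sub>0] \<in> flags T \<omega> m p"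
    and s: "flag_order \<omega> m (Fl[i := L\<^sub>0]) hs s" by blast
  define F where "F = Fl[i := L\<^sub>0]"
  have F: "F \<in> flags T \<omega> m p" and sF: "flag_order \<omega> m F hs s" using L0 s by (simp_all add: F_def)
  have lenF: "length F = Suc p" using F by (simp add: flags_def)
  have Fi: "F ! i = L\<^sub>0" using lenF i by (simp add: F_def)
  have upd: "Fl[i := L] = F[i := L]" for L by (simp add: F_def)
  have sp: "s permutes {..<p}" using sF hs by (simp add: flag_order_def)
  \<comment> \<open>Edge number k depends only on the set of the first k hyperplanes, so exchanging
    positions \<open>i - 1\<close> and \<open>i\<close> alters edge \<open>i\<close> and no
    other.\<close>
  define t where "t = s \<circ> transpose (i - 1) i"
  have tp: "t permutes {..<p}"
    unfolding t_def by (rule permutes_compose[OF permutes_swap_id sp]) (use i in auto)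
  have sign_t: "sign t = - sign s"
    unfolding t_def using i sp permutes_imp_permutation[OF finite_lessThan sp]
    by (subst sign_compose) (auto simp: permutation_swap_id sign_swap_id)
  define a b where "a = hs ! s (i - 1)" and "b = hs ! s i"
  define A where "A = (\<lambda>j. hs ! s j) ` {..<i - 1}"
  define X where "X = hyp_inter \<omega> m A"
  define L\<^sub>1 where "L\<^sub>1 = X \<inter> hyp_inter \<omega> m {b}"
  have L1: "L\<^sub>1 = hyp_inter \<omega> m (insert b A)" unfolding L\<^sub>1_def X_def by (rule hyp_inter_insert[symmetric])
  have FX: "F ! (i - 1) = X" using sF i hs by (simp add: X_def A_def flag_order_def)
  have F0: "F ! i = X \<inter> hyp_inter \<omega> m {a}"
    using flag_order_Suc[OF sF, of "i - 1"] i hs by (simp add: FX a_def)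
  have FS: "F ! Suc i = F ! i \<inter> hyp_inter \<omega> m {b}"
    using flag_order_Suc[OF sF, of i] i hs by (simp add: b_def)
  have st1: "F ! i \<subset> X" using flags_strict[OF F, of "i - 1"] i by (simp add: FX)
  have st2: "F ! Suc i \<subset> F ! i" using flags_strict[OF F, of i] i by simp
  have L1X: "L\<^sub>1 \<subset> X" using st2 FS F0 by (auto simp: L\<^sub>1_def)
  have FL1: "F ! Suc i \<subset> L\<^sub>1"
  proof -
    obtain v where v: "v \<in> F ! i" "v \<notin> F ! Suc i" using st2 by blast
    obtain u where u: "u \<in> X" "u \<notin> F ! i" using st1 by blast
    have "\<exists>w\<in>X. w \<in> hyp_inter \<omega> m {b} \<and> w \<notin> hyp_inter \<omega> m {a}"
      by (rule hyp_inter_not_between[OF X_def]) (use u v F0 FS in auto)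
    then show ?thesis using F0 FS by (auto simp: L\<^sub>1_def)
  qed
  have L1L0: "L\<^sub>1 \<noteq> L\<^sub>0" using FL1 FS Fi by (auto simp: L\<^sub>1_def)
  have FSi: "F ! Suc i = hyp_inter \<omega> m ((\<lambda>j. hs ! s j) ` {..<Suc i})"
    using sF i hs by (simp add: flag_order_def)
  have dims: "cvec.dim (F ! Suc i) < cvec.dim L\<^sub>1" "cvec.dim L\<^sub>1 < cvec.dim X"
    using hyp_inter_psubset_dim FL1 L1X unfolding L1 FSi X_def by blast+
  have cod: "codim m (F ! k) = k" "F ! k \<in> edges T \<omega> m" if "k \<le> p" for k
    using F that by (auto simp: flags_def)
  \<comment> \<open>\<open>codim\<close> is a truncated subtraction, so
    \<open>cvec.dim X \<le> m\<close> is needed to recover dimensions from codimensions. Then the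
    dimension of \<open>L\<^sub>1\<close> lies strictly between two numbers that differ by
    two.\<close>
  have "X \<subseteq> coord_flat m {}" by (auto simp: X_def hyp_inter_def coord_flat_def)
  then have "cvec.dim X \<le> m"
    using cvec.dim_le_card[of X "(\<lambda>i. Poly_Mapping.single i 1) ` ({1..m} - {})"]
    card_image_le[of "{1..m} - {}" "\<lambda>i. Poly_Mapping.single i (1::complex)"]
    by (simp add: coord_flat_eq_span)
  moreover have "m - cvec.dim X = i - 1" "m - cvec.dim (F ! Suc i) = Suc i"
    using cod(1)[of "i - 1"] cod(1)[of "Suc i"] i by (simp_all add: codim_def FX)
  ultimately have codL1: "codim m L\<^sub>1 = i" using dims i unfolding codim_def by linarith
  have sh: "hs ! s j \<in> hyperplanes T m" if "j < p" for j
    using permutes_in_image[OF sp, of j] that hs by (auto intro!: subsetD[OF hs(2)] nth_mem)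
  have edge: "L\<^sub>1 \<in> edges T \<omega> m"
    unfolding edges_def
  proof (intro CollectI exI conjI)
    show "insert b A \<subseteq> hyperplanes T m" using sh i by (auto simp: A_def b_def)
    show "hyp_inter \<omega> m (insert b A) \<noteq> {}"
      using cvec.subspace_0[OF subspace_hyp_inter] by blast
  qed (rule L1)
  have nth1: "F[i := L\<^sub>1] ! k = (if k = i then L\<^sub>1 else F ! k)" for k
    using lenF i by simp
  have F1: "F[i := L\<^sub>1] \<in> flags T \<omega> m p"
    unfolding flags_def
  proof (intro CollectI conjI allI impI)
    show "F[i := L\<^sub>1] ! 0 = Cm m" using F i by (simp add: flags_def)
    fix k
    {
      assume "k \<le> p"
      then show "F[i := L\<^sub>1] ! k \<in> edges T \<omega> m" "codim m (F[i := L\<^sub>1] ! k) = k"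
        unfolding nth1 using cod edge codL1 by simp_all
    next
      assume "k < p"
      then show "F[i := L\<^sub>1] ! Suc k \<subseteq> F[i := L\<^sub>1] ! k"
        unfolding nth1 using flags_strict[OF F, of k] FL1 L1X FX by auto
    }
  qed (simp add: lenF)
  have t1: "flag_order \<omega> m (F[i := L\<^sub>1]) hs t"
    unfolding flag_order_def
  proof (intro conjI allI impI)
    show "t permutes {..<length hs}" using tp hs by simp
    show "length (F[i := L\<^sub>1]) = Suc (length hs)" using lenF hs by simp
    fix k assume k: "k \<le> length hs"
    have ts: "(\<lambda>j. hs ! t j) ` {..<k} = (\<lambda>j. hs ! s j) ` transpose (i - 1) i ` {..<k}"
      by (simp add: t_def image_image)
    consider "k < i" | "k = i" | "i < k" by linarith
    then show "F[i := L\<^sub>1] ! k = hyp_inter \<omega> m ((\<lambda>j. hs ! t j) ` {..<k})"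
    proof cases
      case 1
      have "transpose (i - 1) i ` {..<k} = {..<k}"
        using 1 by (auto simp: transpose_def image_iff)
      then show ?thesis using 1 sF k by (simp add: ts flag_order_def)
    next
      case 2
      have "{..<i} = insert (i - 1) {..<i - 1}" using i by auto
      then have "transpose (i - 1) i ` {..<i} = insert i {..<i - 1}"
        using i by (auto simp: transpose_def image_iff)
      then have "(\<lambda>j. hs ! t j) ` {..<i} = insert b A" by (simp only: ts 2[symmetric]) (simp add: 2 A_def b_def)
      then show ?thesis using 2 lenF i by (simp add: L1)
    next
      case 3
      have "transpose (i - 1) i ` {..<k} = {..<k}"
        by (rule permutes_image, rule permutes_swap_id) (use 3 in auto)
      then show ?thesis using 3 sF k by (simp add: ts flag_order_def)
    qed
  qed
  \<comment> \<open>\<open>r\<close> agrees with \<open>s\<close> away from \<open>i - 1\<close> and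
    \<open>i\<close>, so two values are left for \<open>r (i - 1)\<close>, and each determines the
    edge.\<close>
  have only: "L = L\<^sub>0 \<or> L = L\<^sub>1"
    if "F[i := L] \<in> flags T \<omega> m p" and r: "flag_order \<omega> m (F[i := L]) hs r" for L r
  proof -
    have rp: "r permutes {..<p}" using r hs by (simp add: flag_order_def)
    have agree: "r k = s k" if "k < p" "k \<noteq> i - 1" "k \<noteq> i" for k
      by (rule flag_order_agree[OF F \<open>F[i := L] \<in> flags T \<omega> m p\<close> hs(1) sF r]) (use that i in auto)
    have "r (i - 1) \<in> s ` {..<p}"
      using permutes_in_image[OF rp, of "i - 1"] i by (simp add: permutes_image[OF sp])
    then obtain k where k: "k < p" "r (i - 1) = s k" by auto
    have "k = i - 1 \<or> k = i"
    proof (rule ccontr)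
      assume "\<not> (k = i - 1 \<or> k = i)"
      then have "r (i - 1) = r k" using agree[of k] k by simp
      then show False using permutes_inj[OF rp] \<open>\<not> (k = i - 1 \<or> k = i)\<close> by (auto dest: injD)
    qed
    then have "hs ! r (i - 1) = a \<or> hs ! r (i - 1) = b" using k by (auto simp: a_def b_def)
    moreover have "L = X \<inter> hyp_inter \<omega> m {hs ! r (i - 1)}"
      using flag_order_Suc[OF r, of "i - 1"] i hs lenF FX by simp
    ultimately show ?thesis using F0 Fi by (auto simp: L\<^sub>1_def)
  qed
  let ?S = "{L. Fl[i := L] \<in> flags T \<omega> m p}"
  \<comment> \<open>A sum over an infinite set is 0 by convention, which disposes of that
    case.\<close>
  show ?thesis
  proof (cases "finite ?S")
    case fin: True
    have "(\<Sum>L\<in>?S. flag_pairing \<omega> m (Fl[i := L]) hs) =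
        (\<Sum>L\<in>{L\<^sub>0, L\<^sub>1}. flag_pairing \<omega> m (Fl[i := L]) hs)"
    proof (rule sum.mono_neutral_right[OF fin])
      show "{L\<^sub>0, L\<^sub>1} \<subseteq> ?S" using L0 F1 by (simp add: upd)
      show "\<forall>L\<in>?S - {L\<^sub>0, L\<^sub>1}. flag_pairing \<omega> m (Fl[i := L]) hs = 0"
        using only by (auto simp: flag_pairing_def upd)
    qed
    also have "\<dots> = of_int (sign s) + of_int (sign t)"
      using L1L0 flag_pairing_eq[OF L0 hs(1) s] flag_pairing_eq[OF F1 hs(1) t1] by (simp add: upd)
    finally show ?thesis by (simp add: sign_t)
  qed simp
qed

text \<open>This makes the pairing a function on \<open>\<F>\<^sup>p\<close>, so that a value of
  \<open>\<psi>\<close>, known only up to \<open>flag_equiv\<close>, can be paired with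
  hyperplanes.\<close>

lemma pairing_flag_relations:
  assumes "x \<in> flag_relations T \<omega> m p" "p \<le> m" "length hs = p" "set hs \<subseteq> hyperplanes T m"
  shows "pairing \<omega> m x hs = 0"
proof -
  have "pairing \<omega> m x hs \<in> {0}"
  proof (rule clinear_mem_span[OF clinear_pairing assms(1)[unfolded flag_relations_def]])
    fix x :: "point set list \<Rightarrow>\<^sub>0 complex"
    assume "x \<in> {(\<Sum>L | Fl[i := L] \<in> flags T \<omega> m p. Poly_Mapping.single (Fl[i := L]) 1) | Fl i.
        Fl \<in> flags T \<omega> m p \<and> 0 < i \<and> i < p}"
    then show "pairing \<omega> m x hs \<in> {0}"
      using sum_flag_pairing_completions assms
      by (auto simp: clinear_sum[OF clinear_pairing] pairing_single)
  qed simp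
  then show ?thesis by simp
qed

section \<open>The values of \<open>\<psi>\<^sub>0\<close> on words in barred generators\<close>

text \<open>The sums over 0, ..., n - 1 and over 1, ..., n differ only in their end terms.\<close>

lemma bar_shift:
  assumes "(f ^^ n) x = x"
  shows "bar n f (f x) = bar n f (x :: 'a::ab_group_add)"
proof -
  have "(\<Sum>k<n. (f ^^ k) (f x)) = (\<Sum>k<n. (f ^^ Suc k) x)" by (simp add: funpow_swap1)
  also have "\<dots> = (\<Sum>k<Suc n. (f ^^ k) x) - x" by (simp add: sum.lessThan_Suc_shift del: sum.lessThan_Suc)
  finally show ?thesis using assms by (simp add: bar_def)
qed

lemma bar_fixed:
  assumes "(f ^^ n) x = x" and "clinear f"
  shows "f (bar n f x) = bar n f x"
proof -
  have "f (bar n f x) = bar n f (f x)"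
    by (simp add: bar_def clinear_sum[OF assms(2)] funpow_swap1)
  then show ?thesis using bar_shift assms(1) by metis
qed

lemma clinear_tau: "clinear (\<tau> T)"
  unfolding \<tau>_def by (rule lie_hom_clinear[OF lie_extend_hom])

lemma tau_bracket: "\<tau> T (bracket x y) = bracket (\<tau> T x) (\<tau> T y)"
  using lie_extend_hom unfolding \<tau>_def lie_hom_on_def by blast

lemma tau_f_gen: "\<tau> T (f_gen T i k) = f_gen T i (Suc k)"
  by (simp add: \<tau>_def f_gen_def lie_extend_gen mod_Suc_eq)

lemma tau_funpow_f_gen: "(\<tau> T ^^ k) (f_gen T i l) = f_gen T i (l + k)"
  by (induction k) (simp_all add: tau_f_gen)

definition f_bar :: "nat \<Rightarrow> nat \<Rightarrow> (nat \<times> nat) free_lie" where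
  "f_bar T p = bar T (\<tau> T) (f_gen T p 0)"

lemma f_bar_eq: "f_bar T p = (\<Sum>k<T. f_gen T p k)"
  by (simp add: f_bar_def bar_def tau_funpow_f_gen)

lemma comm_bar_Leaf: "comm_bar T (Leaf (p, 0)) = f_bar T p"
  by (simp add: comm_bar_def f_bar_def f_gen_def)

lemma tau_f_bar: "\<tau> T (f_bar T p) = f_bar T p"
  unfolding f_bar_def
  by (rule bar_fixed[OF _ clinear_tau]) (simp add: tau_funpow_f_gen, simp add: f_gen_def)

lemma lie_subalgebra_abar: "lie_subalgebra (abar_alg T m)"
proof -
  have a: "lie_subalgebra (a_alg T m)" unfolding a_alg_def by (rule lie_subalgebra_generated)
  have "cvec.subspace (fixed_points (\<tau> T))"
    by (rule cvec.subspaceI)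
      (simp_all add: fixed_points_def clinear_0 clinear_add clinear_scale clinear_tau)
  then show ?thesis
    using lie_subalgebraD[OF a] unfolding lie_subalgebra_def abar_alg_def
    by (auto simp: fixed_points_def tau_bracket intro: cvec.subspace_inter)
qed

lemma f_bar_in_abar:
  assumes "p \<in> {1..m}"
  shows "f_bar T p \<in> abar_alg T m"
proof -
  have "f_gen T p k \<in> a_alg T m" if "k < T" for k
    unfolding a_alg_def by (rule subsetD[OF subalgebra_generated_base]) (use assms that in blast)
  then have "f_bar T p \<in> a_alg T m"
    unfolding f_bar_eq a_alg_def
    by (intro cvec.subspace_sum lie_subalgebraD(1) lie_subalgebra_generated) auto
  then show ?thesis by (simp add: abar_alg_def fixed_points_def tau_f_bar)
qed

lemma comm_f_bar_in_abar:
  assumes "set (letters c) \<subseteq> {1..m}"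
  shows "comm_eval (f_bar T) c \<in> abar_alg T m"
  using assms by (intro comm_eval_in_subalgebra[OF lie_subalgebra_abar] f_bar_in_abar) auto

text \<open>All residues of one generator have the same degree, so barring preserves homogeneity and
  letters alone determine the degree.\<close>

lemma comm_f_bar_in_component:
  assumes "set (letters c) \<subseteq> {1..m}"
  shows "comm_eval (f_bar T) c \<in> a_component T m (count_list (letters c))"
proof -
  have "f_bar T p \<in> cvec.span (free_gen ` ({p} \<times> {..<T}))" for p
    unfolding f_bar_eq by (intro cvec.span_sum cvec.span_base) (auto simp: f_gen_def)
  then have "comm_eval (f_bar T) c \<in> cvec.span {comm_eval free_gen c' | c'.
      list_all2 (\<lambda>l' l. l' \<in> {l} \<times> {..<T}) (letters c') (letters c)}"
    by (intro comm_eval_span)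
  also have "\<dots> \<subseteq> a_component T m (count_list (letters c))"
    unfolding a_component_def
  proof (intro cvec.span_mono Collect_mono, clarify)
    fix c' assume "list_all2 (\<lambda>l' l. l' \<in> {l} \<times> {..<T}) (letters c') (letters c)"
    then have 1: "map fst (letters c') = letters c" "set (letters c') \<subseteq> UNIV \<times> {..<T}"
      by (induction rule: list_all2_induct) auto
    have "fst ` set (letters c') = set (letters c)" using 1(1) by (metis list.set_map)
    then have "set (letters c') \<subseteq> {1..m} \<times> {..<T}"
    proof -
      have "fst ` set (letters c') \<subseteq> {1..m}" "snd ` set (letters c') \<subseteq> {..<T}"
        using assms 1 by (auto simp: \<open>fst ` set (letters c') = set (letters c)\<close>)
      then show ?thesis unfolding mem_Times_iff subset_iff by simp
    qed
    then show "\<exists>c''. comm_eval free_gen c' = comm_eval free_gen c'' \<and>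
        set (letters c'') \<subseteq> {1..m} \<times> {..<T} \<and>
        (\<forall>i. count_list (map fst (letters c'')) i = count_list (letters c) i)"
      using 1(1) by (intro exI[of _ c'] conjI) simp_all
  qed
  finally show ?thesis .
qed

section \<open>Relations in \<open>\<And>\<^sup>p A \<otimes> U(A)\<close>\<close>

lemma subspace_wu_relations: "cvec.subspace (wu_relations A p)"
  unfolding wu_relations_def by (rule cvec.subspace_span)

lemma wu_relations_wedge_add:
  assumes "length gs + length gs' + 1 = p" "{x, y} \<union> set gs \<union> set gs' \<union> set us \<subseteq> A"
  shows "wu_symbol (gs @ (x + y) # gs') us
    - (wu_symbol (gs @ x # gs') us + wu_symbol (gs @ y # gs') us) \<in> wu_relations A p"
  unfolding wu_relations_def using assms by (intro cvec.span_base UnI1) blast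

lemma wu_relations_not_distinct:
  assumes "length gs = p" "\<not> distinct gs" "set gs \<union> set us \<subseteq> A"
  shows "wu_symbol gs us \<in> wu_relations A p"
  unfolding wu_relations_def using assms by (intro cvec.span_base UnI1 UnI2[of _ _ "_ \<union> _"]) blast

lemma wu_relations_word_add:
  assumes "length gs = p" "{x, y} \<union> set gs \<union> set us \<union> set us' \<subseteq> A"
  shows "wu_symbol gs (us @ (x + y) # us')
    - (wu_symbol gs (us @ x # us') + wu_symbol gs (us @ y # us')) \<in> wu_relations A p"
  unfolding wu_relations_def using assms by (intro cvec.span_base) blast

lemma wu_relations_word_scale:
  assumes "length gs = p" "{x} \<union> set gs \<union> set us \<union> set us' \<subseteq> A"
  shows "wu_symbol gs (us @ (c *\<^sub>C x) # us') - c *\<^sub>C wu_symbol gs (us @ x # us') \<in> wu_relations A p"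
  unfolding wu_relations_def using assms by (intro cvec.span_base) blast

lemma wu_relations_word_bracket:
  assumes "length gs = p" "{x, y} \<union> set gs \<union> set us \<union> set us' \<subseteq> A"
  shows "wu_symbol gs (us @ x # y # us') - wu_symbol gs (us @ y # x # us')
    - wu_symbol gs (us @ bracket x y # us') \<in> wu_relations A p"
  unfolding wu_relations_def using assms by (intro cvec.span_base) blast

text \<open>Polarisation: the relations kill repeated factors, and antisymmetry follows by expanding
  the symbol with \<open>x + y\<close> in two adjacent places.\<close>

lemma wu_relations_wedge_swap:
  assumes A: "cvec.subspace A" and len: "length gs + length gs' + 2 = p"
    and mem: "{x, y} \<union> set gs \<union> set gs' \<union> set us \<subseteq> A"
  shows "wu_symbol (gs @ x # y # gs') us + wu_symbol (gs @ y # x # gs') us \<in> wu_relations A p"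
proof -
  define S where "S u v = wu_symbol (gs @ u # v # gs') us" for u v
  have R: "cvec.subspace (wu_relations A p)" by (rule subspace_wu_relations)
  have xy: "x + y \<in> A" using A mem by (simp add: cvec.subspace_add)
  have left: "S (x + y) v - (S x v + S y v) \<in> wu_relations A p" if "v \<in> A" for v
    unfolding S_def using wu_relations_wedge_add[of gs "v # gs'" p x y us A] len mem that by simp
  have right: "S u (x + y) - (S u x + S u y) \<in> wu_relations A p" if "u \<in> A" for u
    unfolding S_def using wu_relations_wedge_add[of "gs @ [u]" gs' p x y us A] len mem that by simp
  have diag: "S u u \<in> wu_relations A p" if "u \<in> A" for u
    unfolding S_def by (rule wu_relations_not_distinct) (use len mem that in auto)
  have "S x y + S y x = S (x + y) (x + y) - (S (x + y) (x + y) - (S x (x + y) + S y (x + y)))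
      - (S x (x + y) - (S x x + S x y)) - (S y (x + y) - (S y x + S y y)) - S x x - S y y"
    by (simp add: algebra_simps)
  moreover have "\<dots> \<in> wu_relations A p"
    using xy mem by (intro left right diag cvec.subspace_diff[OF R]) simp_all
  ultimately show ?thesis unfolding S_def by metis
qed

text \<open>Read from the right: \<open>\<psi>\<close> puts a new letter at the front of the word
  but appends an edge at the end of the flag, so edge number k is cut out by the last k
  letters.\<close>

definition coord_flag :: "nat \<Rightarrow> nat list \<Rightarrow> point set list" where
  "coord_flag m ps = map (\<lambda>k. coord_flat m (set (drop (length ps - k) ps))) [0..<Suc (length ps)]"

lemma coord_flag_Cons: "coord_flag m (p # ps) = coord_flag m ps @ [coord_flat m (set (p # ps))]"
  by (simp add: coord_flag_def Suc_diff_le)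

lemma last_coord_flag: "last (coord_flag m ps) = coord_flat m (set ps)"
  by (simp add: coord_flag_def)

lemma coord_flag_in_flags:
  assumes "distinct ps" "set ps \<subseteq> {1..m}"
  shows "coord_flag m ps \<in> flags T \<omega> m (length ps)"
  unfolding flags_def
proof (intro CollectI conjI allI impI)
  have nth: "coord_flag m ps ! k = coord_flat m (set (drop (length ps - k) ps))"
    if "k \<le> length ps" for k
    using that by (simp add: coord_flag_def del: upt_Suc)
  show "length (coord_flag m ps) = Suc (length ps)" by (simp add: coord_flag_def)
  show "coord_flag m ps ! 0 = Cm m" 
    unfolding nth[OF le0] by (simp add: coord_flat_empty)
  fix k
  {
    assume k: "k \<le> length ps"
    let ?P = "set (drop (length ps - k) ps)"
    have P: "?P \<subseteq> {1..m}" by (rule order_trans[OF set_drop_subset assms(2)])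
    have "card ?P = k"
      using k assms(1) by (simp add: distinct_card)
    then show "codim m (coord_flag m ps ! k) = k" by (simp add: nth k codim_coord_flat[OF P])
    have "coord_flat m ?P = hyp_inter \<omega> m (Coord ` ?P)" "Coord ` ?P \<subseteq> hyperplanes T m"
      using P by (auto simp: coord_flat_eq_hyp_inter hyperplanes_def)
    moreover have "hyp_inter \<omega> m (Coord ` ?P) \<noteq> {}"
      using cvec.subspace_0[OF subspace_hyp_inter] by blast
    ultimately show "coord_flag m ps ! k \<in> edges T \<omega> m"
      unfolding nth[OF k] edges_def by blast
  next
    assume k: "k < length ps"
    have "set (drop (length ps - k) ps) \<subseteq> set (drop (length ps - Suc k) ps)"
      by (rule set_drop_subset_set_drop) simp
    then show "coord_flag m ps ! Suc k \<subseteq> coord_flag m ps ! k"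
      using k by (auto simp: nth coord_flat_def)
  }
qed

lemma flag_pairing_coord_flag:
  assumes "\<omega> \<noteq> 0" "ps \<noteq> []" "set ps \<subseteq> {1..m}" "set hs \<subseteq> hyperplanes T m" "set hs \<inter> range Coord = {}"
    and "length hs = length ps"
  shows "flag_pairing \<omega> m (coord_flag m ps) hs = 0"
proof -
  have False if s: "flag_order \<omega> m (coord_flag m ps) hs s" for s
  proof -
    have l: "0 < length hs" using assms by simp
    have "s 0 < length hs" using s l permutes_in_image[of s "{..<length hs}" 0] by (simp add: flag_order_def)
    then have h: "hs ! s 0 \<in> set hs" by simp
    then have "hs ! s 0 \<in> hyperplanes T m" "hs ! s 0 \<notin> range Coord" using assms(4,5) by blast+
    then have "\<exists>i j k. hs ! s 0 = Diag i j k \<and> 1 \<le> i \<and> i < j \<and> j \<le> m"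
      unfolding hyperplanes_def by blast
    then obtain i j k where ijk: "hs ! s 0 = Diag i j k" "1 \<le> i" "i < j" "j \<le> m" by blast
    define q where "q = last ps"
    have q: "q \<in> {1..m}" unfolding q_def by (rule subsetD[OF assms(3) last_in_set[OF assms(2)]])
    have first: "coord_flag m ps ! Suc 0 = coord_flat m {q}"
    proof -
      \<comment> \<open>Edges are numbered from the end of the word, so the edge of codimension one
        belongs to the last letter.\<close>
      obtain qs where "ps = qs @ [q]" using assms(2) by (metis append_butlast_last_id q_def)
      then show ?thesis by (simp add: coord_flag_def nth_append del: upt_Suc)
    qed
    then have eq: "coord_flat m {q} = hyp_inter \<omega> m {Diag i j k}"
    proof -
      have "coord_flag m ps ! Suc 0 = hyp_inter \<omega> m ((\<lambda>j. hs ! s j) ` {..<Suc 0})"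
        using s l unfolding flag_order_def by (auto simp: Suc_le_eq)
      then show ?thesis using first ijk(1) by (simp add: lessThan_Suc)
    qed
    \<comment> \<open>A point of the diagonal hyperplane off t_q = 0: coordinates i and j carry a
      solution of its equation with both entries non-zero, and coordinate q is set to 1 if it is
      neither of them.\<close>
    define t where "t = (if q = i \<or> q = j then 0 else Poly_Mapping.single q 1)
      + Poly_Mapping.single i (\<omega> ^ k) + Poly_Mapping.single j (1::complex)"
    have look: "Poly_Mapping.lookup t r = (if r = q \<and> q \<noteq> i \<and> q \<noteq> j then 1 else 0)
      + (if r = i then \<omega> ^ k else 0) + (if r = j then 1 else 0)" for r
      by (auto simp: t_def lookup_add lookup_single when_def)
    have "t \<in> Cm m" using q ijk by (auto simp: Cm_def in_keys_iff look split: if_splits)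
    then have "t \<in> hyp_inter \<omega> m {Diag i j k}" using ijk by (auto simp: hyp_inter_def look)
    then have "Poly_Mapping.lookup t q = 0" using eq by (auto simp: coord_flat_def)
    then show False using assms(1) ijk(3) by (auto simp: look split: if_splits)
  qed
  then show ?thesis by (auto simp: flag_pairing_def)
qed

lemma wu_component_f_bar:
  assumes "mset (concat (map letters (cs @ cs'))) = mset [1..<Suc m]"
  shows "wu_symbol (map (comm_eval (f_bar T)) cs) (map (comm_eval (f_bar T)) cs')
    \<in> wu_component T m (length cs)"
proof -
  have l: "set (letters c) \<subseteq> {1..m}" if "c \<in> set (cs @ cs')" for c
  proof -
    have "set (letters c) \<subseteq> set (concat (map letters (cs @ cs')))" using that by auto
    also have "\<dots> = {1..m}"
      using arg_cong[OF assms, of set_mset] by (simp only: set_mset_mset set_upt atLeastLessThanSuc_atLeastAtMost)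
    finally show ?thesis .
  qed
  have sum: "(\<Sum>d\<leftarrow>map (\<lambda>c. count_list (letters c)) xs. d i) = count_list (concat (map letters xs)) i"
    for xs :: "nat commutator list" and i
    by (induction xs) simp_all
  have one: "count_list (concat (map letters (cs @ cs'))) i = one_m m i" for i
    unfolding count_mset[symmetric] assms
    by (auto simp: one_m_def count_mset_0_iff distinct_count_atmost_1[THEN iffD1])
  show ?thesis
    unfolding wu_component_def
  proof (rule cvec.span_base, intro CollectI exI conjI allI)
    show "list_all2 (\<lambda>x d. x \<in> abar_alg T m \<inter> a_component T m d)
        (map (comm_eval (f_bar T)) cs @ map (comm_eval (f_bar T)) cs')
        (map (\<lambda>c. count_list (letters c)) (cs @ cs'))"
      unfolding map_append[symmetric] list_all2_map1 list_all2_map2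
      by (rule list.rel_refl_strong) (use l comm_f_bar_in_abar comm_f_bar_in_component in blast)
    show "(\<Sum>d\<leftarrow>map (\<lambda>c. count_list (letters c)) (cs @ cs'). d i) = one_m m i" for i
      unfolding sum by (rule one)
  qed simp_all
qed

lemma wu_component_f_bar_words:
  assumes "mset (xs @ ys) = mset [1..<Suc m]"
  shows "wu_symbol (map (f_bar T) xs) (map (f_bar T) ys) \<in> wu_component T m (length xs)"
proof -
  have "concat (map letters (map Leaf xs @ map Leaf ys)) = xs @ ys"
    by (simp add: comp_def concat_map_singleton)
  then show ?thesis
    using wu_component_f_bar[of "map Leaf xs" "map Leaf ys" m T] assms by (simp add: comp_def)
qed

section \<open>The maps \<open>\<psi>\<^sub>p\<close> in one fixed total degree\<close>

locale psi_map =
  fixes T :: nat and \<omega> :: complex and m :: nat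
    and \<psi> :: "nat \<Rightarrow> (((nat \<times> nat) free_lie list \<times> (nat \<times> nat) free_lie list) \<Rightarrow>\<^sub>0 complex) \<Rightarrow>
      (point set list \<Rightarrow>\<^sub>0 complex)"
  assumes psi: "is_psi T \<omega> m \<psi>" and T_pos: "0 < T" and m_pos: "0 < m" and omega_nz: "\<omega> \<noteq> 0"
begin

declare upt_Suc [simp del]

text \<open>\<open>is_psi\<close> makes \<open>\<psi>\<close> respect relations inside the degree
  (1, ..., 1) part, so every relation fed to it must also be shown to lie there.\<close>

definition "null_wu p = wu_component T m p \<inter> wu_relations (abar_alg T m) p"

lemma subspace_wu_component: "cvec.subspace (wu_component T m p)"
  unfolding wu_component_def by (rule cvec.subspace_span)

lemma subspace_null_wu: "cvec.subspace (null_wu p)"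
  unfolding null_wu_def by (intro cvec.subspace_inter subspace_wu_component subspace_wu_relations)

lemma subspace_flag_relations: "cvec.subspace (flag_relations T \<omega> m p)"
  unfolding flag_relations_def by (rule cvec.subspace_span)

lemma clinear_psi: "p \<le> m \<Longrightarrow> clinear (\<psi> p)"
  using psi by (simp add: is_psi_def)

lemma psi_null:
  assumes "p \<le> m" "x \<in> null_wu p"
  shows "\<psi> p x \<in> flag_relations T \<omega> m (m - p)"
proof -
  have "\<psi> p ` null_wu p \<subseteq> flag_relations T \<omega> m (m - p)"
    using psi assms(1) by (simp add: is_psi_def null_wu_def)
  then show ?thesis using assms(2) by (rule image_subset_iff[THEN iffD1, rule_format])
qed

abbreviation "word xs ys \<equiv> wu_symbol (map (f_bar T) xs) (map (f_bar T) ys)"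

lemma swap_null:
  assumes "mset (gs @ x # y # gs') = mset [1..<Suc m]"
  shows "word (gs @ x # y # gs') [] + word (gs @ y # x # gs') [] \<in> null_wu m"
proof -
  have len: "length gs + length gs' + 2 = m"
    using arg_cong[OF assms, of size] by simp
  have set: "set (gs @ x # y # gs') = {1..m}"
    using arg_cong[OF assms, of set_mset] by (simp only: set_mset_mset set_upt atLeastLessThanSuc_atLeastAtMost)
  have mem: "{f_bar T x, f_bar T y} \<union> set (map (f_bar T) gs) \<union> set (map (f_bar T) gs') \<union> set [] \<subseteq> abar_alg T m"
  proof -
    have "f_bar T ` set (gs @ x # y # gs') \<subseteq> abar_alg T m"
      unfolding set using f_bar_in_abar by blast
    then show ?thesis by auto
  qed
  have "word (gs @ x # y # gs') [] + word (gs @ y # x # gs') [] \<in> wu_relations (abar_alg T m) m"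
    using wu_relations_wedge_swap[OF lie_subalgebraD(1)[OF lie_subalgebra_abar] _ mem, of m] len by simp
  moreover have "word (gs @ x # y # gs') [] \<in> wu_component T m m"
    "word (gs @ y # x # gs') [] \<in> wu_component T m m"
    using wu_component_f_bar_words[of "gs @ x # y # gs'" "[]" m T]
      wu_component_f_bar_words[of "gs @ y # x # gs'" "[]" m T] assms len by (simp_all add: add_mset_commute)
  ultimately show ?thesis
    unfolding null_wu_def by (auto intro: cvec.subspace_add[OF subspace_wu_component])
qed

text \<open>The sign of the permutation is left unspecified: the resulting multiple of a flag will
  only be paired to zero.\<close>

definition sign_equal :: "nat list \<Rightarrow> nat list \<Rightarrow> bool" where
  "sign_equal xs ys \<longleftrightarrow> (\<exists>\<epsilon>\<in>{1, -1}. word xs [] - \<epsilon> *\<^sub>C word ys [] \<in> null_wu m)"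

lemma sign_equal_refl: "sign_equal xs xs"
  unfolding sign_equal_def by (rule bexI[of _ 1]) (simp_all add: cvec.subspace_0[OF subspace_null_wu])

lemma sign_equal_trans:
  assumes "sign_equal xs ys" "sign_equal ys zs"
  shows "sign_equal xs zs"
proof -
  obtain \<epsilon> \<delta> where \<epsilon>: "\<epsilon> \<in> {1, -1}" "word xs [] - \<epsilon> *\<^sub>C word ys [] \<in> null_wu m"
    and \<delta>: "\<delta> \<in> {1, -1}" "word ys [] - \<delta> *\<^sub>C word zs [] \<in> null_wu m"
    using assms unfolding sign_equal_def by blast
  have "word xs [] - (\<epsilon> * \<delta>) *\<^sub>C word zs [] =
      (word xs [] - \<epsilon> *\<^sub>C word ys []) + \<epsilon> *\<^sub>C (word ys [] - \<delta> *\<^sub>C word zs [])"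
    by (simp add: cvec.scale_right_diff_distrib)
  also have "\<dots> \<in> null_wu m"
    using \<epsilon> \<delta> by (intro cvec.subspace_add cvec.subspace_scale subspace_null_wu)
  finally show ?thesis
    unfolding sign_equal_def using \<epsilon>(1) \<delta>(1) by (intro bexI[of _ "\<epsilon> * \<delta>"]) auto
qed

lemma sign_equal_move:
  assumes "mset (gs @ x # ys @ gs') = mset [1..<Suc m]"
  shows "sign_equal (gs @ ys @ x # gs') (gs @ x # ys @ gs')"
  using assms
proof (induction ys arbitrary: gs)
  case Nil
  show ?case by (simp add: sign_equal_refl)
next
  case (Cons y ys)
  have "sign_equal ((gs @ [y]) @ ys @ x # gs') ((gs @ [y]) @ x # ys @ gs')"
    using Cons.prems by (intro Cons.IH) (simp add: add_mset_commute)
  moreover have "sign_equal (gs @ y # x # ys @ gs') (gs @ x # y # ys @ gs')"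
    unfolding sign_equal_def
    using swap_null[of gs y x "ys @ gs'"] Cons.prems
    by (intro bexI[of _ "-1"]) (simp_all add: add_mset_commute)
  ultimately show ?case using sign_equal_trans by simp
qed

lemma sign_equal_permutation:
  assumes "mset xs = mset ys" "mset (gs @ ys) = mset [1..<Suc m]"
  shows "sign_equal (gs @ xs) (gs @ ys)"
  using assms
proof (induction xs arbitrary: gs ys)
  case Nil
  then show ?case by (simp add: sign_equal_refl)
next
  case (Cons x xs)
  have "x \<in> set ys" using Cons.prems(1) by (metis list.set_intros(1) mset_eq_setD)
  then obtain ys1 ys2 where ys: "ys = ys1 @ x # ys2" by (meson split_list)
  have 1: "mset xs = mset (ys1 @ ys2)" using Cons.prems(1) by (simp add: ys)
  have 2: "mset (gs @ x # ys1 @ ys2) = mset [1..<Suc m]" using Cons.prems(2) by (simp add: ys)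
  have "sign_equal ((gs @ [x]) @ xs) ((gs @ [x]) @ ys1 @ ys2)"
    using 1 2 by (intro Cons.IH) simp_all
  moreover have "sign_equal (gs @ x # ys1 @ ys2) (gs @ ys1 @ x # ys2)"
  proof -
    obtain \<epsilon> where \<epsilon>: "\<epsilon> \<in> {1, -1}"
      "word (gs @ ys1 @ x # ys2) [] - \<epsilon> *\<^sub>C word (gs @ x # ys1 @ ys2) [] \<in> null_wu m"
      using sign_equal_move[OF 2] unfolding sign_equal_def by blast
    have "\<epsilon> * \<epsilon> = 1" using \<epsilon>(1) by auto
    \<comment> \<open>Scaling by \<open>- \<epsilon>\<close> reverses the relation, since the sign
      squares to 1.\<close>
    then have "(- \<epsilon>) *\<^sub>C (word (gs @ ys1 @ x # ys2) [] - \<epsilon> *\<^sub>C word (gs @ x # ys1 @ ys2) []) =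
        word (gs @ x # ys1 @ ys2) [] - \<epsilon> *\<^sub>C word (gs @ ys1 @ x # ys2) []"
      by (simp add: cvec.scale_right_diff_distrib scaleC_scaleC scaleC_one)
    then show ?thesis
      unfolding sign_equal_def using \<epsilon> cvec.subspace_scale[OF subspace_null_wu \<epsilon>(2), of "- \<epsilon>"] by metis
  qed
  ultimately show ?case using sign_equal_trans by (simp add: ys)
qed

text \<open>Induction on the word with the wedge part varying. For the empty word, antisymmetry
  sorts the wedge into the normalised one. A further letter is taken from the end of the wedge,
  where the rule for \<open>\<psi>\<close> intersects the last edge with a coordinate
  hyperplane.\<close>

lemma psi_word:
  assumes "mset (xs @ ys) = mset [1..<Suc m]"
  shows "\<exists>\<epsilon>\<in>{1, -1}. flag_equiv T \<omega> m (length ys) (\<psi> (length xs) (word xs ys))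
    (\<epsilon> *\<^sub>C Poly_Mapping.single (coord_flag m ys) 1)"
  using assms
proof (induction ys arbitrary: xs)
  case Nil
  have len: "length xs = m" using arg_cong[OF Nil, of size] by simp
  obtain \<epsilon> where \<epsilon>: "\<epsilon> \<in> {1, -1}" "word xs [] - \<epsilon> *\<^sub>C word [1..<Suc m] [] \<in> null_wu m"
  proof -
    have "sign_equal xs [1..<Suc m]"
      using sign_equal_permutation[of xs "[1..<Suc m]" "[]"] Nil by simp
    then show thesis using that unfolding sign_equal_def by blast
  qed
  have "\<psi> m (word xs []) - \<epsilon> *\<^sub>C \<psi> m (word [1..<Suc m] []) \<in> flag_relations T \<omega> m 0"
    using psi_null[OF order_refl \<epsilon>(2)]
    by (simp add: clinear_diff[OF clinear_psi] clinear_scale[OF clinear_psi])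
  moreover have "\<psi> m (word [1..<Suc m] []) - Poly_Mapping.single [Cm m] 1 \<in> flag_relations T \<omega> m 0"
    using psi by (simp add: is_psi_def flag_equiv_def f_bar_def[abs_def])
  ultimately have "(\<psi> m (word xs []) - \<epsilon> *\<^sub>C \<psi> m (word [1..<Suc m] []))
      + \<epsilon> *\<^sub>C (\<psi> m (word [1..<Suc m] []) - Poly_Mapping.single [Cm m] 1) \<in> flag_relations T \<omega> m 0"
    by (intro cvec.subspace_add cvec.subspace_scale subspace_flag_relations)
  then have "flag_equiv T \<omega> m 0 (\<psi> m (word xs [])) (\<epsilon> *\<^sub>C Poly_Mapping.single [Cm m] 1)"
    by (simp add: flag_equiv_def cvec.scale_right_diff_distrib)
  moreover have "coord_flag m [] = [Cm m]" by (simp add: coord_flag_def coord_flat_empty upt_Suc)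
  ultimately show ?case using \<epsilon>(1) len by auto
next
  case (Cons y ys)
  have len: "length ys + length xs + 1 = m" using arg_cong[OF Cons.prems, of size] by simp
  have "mset ((xs @ [y]) @ ys) = mset [1..<Suc m]" using Cons.prems by simp
  then obtain \<epsilon> where \<epsilon>: "\<epsilon> \<in> {1, -1}"
    "flag_equiv T \<omega> m (length ys) (\<psi> (length (xs @ [y])) (word (xs @ [y]) ys))
      (\<epsilon> *\<^sub>C Poly_Mapping.single (coord_flag m ys) 1)"
    using Cons.IH by blast
  have set: "set (xs @ y # ys) = {1..m}"
    using arg_cong[OF Cons.prems, of set_mset] by (simp only: set_mset_mset set_upt atLeastLessThanSuc_atLeastAtMost)
  have "distinct (xs @ y # ys)"
    using Cons.prems mset_eq_imp_distinct_iff distinct_upt by blast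
  then have flag: "coord_flag m ys \<in> flags T \<omega> m (length ys)"
    using set by (intro coord_flag_in_flags) auto
  \<comment> \<open>The rule for \<open>\<psi>\<close> speaks of commutators; this leaf has bar
    \<open>f_bar T p\<close>, and its \<open>L0_edge\<close> is the hyperplane t_p = 0.\<close>
  let ?lf = "\<lambda>p. Leaf (p, 0::nat)"
  have "mset (map fst (concat (map letters (map ?lf zs)))) = mset zs" for zs :: "nat list"
    by (induction zs) simp_all
  then have ml: "multilinear_comms T m (map ?lf xs @ [?lf y] @ map ?lf ys)"
    using T_pos Cons.prems unfolding multilinear_comms_def by auto
  have lf: "map (comm_bar T) (map ?lf zs) = map (f_bar T) zs" for zs
    by (simp add: comm_bar_Leaf)
  have "flag_equiv T \<omega> m (length ys + 1)
      (\<psi> (length xs) (wu_symbol (map (comm_bar T) (map ?lf xs)) (comm_bar T (?lf y) # map (comm_bar T) (map ?lf ys))))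
      (\<epsilon> *\<^sub>C Poly_Mapping.single (coord_flag m ys @ [last (coord_flag m ys) \<inter> L0_edge m (?lf y)]) 1)"
    using psi[unfolded is_psi_def, THEN conjunct2, THEN conjunct2, THEN conjunct1, rule_format,
      of "map ?lf xs" "length xs" "length ys" "?lf y" "map ?lf ys" \<epsilon> "coord_flag m ys"]
      len ml \<epsilon> flag by (simp add: comm_bar_Leaf comp_def)
  moreover have "last (coord_flag m ys) \<inter> L0_edge m (?lf y) = coord_flat m (set (y # ys))"
    by (auto simp: last_coord_flag coord_flat_def L0_edge_def)
  ultimately have "flag_equiv T \<omega> m (length (y # ys)) (\<psi> (length xs) (word xs (y # ys)))
    (\<epsilon> *\<^sub>C Poly_Mapping.single (coord_flag m (y # ys)) 1)"
    by (simp add: lf comm_bar_Leaf coord_flag_Cons comp_def)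
  then show ?case using \<epsilon>(1) by blast
qed

text \<open>Only families of diagonal hyperplanes are tested, since \<open>Coord\<close> has weight zero.\<close>

definition invisible :: "(((nat \<times> nat) free_lie list \<times> (nat \<times> nat) free_lie list) \<Rightarrow>\<^sub>0 complex) set" where
  "invisible = {x \<in> wu_component T m 0. \<forall>hs. set hs \<subseteq> hyperplanes T m \<longrightarrow> set hs \<inter> range Coord = {} \<longrightarrow>
     length hs = m \<longrightarrow> pairing \<omega> m (\<psi> 0 x) hs = 0}"

lemma subspace_invisible: "cvec.subspace invisible"
  by (rule cvec.subspaceI)
    (simp_all add: invisible_def cvec.subspace_0[OF subspace_wu_component]
      cvec.subspace_add[OF subspace_wu_component] cvec.subspace_scale[OF subspace_wu_component]
      clinear_0[OF clinear_psi] clinear_add[OF clinear_psi] clinear_scale[OF clinear_psi]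
      clinear_0[OF clinear_pairing] clinear_add[OF clinear_pairing] clinear_scale[OF clinear_pairing])

lemma null_wu_invisible: "x \<in> null_wu 0 \<Longrightarrow> x \<in> invisible"
  using psi_null[of 0 x] by (auto simp: invisible_def null_wu_def pairing_flag_relations)

lemma word_invisible:
  assumes "mset ys = mset [1..<Suc m]"
  shows "word [] ys \<in> invisible"
proof -
  have len: "length ys = m" using arg_cong[OF assms, of size] by simp
  have set: "set ys = {1..m}"
    using arg_cong[OF assms, of set_mset] by (simp only: set_mset_mset set_upt atLeastLessThanSuc_atLeastAtMost)
  obtain \<epsilon> where \<epsilon>: "\<psi> 0 (word [] ys) - \<epsilon> *\<^sub>C Poly_Mapping.single (coord_flag m ys) 1 \<in> flag_relations T \<omega> m m"
    using psi_word[of "[]" ys] assms unfolding len append.simps list.size flag_equiv_def by blast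
  have "pairing \<omega> m (\<psi> 0 (word [] ys)) hs = 0"
    if hs: "set hs \<subseteq> hyperplanes T m" "set hs \<inter> range Coord = {}" "length hs = m" for hs
  proof -
    have "pairing \<omega> m (\<psi> 0 (word [] ys)) hs = \<epsilon> * flag_pairing \<omega> m (coord_flag m ys) hs"
      using pairing_flag_relations[OF \<epsilon> order_refl hs(3,1)]
      by (simp add: clinear_diff[OF clinear_pairing] clinear_scale[OF clinear_pairing] pairing_single scaleC_complex_def)
    also have "\<dots> = 0"
      using flag_pairing_coord_flag[OF omega_nz _ _ hs(1,2), of ys] m_pos len set hs(3) by auto
    finally show ?thesis .
  qed
  moreover have "word [] ys \<in> wu_component T m 0"
    using wu_component_f_bar_words[of "[]" ys m T] assms by simp
  ultimately show ?thesis by (simp add: invisible_def)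
qed

text \<open>In the enveloping algebra a factor [a, b] equals a b - b a, and splitting it removes one
  \<open>Comm\<close> node from the total size. The recursion ends at words in single barred
  generators.\<close>

lemma comms_invisible:
  assumes "mset (concat (map letters cs)) = mset [1..<Suc m]"
  shows "wu_symbol [] (map (comm_eval (f_bar T)) cs) \<in> invisible"
  using assms
proof (induction "sum_list (map size cs)" arbitrary: cs rule: less_induct)
  case less
  show ?case
  proof (cases "\<exists>c a b. c \<in> set cs \<and> c = Comm a b")
    case False
    have "\<exists>p. c = Leaf p" if "c \<in> set cs" for c using False that by (cases c) auto
    then obtain f where f: "\<And>c. c \<in> set cs \<Longrightarrow> c = Leaf (f c)" by metis
    then have cs: "cs = map Leaf (map f cs)" by (simp add: map_idI comp_def)
    have "concat (map letters (map Leaf ps)) = ps" for ps :: "nat list"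
      by (induction ps) simp_all
    then have "mset (map f cs) = mset [1..<Suc m]" using less.prems cs by metis
    then have "word [] (map f cs) \<in> invisible" by (rule word_invisible)
    moreover have "map (comm_eval (f_bar T)) cs = map (f_bar T) (map f cs)"
    proof -
      have "comm_eval (f_bar T) c = f_bar T (f c)" if "c \<in> set cs" for c
        by (subst f[OF that]) simp
      then show ?thesis by simp
    qed
    ultimately show ?thesis by (simp only: list.map(1))
  next
    case True
    then obtain a b us us' where cs: "cs = us @ Comm a b # us'" by (metis split_list)
    let ?e = "comm_eval (f_bar T)"
    let ?W = "\<lambda>xs. wu_symbol [] (map ?e (us @ xs @ us'))"
    \<comment> \<open>The relation x y - y x = [x, y] placed inside the word. All three words have
      the same letters, so it is homogeneous and hence null.\<close>
    let ?R = "?W [a, b] - ?W [b, a] - ?W [Comm a b]"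
    have perm: "mset (concat (map letters (us @ [a, b] @ us'))) = mset [1..<Suc m]"
      "mset (concat (map letters (us @ [b, a] @ us'))) = mset [1..<Suc m]"
      "mset (concat (map letters (us @ [Comm a b] @ us'))) = mset [1..<Suc m]"
      using less.prems by (simp_all add: cs ac_simps del: mset_upt)
    have set: "set (letters c) \<subseteq> {1..m}" if "c \<in> set (us @ [a, b] @ us')" for c
    proof -
      have "set (letters c) \<subseteq> set (concat (map letters (us @ [a, b] @ us')))" using that by auto
      also have "\<dots> = {1..m}"
        using arg_cong[OF perm(1), of set_mset]
        by (simp only: set_mset_mset set_upt atLeastLessThanSuc_atLeastAtMost)
      finally show ?thesis .
    qed
    have inv: "?W [a, b] \<in> invisible" "?W [b, a] \<in> invisible"
      by (rule less.hyps[OF _ perm(1)], simp add: cs, rule less.hyps[OF _ perm(2)], simp add: cs)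
    have ab: "{?e a, ?e b} \<union> set [] \<union> set (map ?e us) \<union> set (map ?e us') \<subseteq> abar_alg T m"
      using comm_f_bar_in_abar[OF set] by auto
    have "?R \<in> wu_relations (abar_alg T m) 0"
      using wu_relations_word_bracket[OF _ ab, of 0] by simp
    moreover have "?R \<in> wu_component T m 0"
      using wu_component_f_bar[of "[]" _ m T] perm
      by (intro cvec.subspace_diff[OF subspace_wu_component]) (metis append_Nil list.map(1) list.size(3))+
    ultimately have "?R \<in> invisible" by (intro null_wu_invisible) (simp add: null_wu_def)
    then have "?W [a, b] - ?W [b, a] - ?R \<in> invisible"
      by (rule cvec.subspace_diff[OF subspace_invisible cvec.subspace_diff[OF subspace_invisible inv]])
    then show ?thesis by (simp add: cs)
  qed
qed

text \<open>On representatives the symbol is not linear in \<open>x\<close>; it is so only modulo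
  relations. The admissible \<open>x\<close> are therefore collected in a set \<open>K\<close>
  inside the homogeneous part \<open>A\<close>, where these relations are null, and \<open>K\<close>
  is shown to be a subspace.\<close>

lemma multilinear_span_invisible:
  assumes "x \<in> cvec.span {comm_eval (f_bar T) c | c. mset (letters c) = mset [1..<Suc m]}"
  shows "wu_symbol [] [x] \<in> invisible"
proof -
  let ?S = "{comm_eval (f_bar T) c | c. mset (letters c) = mset [1..<Suc m]}"
  define A where "A = abar_alg T m \<inter> a_component T m (one_m m)"
  define K where "K = {x \<in> A. wu_symbol [] [x] \<in> invisible}"
  have A: "cvec.subspace A"
    unfolding A_def a_component_def
    by (intro cvec.subspace_inter lie_subalgebraD(1)[OF lie_subalgebra_abar] cvec.subspace_span)
  have comp: "wu_symbol [] [x] \<in> wu_component T m 0" if "x \<in> A" for x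
    unfolding wu_component_def using that unfolding A_def
    by (intro cvec.span_base CollectI exI[of _ "[]"] exI[of _ "[x]"] conjI exI[of _ "[one_m m]"]) auto
  have scale: "wu_symbol [] [c *\<^sub>C x] - c *\<^sub>C wu_symbol [] [x] \<in> invisible" if "x \<in> A" for c x
  proof (rule null_wu_invisible, unfold null_wu_def, intro IntI)
    show "wu_symbol [] [c *\<^sub>C x] - c *\<^sub>C wu_symbol [] [x] \<in> wu_component T m 0"
      using that by (intro cvec.subspace_diff cvec.subspace_scale subspace_wu_component comp A)
    show "wu_symbol [] [c *\<^sub>C x] - c *\<^sub>C wu_symbol [] [x] \<in> wu_relations (abar_alg T m) 0"
      using wu_relations_word_scale[of "[]" 0 x "[]" "[]"] that by (simp add: A_def)
  qed
  have add: "wu_symbol [] [x + y] - (wu_symbol [] [x] + wu_symbol [] [y]) \<in> invisible"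
    if "x \<in> A" "y \<in> A" for x y
  proof (rule null_wu_invisible, unfold null_wu_def, intro IntI)
    show "wu_symbol [] [x + y] - (wu_symbol [] [x] + wu_symbol [] [y]) \<in> wu_component T m 0"
      using that by (intro cvec.subspace_diff cvec.subspace_add subspace_wu_component comp A)
    show "wu_symbol [] [x + y] - (wu_symbol [] [x] + wu_symbol [] [y])
        \<in> wu_relations (abar_alg T m) 0"
      using wu_relations_word_add[of "[]" 0 x y "[]" "[]"] that by (simp add: A_def)
  qed
  have K: "cvec.subspace K"
  proof (rule cvec.subspaceI)
    have "0 \<in> A" by (rule cvec.subspace_0[OF A])
    \<comment> \<open>With scalar and vector both 0, the scaling relation is the symbol of the zero
      vector itself.\<close>
    then show "0 \<in> K" using scale[of 0 0] by (simp add: K_def)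
    fix x y c assume "x \<in> K"
    then have x: "x \<in> A" "wu_symbol [] [x] \<in> invisible" by (auto simp: K_def)
    have "wu_symbol [] [c *\<^sub>C x] - c *\<^sub>C wu_symbol [] [x] + c *\<^sub>C wu_symbol [] [x] \<in> invisible"
      using x by (intro cvec.subspace_add cvec.subspace_scale subspace_invisible scale)
    then show "c *\<^sub>C x \<in> K" using x(1) by (simp add: K_def cvec.subspace_scale[OF A])
    assume "y \<in> K"
    then have y: "y \<in> A" "wu_symbol [] [y] \<in> invisible" by (auto simp: K_def)
    have "wu_symbol [] [x + y] - (wu_symbol [] [x] + wu_symbol [] [y])
        + (wu_symbol [] [x] + wu_symbol [] [y]) \<in> invisible"
      using x y by (intro cvec.subspace_add subspace_invisible add)
    then show "x + y \<in> K" using x(1) y(1) by (simp add: K_def cvec.subspace_add[OF A])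
  qed
  have "?S \<subseteq> K"
  proof clarify
    fix c :: "nat commutator" assume c: "mset (letters c) = mset [1..<Suc m]"
    have "set (letters c) = {1..m}"
      using arg_cong[OF c, of set_mset]
      by (simp only: set_mset_mset set_upt atLeastLessThanSuc_atLeastAtMost)
    moreover have "count_list (letters c) = one_m m"
    proof
      fix i
      show "count_list (letters c) i = one_m m i"
        unfolding count_mset[symmetric] c
        by (auto simp: one_m_def count_mset_0_iff distinct_count_atmost_1[THEN iffD1])
    qed
    ultimately show "comm_eval (f_bar T) c \<in> K"
      using comms_invisible[of "[c]"] c comm_f_bar_in_abar[of c m T] comm_f_bar_in_component[of c m T]
      by (simp add: K_def A_def)
  qed
  then have "x \<in> K" using assms cvec.span_minimal[OF _ K] by blast
  then show ?thesis by (simp add: K_def)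
qed

lemma G_form_multilinear_span:
  assumes "x \<in> cvec.span {comm_eval (f_bar T) c | c. mset (letters c) = mset [1..<Suc m]}"
    and "\<And>i. a (Coord i) = 0"
  shows "G_form T \<omega> m a m (\<psi> 0 (wu_symbol [] [x])) y = 0"
  unfolding G_form_def Let_def
proof (intro sum.neutral ballI)
  fix S assume "S \<in> {S. S \<subseteq> hyperplanes T m \<and> card S = m}"
  then have S: "S \<subseteq> hyperplanes T m" "card S = m" by auto
  \<comment> \<open>An infinite set has cardinality 0 by convention, which \<open>m_pos\<close>
    excludes.\<close>
  have fin: "finite S" using S(2) m_pos by (metis card.infinite less_irrefl)
  define hs where "hs = (SOME hs. distinct hs \<and> set hs = S)"
  have "\<exists>hs. distinct hs \<and> set hs = S" using finite_distinct_list[OF fin] by blast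
  then have hs: "distinct hs" "set hs = S" unfolding hs_def by (rule someI2_ex, simp)+
  have "pairing \<omega> m (\<psi> 0 (wu_symbol [] [x])) hs = 0 \<or> (\<Prod>h\<in>S. a h) = 0"
  proof (cases "S \<inter> range Coord = {}")
    case True
    then show ?thesis
      using multilinear_span_invisible[OF assms(1)] S hs distinct_card[OF hs(1)]
      by (auto simp: invisible_def)
  next
    case False
    then show ?thesis using fin assms(2) by (auto simp: prod_zero_iff)
  qed
  then show "pairing \<omega> m (\<psi> 0 (wu_symbol [] [x])) (SOME hs. distinct hs \<and> set hs = S) *
      pairing \<omega> m y (SOME hs. distinct hs \<and> set hs = S) * (\<Prod>h\<in>S. a h) = 0"
    unfolding hs_def[symmetric] by auto
qed

end

section \<open>The grading and the map \<open>\<jmath>\<close>\<close>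

text \<open>A finite combination from \<open>X\<close> is annihilated by a product of operators
  \<open>D i - \<mu>\<close>, one for each term, because the operators commute. On \<open>u\<close>
  this product acts by the product of the non-zero numbers \<open>\<nu> i - \<mu>\<close>, so
  \<open>u\<close> must be 0. \<open>K l\<close> is the product attached to the list
  \<open>l\<close>.\<close>

lemma joint_eigenvector_in_span_zero:
  fixes D :: "'k \<Rightarrow> 'a \<Rightarrow> 'a::complex_vector"
  assumes lin: "\<And>i. clinear (D i)" and comm: "\<And>i k x. D i (D k x) = D k (D i x)"
    and X: "\<And>x. x \<in> X \<Longrightarrow> \<exists>i \<mu>. \<mu> \<noteq> \<nu> i \<and> D i x = \<mu> *\<^sub>C x"
    and u: "u \<in> cvec.span X" "\<And>i. D i u = \<nu> i *\<^sub>C u"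
  shows "u = 0"
proof -
  define K where "K l = foldr (\<lambda>(i, \<mu>) y. D i y - \<mu> *\<^sub>C y) l" for l
  have K_Nil: "K [] y = y" and K_Cons: "K ((i, \<mu>) # l) y = D i (K l y) - \<mu> *\<^sub>C K l y" for i \<mu> l y
    by (simp_all add: K_def)
  have K_append: "K (l @ l') y = K l (K l' y)" for l l' y by (simp add: K_def)
  have K_lin: "clinear (K l)" for l
  proof (induction l)
    case Nil
    show ?case by (rule clinearI) (simp_all add: K_Nil)
  next
    case (Cons p l)
    obtain i \<mu> where p: "p = (i, \<mu>)" by fastforce
    show ?case unfolding p
      by (rule clinearI) (simp_all add: K_Cons clinear_add[OF Cons] clinear_scale[OF Cons]
          clinear_add[OF lin] clinear_scale[OF lin] cvec.scale_right_distrib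
          cvec.scale_right_diff_distrib cvec.scale_left_commute)
  qed
  have K_D: "K l (D i y) = D i (K l y)" for l i y
  proof (induction l)
    case Nil
    show ?case by (simp add: K_Nil)
  next
    case (Cons p l)
    obtain k \<mu> where p: "p = (k, \<mu>)" by fastforce
    show ?case unfolding p K_Cons Cons by (simp add: clinear_diff[OF lin] clinear_scale[OF lin] comm[of k i])
  qed
  have K_comm: "K l (K l' y) = K l' (K l y)" for l l' y
  proof (induction l)
    case Nil
    show ?case by (simp add: K_Nil)
  next
    case (Cons p l)
    obtain k \<mu> where p: "p = (k, \<mu>)" by fastforce
    show ?case unfolding p K_Cons Cons by (simp add: clinear_diff[OF K_lin] clinear_scale[OF K_lin] K_D)
  qed
  have "\<exists>l. (\<forall>(i, \<mu>)\<in>set l. \<mu> \<noteq> \<nu> i) \<and> K l x = 0" if "x \<in> cvec.span X" for x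
    using that
  proof (induction rule: cvec.span_induct_alt)
    case base
    show ?case by (intro exI[of _ "[]"]) (simp add: K_Nil)
  next
    case (step c x y)
    obtain i \<mu> where i: "\<mu> \<noteq> \<nu> i" "D i x = \<mu> *\<^sub>C x" using X[OF step(1)] by blast
    obtain l where l: "\<forall>(i, \<mu>)\<in>set l. \<mu> \<noteq> \<nu> i" "K l y = 0" using step(2) by blast
    have "K [(i, \<mu>)] x = 0" using i by (simp add: K_Nil K_Cons)
    then have "K ((i, \<mu>) # l) x = 0"
      using K_append[of "[(i, \<mu>)]" l] K_comm[of "[(i, \<mu>)]" l] by (simp add: clinear_0[OF K_lin])
    moreover have "K ((i, \<mu>) # l) y = 0" using l by (simp add: K_Cons clinear_0[OF lin])
    ultimately have "K ((i, \<mu>) # l) (c *\<^sub>C x + y) = 0"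
      by (simp add: clinear_add[OF K_lin] clinear_scale[OF K_lin])
    moreover have "\<forall>(i, \<mu>)\<in>set ((i, \<mu>) # l). \<mu> \<noteq> \<nu> i" using i l by simp
    ultimately show ?case by blast
  qed
  then obtain l where l: "\<forall>(i, \<mu>)\<in>set l. \<mu> \<noteq> \<nu> i" "K l u = 0" using u(1) by blast
  have "\<exists>c. c \<noteq> 0 \<and> K l u = c *\<^sub>C u"
    using l(1)
  proof (induction l)
    case Nil
    show ?case by (intro exI[of _ 1]) (simp add: K_Nil)
  next
    case (Cons p l)
    obtain i \<mu> where p: "p = (i, \<mu>)" by fastforce
    obtain c where c: "c \<noteq> 0" "K l u = c *\<^sub>C u" using Cons by auto
    have "K (p # l) u = (c * (\<nu> i - \<mu>)) *\<^sub>C u"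
      by (simp add: p K_Cons c clinear_scale[OF lin] u(2) algebra_simps cvec.scale_left_diff_distrib)
    moreover have "c * (\<nu> i - \<mu>) \<noteq> 0" using c(1) Cons.prems p by auto
    ultimately show ?case by blast
  qed
  then show ?thesis using l(2) by auto
qed

lemma lie_extend_lie_extend:
  "lie_extend f (lie_extend g x) = lie_extend (\<lambda>y. lie_extend f (g y)) x"
proof -
  have "lie_extend f (lie_extend g (abs_free_lie t)) = lie_extend (\<lambda>y. lie_extend f (g y)) (abs_free_lie t)" for t
    unfolding lie_extend.abs_eq
    using lie_extend_hom[of f]
    by (induction t) (simp_all add: clinear_0 clinear_neg lie_hom_clinear lie_hom_on_def)
  then show ?thesis by (induction x rule: free_lie.abs_induct)
qed

text \<open>Operators that detect the grading: the powers of 2 are pairwise distinct, so the joint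
  eigenvalues of all \<open>rescale i\<close> determine the multidegree.\<close>

definition rescale :: "nat \<Rightarrow> (nat \<times> nat) free_lie \<Rightarrow> (nat \<times> nat) free_lie" where
  "rescale i = lie_extend (\<lambda>(p, k). (if p = i then 2 else 1) *\<^sub>C free_gen (p, k))"

lemma clinear_rescale: "clinear (rescale i)"
  unfolding rescale_def by (rule lie_hom_clinear[OF lie_extend_hom])

lemma rescale_comm_eval:
  "rescale i (comm_eval free_gen c) = 2 ^ count_list (map fst (letters c)) i *\<^sub>C comm_eval free_gen c"
proof (induction c)
  case (Leaf x)
  then show ?case by (cases x) (simp add: rescale_def lie_extend_gen)
next
  case (Comm a b)
  have "rescale i (bracket x y) = bracket (rescale i x) (rescale i y)" for x y
    using lie_extend_hom unfolding rescale_def lie_hom_on_def by blast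
  then show ?case
    by (simp add: Comm bracket_scale_left bracket_scale_right power_add scaleC_scaleC)
qed

lemma rescale_a_component:
  assumes "x \<in> a_component T m d"
  shows "rescale i x = 2 ^ d i *\<^sub>C x"
proof -
  have "rescale i x - 2 ^ d i *\<^sub>C x \<in> {0}"
    by (rule clinear_mem_span[OF _ assms[unfolded a_component_def]])
      (auto simp: rescale_comm_eval clinear_add[OF clinear_rescale] clinear_scale[OF clinear_rescale]
        scaleC_add_right cvec.scale_right_diff_distrib cvec.scale_left_commute intro!: clinearI)
  then show ?thesis by simp
qed

text \<open>Distinct components carry distinct joint eigenvalues of the commuting rescalings.
  Independence of the components is thus obtained without a basis of the free Lie algebra.\<close>

lemma a_component_inter_others:
  assumes "x \<in> a_component T m d" "x \<in> cvec.span (\<Union>d'\<in>- {d}. a_component T m d')"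
  shows "x = 0"
proof (rule joint_eigenvector_in_span_zero[where D = rescale and \<nu> = "\<lambda>i. 2 ^ d i", OF clinear_rescale _ _ assms(2)])
  show "rescale i (rescale k x) = rescale k (rescale i x)" for i k x
    unfolding rescale_def lie_extend_lie_extend
    by (intro arg_cong[of _ _ "\<lambda>f. lie_extend f x"])
      (auto simp: fun_eq_iff lie_extend_gen clinear_scale[OF lie_hom_clinear[OF lie_extend_hom]])
  show "rescale i x = 2 ^ d i *\<^sub>C x" for i by (rule rescale_a_component[OF assms(1)])
  fix x assume "x \<in> (\<Union>d'\<in>- {d}. a_component T m d')"
  then obtain d' where d': "d' \<noteq> d" "x \<in> a_component T m d'" by auto
  then obtain i where "d' i \<noteq> d i" by (metis ext)
  then have "(2::complex) ^ d' i \<noteq> 2 ^ d i"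
    by (metis of_nat_eq_iff of_nat_numeral of_nat_power power_inject_exp one_less_numeral_iff semiring_norm(76))
  then show "\<exists>i \<mu>. \<mu> \<noteq> 2 ^ d i \<and> rescale i x = \<mu> *\<^sub>C x"
    using rescale_a_component[OF d'(2)] by blast
qed

lemma a_projection_add:
  assumes "x \<in> a_component T m (one_m m)" "y \<in> cvec.span (\<Union>d\<in>- {one_m m}. a_component T m d)"
  shows "a_projection T m (x + y) = x"
  unfolding a_projection_def
proof (rule the_equality)
  show "x \<in> a_component T m (one_m m) \<and> x + y - x \<in> cvec.span (\<Union>d\<in>- {one_m m}. a_component T m d)"
    using assms by simp
  fix z assume z: "z \<in> a_component T m (one_m m) \<and>
    x + y - z \<in> cvec.span (\<Union>d\<in>- {one_m m}. a_component T m d)"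
  have "x - z \<in> a_component T m (one_m m)"
    using assms z unfolding a_component_def by (intro cvec.span_diff) auto
  moreover have "x - z = (x + y - z) - y" by simp
  then have "x - z \<in> cvec.span (\<Union>d\<in>- {one_m m}. a_component T m d)"
    using assms(2) z cvec.span_diff by metis
  ultimately show "z = x" using a_component_inter_others by fastforce
qed

text \<open>Each commutator in barred generators is homogeneous, so the projection merely deletes
  terms and never breaks a bar apart.\<close>

lemma a_projection_comm_f_bar:
  assumes "x \<in> cvec.span {comm_eval (f_bar T) c | c. set (letters c) \<subseteq> {1..m}}"
  shows "a_projection T m x \<in> cvec.span {comm_eval (f_bar T) c | c. mset (letters c) = mset [1..<Suc m]}"
proof -
  let ?A = "{comm_eval (f_bar T) c | c. mset (letters c) = mset [1..<Suc m]}"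
  let ?B = "{comm_eval (f_bar T) c | c. set (letters c) \<subseteq> {1..m} \<and> mset (letters c) \<noteq> mset [1..<Suc m]}"
  have count: "count (mset [1..<Suc m]) i = one_m m i" for i
    by (auto simp: one_m_def count_mset_0_iff distinct_count_atmost_1[THEN iffD1] simp del: upt_Suc)
  have A: "?A \<subseteq> a_component T m (one_m m)"
  proof clarify
    fix c :: "nat commutator" assume c: "mset (letters c) = mset [1..<Suc m]"
    have "set (letters c) = {1..m}"
      using arg_cong[OF c, of set_mset]
      by (simp only: set_mset_mset set_upt atLeastLessThanSuc_atLeastAtMost)
    moreover have "count_list (letters c) = one_m m"
      by (rule ext) (simp only: count_mset[symmetric] c count)
    ultimately show "comm_eval (f_bar T) c \<in> a_component T m (one_m m)"
      using comm_f_bar_in_component[of c m T] by simp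
  qed
  have B: "?B \<subseteq> (\<Union>d\<in>- {one_m m}. a_component T m d)"
  proof clarify
    fix c :: "nat commutator"
    assume c: "set (letters c) \<subseteq> {1..m}" "mset (letters c) \<noteq> mset [1..<Suc m]"
    have "count_list (letters c) \<noteq> one_m m"
    proof
      assume "count_list (letters c) = one_m m"
      then have "count (mset (letters c)) i = count (mset [1..<Suc m]) i" for i
        by (simp only: count_mset count[unfolded count_mset])
      then show False using c(2) by (simp add: multiset_eq_iff)
    qed
    then show "comm_eval (f_bar T) c \<in> (\<Union>d\<in>- {one_m m}. a_component T m d)"
      using comm_f_bar_in_component[OF c(1), of T] by blast
  qed
  have "x \<in> cvec.span (?A \<union> ?B)"
    by (rule subsetD[OF cvec.span_mono assms]) blast
  then have "\<exists>a b. x = a + b \<and> a \<in> cvec.span ?A \<and> b \<in> cvec.span ?B"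
    unfolding cvec.span_Un mem_Collect_eq .
  then obtain a b where ab: "x = a + b" "a \<in> cvec.span ?A" "b \<in> cvec.span ?B"
    by (elim exE conjE)
  have "a \<in> a_component T m (one_m m)"
    using cvec.span_minimal[OF A] ab(2) unfolding a_component_def
    by (auto simp: cvec.subspace_span)
  then have "a_projection T m x = a"
    unfolding ab(1) by (rule a_projection_add) (rule subsetD[OF cvec.span_mono[OF B] ab(3)])
  then show ?thesis using ab(2) by simp
qed

text \<open>The abelian Lie algebra serves as a target that detects the linear independence of free generators.\<close>

instantiation complex :: lie_algebra
begin

definition bracket_complex :: "complex \<Rightarrow> complex \<Rightarrow> complex" where
  "bracket_complex x y = 0"

instance
  by standard (simp_all add: bracket_complex_def)

end

section \<open>Cycles of \<open>\<pi>\<close> and the image of barred generators under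
  \<open>\<jmath>\<close>\<close>

lemma sum_lessThan_mult: "(\<Sum>k<q * n. g k) = (\<Sum>l<q. \<Sum>k<n. g (k + n * l))"
  for g :: "nat \<Rightarrow> 'a::comm_monoid_add"
proof -
  have "sum g {l * n..<l * n + n} = (\<Sum>k<n. g (k + n * l))" for l
    using sum.shift_bounds_nat_ivl[of g 0 "l * n" n] by (simp add: lessThan_atLeast0 ac_simps)
  then show ?thesis unfolding sum.nat_group[symmetric] by simp
qed

lemma cycle_length_props:
  fixes \<pi> :: "'i::finite \<Rightarrow> 'i"
  assumes "bij \<pi>"
  shows "0 < card (orbit \<pi> x)" "(\<pi> ^^ card (orbit \<pi> x)) x = x"
proof -
  have "permutation \<pi>" using assms by (simp add: permutation)
  then have self: "x \<in> orbit \<pi> x" by (rule permutation_self_in_orbit)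
  have "card (orbit \<pi> x) = funpow_dist1 \<pi> x x"
    using card_image[OF inj_on_funpow_dist1[OF self]] orbit_conv_funpow_dist1[OF self] by simp
  then show "0 < card (orbit \<pi> x)" "(\<pi> ^^ card (orbit \<pi> x)) x = x"
    using funpow_dist1_prop[OF self] by simp_all
qed

lemma idx_in_range:
  assumes "i \<in> {1..r}" "n \<in> {1..d i}"
  shows "idx d i n \<in> {1..total_degree r d}"
proof -
  have "idx d i n \<le> (\<Sum>j=1..<i. d j) + d i" using assms by (simp add: idx_def)
  also have "\<dots> = (\<Sum>j=1..<Suc i. d j)" using assms by simp
  also have "\<dots> \<le> (\<Sum>j=1..r. d j)" using assms by (intro sum_mono2) auto
  finally show ?thesis using assms by (simp add: idx_def total_degree_def)
qed

text \<open>The length \<open>T\<^sub>i\<close> of a cycle divides \<open>T\<close> unless \<open>T < T\<^sub>i\<close>, in which case \<open>T div T\<^sub>i = 0\<close> makes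
  \<open>\<jmath>\<close> vanish on this cycle. This is forced by the values of \<open>\<jmath>\<close> in degree \<open>e\<^sub>i\<close>, so the
  injectivity of \<open>F\<close> need not be derived from the presentation.\<close>

lemma cycle_length_dvd:
  fixes \<pi> :: "'i::finite \<Rightarrow> 'i" and F :: "'i \<Rightarrow> 'g::lie_algebra"
  assumes jm: "is_jmath \<pi> \<iota> F T d j" and i: "i \<in> {1..num_cycles \<pi>}" and bij: "bij \<pi>"
    and per: "F ((\<pi> ^^ T) (\<iota> i)) = F (\<iota> i)"
    and d: "d = (\<lambda>x. if x = i then 1 else 0)" and le: "cycle_length \<pi> \<iota> i \<le> T"
  shows "cycle_length \<pi> \<iota> i dvd T"
proof (rule ccontr)
  let ?n = "cycle_length \<pi> \<iota> i"
  assume "\<not> ?n dvd T"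
  then have r: "0 < T mod ?n" by (simp add: dvd_eq_mod_eq_0)
  have n: "0 < ?n" "(\<pi> ^^ ?n) (\<iota> i) = \<iota> i"
    using cycle_length_props[OF bij] by (simp_all add: cycle_length_def)
  have q: "0 < T div ?n" using n le by (simp add: div_greater_zero_iff)
  define \<chi> where "\<chi> = lie_extend (\<lambda>x. if x = (1::nat, 0::nat) then 1 else (0::complex))"
  have \<chi>: "\<chi> (f_gen T 1 k) = (if k mod T = 0 then 1 else 0)" for k
    by (simp add: \<chi>_def f_gen_def lie_extend_gen)
  have "idx d i 1 = 1" by (simp add: idx_def d)
  then have j: "j (F ((\<pi> ^^ k) (\<iota> i))) = (\<Sum>l<T div ?n. f_gen T 1 (k + ?n * l))" if "k < ?n" for k
    using jm i that unfolding is_jmath_def by (simp add: d)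
  \<comment> \<open>Since \<open>k < ?n\<close>, every \<open>k + ?n * l\<close> stays below
    \<open>T\<close>: nothing wraps around, and residue 0 occurs only for
    \<open>k = l = 0\<close>.\<close>
  have val: "\<chi> (j (F ((\<pi> ^^ k) (\<iota> i)))) = (if k = 0 then 1 else 0)" if "k \<le> T mod ?n" for k
  proof -
    have k: "k < ?n" using that n(1) by (meson le_less_trans mod_less_divisor)
    have lt: "k + ?n * l < T" if l: "l < T div ?n" for l
    proof -
      have "k + ?n * l < ?n * Suc l" using k by simp
      also have "\<dots> \<le> ?n * (T div ?n)" using l by (intro mult_le_mono2) simp
      also have "\<dots> \<le> T" by simp
      finally show ?thesis .
    qed
    have "\<chi> (j (F ((\<pi> ^^ k) (\<iota> i)))) = (\<Sum>l<T div ?n. \<chi> (f_gen T 1 (k + ?n * l)))"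
      unfolding j[OF k] \<chi>_def by (rule clinear_sum[OF lie_hom_clinear[OF lie_extend_hom]])
    also have "\<dots> = (\<Sum>l<T div ?n. if l = 0 then (if k = 0 then 1 else 0) else 0)"
    proof (rule sum.cong)
      fix l assume "l \<in> {..<T div ?n}"
      then have "(k + ?n * l) mod T = k + ?n * l" using lt by simp
      then show "\<chi> (f_gen T 1 (k + ?n * l)) = (if l = 0 then (if k = 0 then 1 else 0) else 0)"
        using n(1) by (simp add: \<chi> del: One_nat_def)
    qed simp
    also have "\<dots> = (if k = 0 then 1 else 0)" using q by simp
    finally show ?thesis .
  qed
  \<comment> \<open>By \<open>per\<close>, the exponents \<open>T mod ?n\<close> and 0 give the same
    value of \<open>F\<close>, while \<open>\<chi>\<close> sees 0 for the former and 1 for the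
    latter.\<close>
  have "(\<pi> ^^ (T mod ?n)) (\<iota> i) = (\<pi> ^^ T) (\<iota> i)" by (rule funpow_mod_eq[OF n(2)])
  then have "\<chi> (j (F ((\<pi> ^^ (T mod ?n)) (\<iota> i)))) = \<chi> (j (F ((\<pi> ^^ 0) (\<iota> i))))" using per by simp
  then show False using val[of "T mod ?n"] val[of 0] r by simp
qed

text \<open>The sum over \<open>T\<close> iterates runs T/T_i times through the cycle, and
  \<open>\<jmath>\<close> spreads the k-th point over the residues k + T_i l. Together these cover
  each residue modulo \<open>T\<close> equally often, so every barred generator of the block appears
  with multiplicity T/T_i.\<close>

lemma jmath_bar:
  fixes \<pi> :: "'i::finite \<Rightarrow> 'i" and F :: "'i \<Rightarrow> 'g::lie_algebra"
  assumes jm: "\<And>d. d \<in> multidegrees (num_cycles \<pi>) \<Longrightarrow> is_jmath \<pi> \<iota> F T d (j d)"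
    and d: "d \<in> multidegrees (num_cycles \<pi>)" and bij: "bij \<pi>"
    and rep: "cycle_representatives \<pi> \<iota>"
    and \<sigma>: "\<sigma> ^^ T = id" "\<And>i. \<sigma> (F i) = F (\<pi> i)"
  shows "j d (bar T \<sigma> (F a)) \<in> cvec.span (f_bar T ` {1..total_degree (num_cycles \<pi>) d})"
proof -
  have perm: "permutation \<pi>" using bij by (simp add: permutation)
  have pow: "(\<sigma> ^^ k) (F i) = F ((\<pi> ^^ k) i)" for k i by (induction k) (simp_all add: \<sigma>)
  have "orbit \<pi> a \<in> (\<lambda>i. orbit \<pi> (\<iota> i)) ` {1..num_cycles \<pi>}"
    using rep unfolding cycle_representatives_def bij_betw_def by blast
  then obtain i where i: "i \<in> {1..num_cycles \<pi>}" "orbit \<pi> a = orbit \<pi> (\<iota> i)" by blast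
  let ?n = "cycle_length \<pi> \<iota> i" and ?x = "\<iota> i"
  have n: "0 < ?n" "(\<pi> ^^ ?n) ?x = ?x"
    using cycle_length_props[OF bij] by (simp_all add: cycle_length_def)
  have "a \<in> orbit \<pi> ?x" using permutation_self_in_orbit[OF perm, of a] i(2) by simp
  then obtain k0 where a: "a = (\<pi> ^^ k0) ?x" by (auto simp: orbit_altdef)
  have "bar T \<sigma> (F ((\<pi> ^^ k) ?x)) = bar T \<sigma> (F ?x)" for k
  proof (induction k)
    case (Suc k)
    have "F ((\<pi> ^^ Suc k) ?x) = \<sigma> (F ((\<pi> ^^ k) ?x))" by (simp add: \<sigma>)
    then show ?case using bar_shift[of T \<sigma> "F ((\<pi> ^^ k) ?x)"] Suc by (simp add: \<sigma>)
  qed simp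
  then have bar: "bar T \<sigma> (F a) = (\<Sum>k<T. F ((\<pi> ^^ k) ?x))"
    by (simp add: a bar_def pow)
  have hom: "lie_hom_on (subalgebra_generated (range F)) (j d)"
    using jm[OF d] by (simp add: is_jmath_def)
  have "j d (bar T \<sigma> (F a)) = (\<Sum>k<T. j d (F ((\<pi> ^^ k) ?x)))"
    unfolding bar
    by (rule lie_hom_on_sum[OF hom lie_subalgebraD(1)[OF lie_subalgebra_generated]])
      (use subalgebra_generated_base in blast)
  also have "\<dots> = (\<Sum>k<T. \<Sum>l<T div ?n. \<Sum>p=1..d i. f_gen T (idx d i p) (k mod ?n + ?n * l))"
  proof (rule sum.cong)
    fix k
    \<comment> \<open>\<open>is_jmath\<close> gives values for exponents below the cycle length,
      hence the reduction modulo \<open>?n\<close>.\<close>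
    have "k mod ?n < ?n" using n(1) by simp
    then have "j d (F ((\<pi> ^^ (k mod ?n)) ?x)) =
        (\<Sum>l<T div ?n. \<Sum>p=1..d i. f_gen T (idx d i p) (k mod ?n + ?n * l))"
      using jm[OF d] i(1) by (simp add: is_jmath_def)
    then show "j d (F ((\<pi> ^^ k) ?x)) =
        (\<Sum>l<T div ?n. \<Sum>p=1..d i. f_gen T (idx d i p) (k mod ?n + ?n * l))"
      by (simp add: funpow_mod_eq[OF n(2)])
  qed simp
  also have "\<dots> \<in> cvec.span (f_bar T ` {1..total_degree (num_cycles \<pi>) d})"
  proof (cases "?n \<le> T")
    case False
    then show ?thesis by (simp add: cvec.span_zero)
  next
    case True
    \<comment> \<open>Divisibility is read off from the map \<open>\<jmath>\<close> of the unit
      degree at \<open>i\<close>; the given \<open>d\<close> may vanish at \<open>i\<close> and then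
      carries no information on this cycle.\<close>
    let ?e = "\<lambda>x. if x = i then 1 else (0::nat)"
    have "?e \<in> multidegrees (num_cycles \<pi>)" using i(1) by (auto simp: multidegrees_def)
    then have "?n dvd T"
      using cycle_length_dvd[OF jm i(1) bij _ HOL.refl True] pow[of T ?x] \<sigma>(1) by simp
    then obtain q where T: "T = q * ?n" by (metis dvd_mult_div_cancel mult.commute)
    then have q: "T div ?n = q" using n(1) by simp
    have "(\<Sum>k<q * ?n. \<Sum>l<q. \<Sum>p=1..d i. f_gen T (idx d i p) (k mod ?n + ?n * l)) =
        (\<Sum>l'<q. \<Sum>k<?n. \<Sum>l<q. \<Sum>p=1..d i. f_gen T (idx d i p) (k + ?n * l))"
      unfolding sum_lessThan_mult by (intro sum.cong) simp_all
    \<comment> \<open>After the interchange, \<open>k\<close> and \<open>l\<close> merge into the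
      single index \<open>k + ?n * l\<close>, which runs once through all residues.\<close>
    also have "\<dots> = (\<Sum>l'<q. \<Sum>p=1..d i. \<Sum>l<q. \<Sum>k<?n. f_gen T (idx d i p) (k + ?n * l))"
      by (intro sum.cong[OF HOL.refl]) (simp only: sum.swap[of _ "{1..d i}"] sum.swap[of _ "{..<q}" "{..<?n}"])
    also have "\<dots> = (\<Sum>l'<q. \<Sum>p=1..d i. f_bar T (idx d i p))"
      unfolding f_bar_eq sum_lessThan_mult[symmetric] T[symmetric] ..
    also have "\<dots> \<in> cvec.span (f_bar T ` {1..total_degree (num_cycles \<pi>) d})"
      using idx_in_range[OF i(1), of _ d] by (intro cvec.span_sum cvec.span_base) blast
    finally show ?thesis unfolding q using T by simp
  qed
  finally show ?thesis .
qed

section \<open>Vanishing of \<open>\<Omega>\<close>\<close>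

lemma relator_zero:
  assumes "lie_presentation f R" "r \<in> R"
  shows "lie_extend f r = 0"
proof -
  have "r \<in> ideal_generated R" using assms(2) by (auto simp: ideal_generated_def)
  then show ?thesis using assms(1) by (auto simp: lie_presentation_def)
qed

lemma g_presentation_relations:
  fixes hh :: "'h::complex_vector \<Rightarrow> 'g::lie_algebra"
  assumes "g_presentation \<alpha> Hc hh E F"
  shows "hh (x + y) = hh x + hh y" "hh (c *\<^sub>C x) = c *\<^sub>C hh x"
    and "bracket (E i) (F k) = (if i = k then hh (Hc i) else 0)"
    and "bracket (hh x) (E i) = \<alpha> i x *\<^sub>C E i"
    and "bracket (hh x) (F i) = (- \<alpha> i x) *\<^sub>C F i"
    and "bracket (hh x) (hh y) = 0"
proof -
  let ?ev = "lie_extend (case_gsym hh E F)"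
  have hom: "?ev (u + v) = ?ev u + ?ev v" "?ev (u - v) = ?ev u - ?ev v"
    "?ev (bracket u v) = bracket (?ev u) (?ev v)" "?ev (c *\<^sub>C u) = c *\<^sub>C ?ev u" "?ev 0 = 0" for u v c
    using lie_extend_hom[of "case_gsym hh E F"]
    by (simp_all add: lie_hom_on_def clinear_diff[OF lie_hom_clinear] clinear_0[OF lie_hom_clinear])
  note rel = relator_zero[OF assms[unfolded g_presentation_def]]
  note ev = hom lie_extend_gen gsym.case
  have "?ev (free_gen (HSym (x + y)) - (free_gen (HSym x) + free_gen (HSym y))) = 0"
    by (rule rel) (simp add: g_relators_def, blast)
  then show "hh (x + y) = hh x + hh y" by (simp add: ev)
  have "?ev (free_gen (HSym (c *\<^sub>C x)) - c *\<^sub>C free_gen (HSym x)) = 0"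
    by (rule rel) (simp add: g_relators_def, blast)
  then show "hh (c *\<^sub>C x) = c *\<^sub>C hh x" by (simp add: ev)
  have "?ev (bracket (free_gen (ESym i)) (free_gen (FSym k))
      - (if i = k then free_gen (HSym (Hc i)) else 0)) = 0"
    by (rule rel) (simp only: g_relators_def, blast)
  then show "bracket (E i) (F k) = (if i = k then hh (Hc i) else 0)" by (simp add: ev split: if_splits)
  have "?ev (bracket (free_gen (HSym x)) (free_gen (ESym i)) - \<alpha> i x *\<^sub>C free_gen (ESym i)) = 0"
    by (rule rel) (simp only: g_relators_def, blast)
  then show "bracket (hh x) (E i) = \<alpha> i x *\<^sub>C E i" by (simp add: ev)
  have "?ev (bracket (free_gen (HSym x)) (free_gen (FSym i)) + \<alpha> i x *\<^sub>C free_gen (FSym i)) = 0"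
    by (rule rel) (simp only: g_relators_def, blast)
  then show "bracket (hh x) (F i) = (- \<alpha> i x) *\<^sub>C F i"
    by (simp add: ev eq_neg_iff_add_eq_0 cvec.scale_minus_left)
  have "?ev (bracket (free_gen (HSym x)) (free_gen (HSym y))) = 0"
    by (rule rel) (simp only: g_relators_def, blast)
  then show "bracket (hh x) (hh y) = 0" by (simp add: ev)
qed

text \<open>The value 0 outside the range of cycle numbers is what \<open>multidegrees\<close>
  demands; degrees are compared there as functions on all natural numbers.\<close>

definition comm_degree :: "('i \<Rightarrow> 'i) \<Rightarrow> (nat \<Rightarrow> 'i) \<Rightarrow> 'i commutator \<Rightarrow> nat \<Rightarrow> nat" where
  "comm_degree \<pi> \<iota> c i =
     (if i \<in> {1..num_cycles \<pi>} then length (filter (\<lambda>l. l \<in> orbit \<pi> (\<iota> i)) (letters c)) else 0)"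

lemma comm_degree_in_multidegrees:
  fixes \<pi> :: "'i::finite \<Rightarrow> 'i"
  assumes "bij \<pi>" "cycle_representatives \<pi> \<iota>"
  shows "comm_degree \<pi> \<iota> c \<in> multidegrees (num_cycles \<pi>)"
proof -
  have "letters c \<noteq> []" by (induction c) simp_all
  then obtain l where l: "l \<in> set (letters c)" by (meson last_in_set)
  have "orbit \<pi> l \<in> (\<lambda>i. orbit \<pi> (\<iota> i)) ` {1..num_cycles \<pi>}"
    using assms(2) unfolding cycle_representatives_def bij_betw_def by blast
  then obtain i where i: "i \<in> {1..num_cycles \<pi>}" "orbit \<pi> l = orbit \<pi> (\<iota> i)" by blast
  have "l \<in> orbit \<pi> (\<iota> i)"
    using permutation_self_in_orbit[of \<pi> l] assms(1) i(2) by (simp add: permutation)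
  then have "filter (\<lambda>l. l \<in> orbit \<pi> (\<iota> i)) (letters c) \<noteq> []"
    using l by (auto simp: filter_empty_conv)
  then have "comm_degree \<pi> \<iota> c i \<noteq> 0" using i(1) by (simp add: comm_degree_def)
  moreover have "comm_degree \<pi> \<iota> c i = 0" if "i \<notin> {1..num_cycles \<pi>}" for i
    using that unfolding comm_degree_def by (rule if_not_P)
  ultimately show ?thesis unfolding multidegrees_def by blast
qed

text \<open>Iterates of \<open>\<sigma>\<close> move a letter only within its orbit, and the degree
  counts letters by orbit.\<close>

lemma comm_bar_in_n_component:
  fixes \<pi> :: "'i::finite \<Rightarrow> 'i" and X :: "'i \<Rightarrow> 'g::lie_algebra"
  assumes "bij \<pi>" "\<And>i. \<sigma> (X i) = X (\<pi> i)"
  shows "comm_eval (\<lambda>i. bar T \<sigma> (X i)) c \<in> n_component \<pi> \<iota> X (comm_degree \<pi> \<iota> c)"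
proof -
  have perm: "permutation \<pi>" using assms(1) by (simp add: permutation)
  have self: "l \<in> orbit \<pi> l" for l by (rule permutation_self_in_orbit[OF perm])
  have "(\<sigma> ^^ k) (X i) = X ((\<pi> ^^ k) i)" for k i by (induction k) (simp_all add: assms(2))
  then have "bar T \<sigma> (X i) \<in> cvec.span (X ` orbit \<pi> i)" for i
    unfolding bar_def by (intro cvec.span_sum cvec.span_base) (simp add: funpow_in_orbit[OF self])
  then have "comm_eval (\<lambda>i. bar T \<sigma> (X i)) c \<in> cvec.span {comm_eval X c' | c'.
      list_all2 (\<lambda>l' l. l' \<in> orbit \<pi> l) (letters c') (letters c)}"
    by (intro comm_eval_span)
  also have "\<dots> \<subseteq> n_component \<pi> \<iota> X (comm_degree \<pi> \<iota> c)"
    unfolding n_component_def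
  proof (intro cvec.span_mono Collect_mono, clarify)
    fix c' assume "list_all2 (\<lambda>l' l. l' \<in> orbit \<pi> l) (letters c') (letters c)"
    then have "length (filter (\<lambda>l. l \<in> orbit \<pi> x) (letters c')) =
        length (filter (\<lambda>l. l \<in> orbit \<pi> x) (letters c))" for x
    proof (induction rule: list_all2_induct)
      case (Cons l' ls' l ls)
      have "l \<in> orbit \<pi> l'" using orbit_swap[OF self Cons(1)] .
      then have "l' \<in> orbit \<pi> x \<longleftrightarrow> l \<in> orbit \<pi> x" using Cons(1) orbit_trans by metis
      then show ?case using Cons by simp
    qed simp
    then show "\<exists>c''. comm_eval X c' = comm_eval X c'' \<and> (\<forall>i\<in>{1..num_cycles \<pi>}.
        length (filter (\<lambda>l. l \<in> orbit \<pi> (\<iota> i)) (letters c'')) = comm_degree \<pi> \<iota> c i)"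
      by (intro exI[of _ c']) (simp add: comm_degree_def)
  qed
  finally show ?thesis .
qed

text \<open>Bilinearity is available only on \<open>G\<close>, so the annihilators are formed as
  subspaces inside \<open>G\<close>.\<close>

lemma bilinear_vanish_span:
  fixes \<Omega> :: "'g::complex_vector \<Rightarrow> 'g \<Rightarrow> complex"
  assumes G: "cvec.subspace G" "S \<subseteq> G"
    and add: "\<And>x y z. x \<in> G \<Longrightarrow> y \<in> G \<Longrightarrow> z \<in> G \<Longrightarrow>
      \<Omega> (x + y) z = \<Omega> x z + \<Omega> y z \<and> \<Omega> x (y + z) = \<Omega> x y + \<Omega> x z"
    and scale: "\<And>c x y. x \<in> G \<Longrightarrow> y \<in> G \<Longrightarrow> \<Omega> (c *\<^sub>C x) y = c * \<Omega> x y \<and> \<Omega> x (c *\<^sub>C y) = c * \<Omega> x y"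
    and zero: "\<And>x y. x \<in> S \<Longrightarrow> y \<in> S \<Longrightarrow> \<Omega> x y = 0"
    and xy: "x \<in> cvec.span S" "y \<in> cvec.span S"
  shows "\<Omega> x y = 0"
proof -
  have 0: "\<Omega> 0 z = 0" "\<Omega> z 0 = 0" if "z \<in> G" for z
    using scale[of 0 z 0] scale[of z 0 0] that cvec.subspace_0[OF G(1)] by simp_all
  have right: "y \<in> {y \<in> G. \<Omega> s y = 0}" if s: "s \<in> S" and "y \<in> cvec.span S" for s y
  proof (rule subsetD[OF cvec.span_minimal \<open>y \<in> cvec.span S\<close>])
    have sG: "s \<in> G" using s G(2) by blast
    show "S \<subseteq> {y \<in> G. \<Omega> s y = 0}" using zero s G(2) by blast
    show "cvec.subspace {y \<in> G. \<Omega> s y = 0}"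
      by (rule cvec.subspaceI) (simp_all add: 0 sG add scale cvec.subspace_0[OF G(1)]
          cvec.subspace_add[OF G(1)] cvec.subspace_scale[OF G(1)])
  qed
  have yG: "y \<in> G" using xy(2) cvec.span_minimal[OF G(2,1)] by blast
  have "x \<in> {x \<in> G. \<Omega> x y = 0}"
  proof (rule subsetD[OF cvec.span_minimal xy(1)])
    show "S \<subseteq> {x \<in> G. \<Omega> x y = 0}" using right[OF _ xy(2)] G(2) by blast
    show "cvec.subspace {x \<in> G. \<Omega> x y = 0}"
      by (rule cvec.subspaceI) (simp_all add: 0 yG add scale cvec.subspace_0[OF G(1)]
          cvec.subspace_add[OF G(1)] cvec.subspace_scale[OF G(1)])
  qed
  then show ?thesis by simp
qed

text \<open>\<open>\<phi>\<close> commutes with barring on generators and reverses brackets, each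
  reversal costing a sign. The scalar is kept inside \<open>\<phi>\<close> because
  \<open>\<Omega>\<close> is prescribed on elements of the form \<open>\<phi> x\<close>.\<close>

lemma chevalley_comm_bar:
  assumes "chevalley_anti_automorphism hh E F \<phi>"
    and "\<And>i. \<sigma> (E i) = E (\<pi> i)" "\<And>i. \<sigma> (F i) = F (\<pi> i)"
  shows "\<exists>\<epsilon>. comm_eval (\<lambda>i. bar T \<sigma> (E i)) c = \<phi> (\<epsilon> *\<^sub>C comm_eval (\<lambda>i. bar T \<sigma> (F i)) c)"
proof (induction c)
  have lin: "clinear \<phi>" and anti: "\<And>x y. \<phi> (bracket x y) = bracket (\<phi> y) (\<phi> x)"
    and FE: "\<And>i. \<phi> (F i) = E i"
    using assms(1) by (auto simp: chevalley_anti_automorphism_def)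
  {
    case (Leaf i)
    have "(\<sigma> ^^ k) (E i) = E ((\<pi> ^^ k) i)" "(\<sigma> ^^ k) (F i) = F ((\<pi> ^^ k) i)" for k
      by (induction k) (simp_all add: assms(2,3))
    then have "\<phi> (bar T \<sigma> (F i)) = bar T \<sigma> (E i)"
      by (simp add: bar_def clinear_sum[OF lin] FE)
    then show ?case by (intro exI[of _ 1]) simp
  next
    case (Comm a b)
    then obtain \<epsilon> \<delta> where
      "comm_eval (\<lambda>i. bar T \<sigma> (E i)) a = \<epsilon> *\<^sub>C \<phi> (comm_eval (\<lambda>i. bar T \<sigma> (F i)) a)"
      "comm_eval (\<lambda>i. bar T \<sigma> (E i)) b = \<delta> *\<^sub>C \<phi> (comm_eval (\<lambda>i. bar T \<sigma> (F i)) b)"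
      by (auto simp: clinear_scale[OF lin])
    then have "comm_eval (\<lambda>i. bar T \<sigma> (E i)) (Comm a b) =
        \<phi> ((- (\<epsilon> * \<delta>)) *\<^sub>C comm_eval (\<lambda>i. bar T \<sigma> (F i)) (Comm a b))"
      by (simp add: clinear_neg[OF lin] clinear_scale[OF lin] anti bracket_scale_left bracket_scale_right
          scaleC_scaleC cvec.scale_minus_left mult.commute
          bracket_skew[of "\<phi> (comm_eval (\<lambda>i. bar T \<sigma> (F i)) b)" "\<phi> (comm_eval (\<lambda>i. bar T \<sigma> (F i)) a)"])
    then show ?case by blast
  }
qed

theorem corollary8p5:
  fixes B :: "'h::complex_vector \<Rightarrow> 'h \<Rightarrow> complex"
    and \<alpha> :: "'i::finite \<Rightarrow> 'h \<Rightarrow> complex"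
    and Hc :: "'i \<Rightarrow> 'h"
    and hh :: "'h \<Rightarrow> 'g::lie_algebra"
    and E F :: "'i \<Rightarrow> 'g"
    and \<phi> \<sigma> :: "'g \<Rightarrow> 'g"
    and \<pi> :: "'i \<Rightarrow> 'i"
    and T :: nat
    and \<omega> :: complex
    and \<iota> :: "nat \<Rightarrow> 'i"
    and j :: "(nat \<Rightarrow> nat) \<Rightarrow> 'g \<Rightarrow> (nat \<times> nat) free_lie"
    and \<psi> :: "nat \<Rightarrow> nat \<Rightarrow>
      (((nat \<times> nat) free_lie list \<times> (nat \<times> nat) free_lie list) \<Rightarrow>\<^sub>0 complex) \<Rightarrow>
      (point set list \<Rightarrow>\<^sub>0 complex)"
    and \<Omega> :: "'g \<Rightarrow> 'g \<Rightarrow> complex"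
  assumes "cartan_data B \<alpha> Hc"
    and "g_presentation \<alpha> Hc hh E F"
    and "chevalley_anti_automorphism hh E F \<phi>"
    and "diagram_automorphism B Hc hh E F T \<sigma> \<pi>"
    and "primitive_root T \<omega>"
    and "cycle_representatives \<pi> \<iota>"
    and "\<forall>d\<in>multidegrees (num_cycles \<pi>). is_jmath \<pi> \<iota> F T d (j d)"
    and "\<forall>m\<ge>1. is_psi T \<omega> m (\<psi> m)"
    and "is_Omega B \<alpha> hh E F \<phi> T \<omega> \<sigma> \<pi> \<iota> j \<psi> \<Omega>"
    and "g_B\<sigma> hh E F T \<sigma> = fixed_points \<sigma>"
  shows "\<forall>x\<in>fixed_points \<sigma>. \<forall>y\<in>fixed_points \<sigma>. \<Omega> x y = 0"
proof -
  let ?f = "\<lambda>i. bar T \<sigma> (F i)" and ?e = "\<lambda>i. bar T \<sigma> (E i)"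
  let ?h = "h_fixed hh \<sigma>" and ?G = "fixed_points \<sigma>" and ?dg = "comm_degree \<pi> \<iota>"
  let ?r = "num_cycles \<pi>"
  note rel = g_presentation_relations[OF assms(2)]
  have \<sigma>: "\<sigma> ^^ T = id" "\<And>i. \<sigma> (E i) = E (\<pi> i)" "\<And>i. \<sigma> (F i) = F (\<pi> i)"
    and T: "0 < T" and bij: "bij \<pi>" and \<sigma>hom: "lie_hom_on UNIV \<sigma>"
    using assms(4) by (auto simp: diagram_automorphism_def lie_automorphism_def)
  have \<sigma>lin: "clinear \<sigma>" by (rule lie_hom_clinear[OF \<sigma>hom])
  have \<sigma>br: "\<sigma> (bracket x y) = bracket (\<sigma> x) (\<sigma> y)" for x y
    using \<sigma>hom by (simp add: lie_hom_on_def)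
  have G: "cvec.subspace ?G"
    by (rule cvec.subspaceI)
      (simp_all add: fixed_points_def clinear_0[OF \<sigma>lin] clinear_add[OF \<sigma>lin] clinear_scale[OF \<sigma>lin])
  have Gs: "lie_subalgebra ?G"
    using G by (simp add: lie_subalgebra_def fixed_points_def \<sigma>br)
  have barG: "bar T \<sigma> x \<in> ?G" for x
    unfolding fixed_points_def by (simp add: bar_fixed[OF _ \<sigma>lin] \<sigma>(1))
  have hh: "clinear hh" by (rule clinearI) (rule rel)+
  have hhsub: "cvec.subspace (range hh)"
    by (rule cvec.subspaceI)
      (auto simp: clinear_add[OF hh, symmetric] clinear_scale[OF hh, symmetric]
        intro: range_eqI[of _ _ 0] clinear_0[OF hh, symmetric])
  have hsub: "cvec.subspace ?h" unfolding h_fixed_def by (rule cvec.subspace_inter[OF hhsub G])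
  \<comment> \<open>As \<open>x\<close> is fixed by \<open>\<sigma>\<close>, it has the same
    eigenvalue on all iterates of \<open>X i\<close>, hence also on their sum.\<close>
  have wt: "\<exists>c. bracket x (bar T \<sigma> (X i)) = c *\<^sub>C bar T \<sigma> (X i)"
    if x: "x \<in> ?h" and X: "\<And>y i. \<exists>c. bracket (hh y) (X i) = c *\<^sub>C X i" for x i and X :: "'i \<Rightarrow> 'g"
  proof -
    obtain y where y: "x = hh y" "\<sigma> x = x" using x by (auto simp: h_fixed_def fixed_points_def)
    obtain c where c: "bracket x (X i) = c *\<^sub>C X i" using X y(1) by blast
    have "bracket x ((\<sigma> ^^ k) (X i)) = c *\<^sub>C (\<sigma> ^^ k) (X i)" for k
    proof (induction k)
      case (Suc k)
      have "bracket x ((\<sigma> ^^ Suc k) (X i)) = \<sigma> (bracket x ((\<sigma> ^^ k) (X i)))"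
        by (simp add: \<sigma>br y(2))
      then show ?case by (simp add: Suc clinear_scale[OF \<sigma>lin])
    qed (simp add: c)
    then show ?thesis by (intro exI[of _ c]) (simp add: bar_def bracket_sum_right cvec.scale_sum_right)
  qed
  have powE: "(\<sigma> ^^ k) (E i) = E ((\<pi> ^^ k) i)" and powF: "(\<sigma> ^^ k) (F i) = F ((\<pi> ^^ k) i)" for k i
    by (induction k) (simp_all add: \<sigma>)
  \<comment> \<open>Expanding both bars leaves a sum of elements of \<open>range hh\<close>, and it
    is fixed because both factors are.\<close>
  have ef: "bracket (?e i) (?f k) \<in> ?h" for i k
    unfolding h_fixed_def
  proof
    have "bracket (E a) (F b) \<in> range hh" for a b
      by (simp add: rel(3) cvec.subspace_0[OF hhsub])
    then show "bracket (?e i) (?f k) \<in> range hh"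
      unfolding bar_def powE powF bracket_sum_left bracket_sum_right
      by (intro cvec.subspace_sum[OF hhsub])
    show "bracket (?e i) (?f k) \<in> ?G" by (rule lie_subalgebraD(2)[OF Gs barG barG])
  qed
  let ?S = "?h \<union> range (comm_eval ?e) \<union> range (comm_eval ?f)"
  have span: "?G \<subseteq> cvec.span ?S"
    unfolding assms(10)[symmetric] g_B\<sigma>_def
  proof (rule triangular_span[OF hsub _ _ _ ef])
    show "bracket x y = 0" if "x \<in> ?h" "y \<in> ?h" for x y
      using that rel(6) by (auto simp: h_fixed_def)
    show "\<exists>c. bracket x (?e i) = c *\<^sub>C ?e i" if "x \<in> ?h" for x i
      by (rule wt[OF that]) (use rel(4) in blast)
    show "\<exists>c. bracket x (?f i) = c *\<^sub>C ?f i" if "x \<in> ?h" for x i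
      by (rule wt[OF that]) (use rel(5) in blast)
  qed
  have commG: "comm_eval ?e c \<in> ?G" "comm_eval ?f c \<in> ?G" for c
    by (intro comm_eval_in_subalgebra[OF Gs] barG)+
  have D: "?dg c \<in> multidegrees ?r" for c
    by (rule comm_degree_in_multidegrees[OF bij assms(6)])
  let ?nm = "n_fixed_component \<pi> \<iota> \<sigma> F" and ?np = "n_fixed_component \<pi> \<iota> \<sigma> E"
  have nm: "comm_eval ?f c \<in> ?nm (?dg c)" and np: "comm_eval ?e c \<in> ?np (?dg c)" for c
    using comm_bar_in_n_component[where X = F, OF bij \<sigma>(3)]
      comm_bar_in_n_component[where X = E, OF bij \<sigma>(2)] commG
    by (auto simp: n_fixed_component_def)
  note Om = assms(9)[unfolded is_Omega_def Let_def]
  note add = Om[THEN conjunct1]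
    and scale = Om[THEN conjunct2, THEN conjunct1]
    and skew = Om[THEN conjunct2, THEN conjunct2, THEN conjunct1]
    and val = Om[THEN conjunct2, THEN conjunct2, THEN conjunct2, THEN conjunct1]
    and off = Om[THEN conjunct2, THEN conjunct2, THEN conjunct2, THEN conjunct2, THEN conjunct1]
    and same = Om[THEN conjunct2, THEN conjunct2, THEN conjunct2, THEN conjunct2, THEN conjunct2, THEN conjunct1]
    and hn = Om[THEN conjunct2, THEN conjunct2, THEN conjunct2, THEN conjunct2, THEN conjunct2, THEN conjunct2, THEN conjunct1]
    and hz = Om[THEN conjunct2, THEN conjunct2, THEN conjunct2, THEN conjunct2, THEN conjunct2, THEN conjunct2, THEN conjunct2]
  \<comment> \<open>The scalar anticipates writing a commutator in the barred \<open>E\<close> as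
    \<open>\<phi>\<close> of a multiple of one in the barred \<open>F\<close>; \<open>y\<close>
    stays arbitrary.\<close>
  have omega_0: "omega_value B \<alpha> \<pi> \<iota> T \<omega> j \<psi> d (\<epsilon> *\<^sub>C comm_eval ?f c) y = 0"
    if d: "d \<in> multidegrees ?r" for d \<epsilon> c y
  proof -
    let ?m = "total_degree ?r d"
    have "0 < ?m"
      using d by (auto simp: multidegrees_def total_degree_def intro!: sum_pos2)
    interpret psi_map T \<omega> ?m "\<psi> ?m"
    proof
      show "is_psi T \<omega> ?m (\<psi> ?m)" using assms(8) \<open>0 < ?m\<close> by simp
      show "\<omega> \<noteq> 0" using assms(5) by (auto simp: primitive_root_def zero_power)
    qed (rule T \<open>0 < ?m\<close>)+
    have jm: "\<And>d. d \<in> multidegrees ?r \<Longrightarrow> is_jmath \<pi> \<iota> F T d (j d)" using assms(7) by blast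
    have hom: "lie_hom_on (subalgebra_generated (range F)) (j d)"
      using jm[OF d] by (simp add: is_jmath_def)
    let ?N = "subalgebra_generated (range F)"
    note N = lie_subalgebra_generated[of "range F"]
    have FN: "?f i \<in> ?N" for i
      unfolding bar_def powF using subalgebra_generated_base[of "range F"]
      by (intro cvec.subspace_sum[OF lie_subalgebraD(1)[OF N]]) auto
    have "j d (comm_eval ?f c) = comm_eval (\<lambda>i. j d (?f i)) c"
      by (rule lie_hom_on_comm_eval[OF hom N FN])
    also have "\<dots> \<in> cvec.span {comm_eval (f_bar T) c' | c'.
        list_all2 (\<lambda>l' l. l' \<in> {1..?m}) (letters c') (letters c)}"
      by (rule comm_eval_span) (rule jmath_bar[OF jm d bij assms(6) \<sigma>(1,3)])
    also have "\<dots> \<subseteq> cvec.span {comm_eval (f_bar T) c' | c'. set (letters c') \<subseteq> {1..?m}}"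
    proof (intro cvec.span_mono Collect_mono, clarify)
      fix c' assume "list_all2 (\<lambda>l' l. l' \<in> {1..?m}) (letters c') (letters c)"
      then have "set (letters c') \<subseteq> {1..?m}" by (induction rule: list_all2_induct) auto
      then show "\<exists>c''. comm_eval (f_bar T) c' = comm_eval (f_bar T) c'' \<and> set (letters c'') \<subseteq> {1..?m}"
        by blast
    qed
    finally have "\<epsilon> *\<^sub>C j d (comm_eval ?f c)
        \<in> cvec.span {comm_eval (f_bar T) c' | c'. set (letters c') \<subseteq> {1..?m}}"
      by (rule cvec.span_scale)
    moreover have "j d (\<epsilon> *\<^sub>C comm_eval ?f c) = \<epsilon> *\<^sub>C j d (comm_eval ?f c)"
    proof -
      have "comm_eval ?f c \<in> ?N" by (rule comm_eval_in_subalgebra[OF N FN])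
      then show ?thesis using hom unfolding lie_hom_on_def by blast
    qed
    ultimately have "a_projection T ?m (j d (\<epsilon> *\<^sub>C comm_eval ?f c)) \<in>
        cvec.span {comm_eval (f_bar T) c' | c'. mset (letters c') = mset [1..<Suc ?m]}"
      by (simp only: a_projection_comm_f_bar)
    then show ?thesis
      unfolding omega_value_def Let_def by (subst G_form_multilinear_span) simp_all
  qed
  have pm: "\<Omega> (comm_eval ?e c) (comm_eval ?f c') = 0" for c c'
  proof (cases "?dg c = ?dg c'")
    case False
    then show ?thesis using off D np nm by blast
  next
    case True
    \<comment> \<open>For equal degrees \<open>\<Omega>\<close> is prescribed only through
      \<open>\<phi> x\<close> with \<open>x\<close> in the fixed component of \<open>\<nn>\<close>,
      so the commutator in the barred \<open>E\<close> is first brought into that form.\<close>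
    obtain \<epsilon> where \<epsilon>: "comm_eval ?e c = \<phi> (\<epsilon> *\<^sub>C comm_eval ?f c)"
      using chevalley_comm_bar[OF assms(3) \<sigma>(2,3)] by blast
    have "cvec.subspace (?nm (?dg c))"
      unfolding n_fixed_component_def n_component_def
      by (intro cvec.subspace_inter cvec.subspace_span G)
    then have "\<epsilon> *\<^sub>C comm_eval ?f c \<in> ?nm (?dg c)" using nm by (rule cvec.subspace_scale)
    then show ?thesis
      using val D[of c] nm[of c'] omega_0[OF D[of c]] unfolding \<epsilon> True by metis
  qed
  have mp: "\<Omega> (comm_eval ?f c') (comm_eval ?e c) = 0" for c c'
    using skew[rule_format, OF commG(1)[of c] commG(2)[of c']] pm[of c c'] by simp
  have hx: "\<Omega> x (comm_eval ?f c) = 0" "\<Omega> x (comm_eval ?e c) = 0"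
    "\<Omega> (comm_eval ?f c) x = 0" "\<Omega> (comm_eval ?e c) x = 0" if "x \<in> ?h" for x c
    using hn D[of c] nm[of c] np[of c] that by blast+
  have ff: "\<Omega> (comm_eval ?f c) (comm_eval ?f c') = 0" "\<Omega> (comm_eval ?e c) (comm_eval ?e c') = 0" for c c'
    using same D[of c] D[of c'] nm[of c] nm[of c'] np[of c] np[of c'] by blast+
  have zero: "\<Omega> x y = 0" if "x \<in> ?S" "y \<in> ?S" for x y
    using that hz by (elim UnE rangeE) (simp_all add: hx ff pm mp)
  have SG: "?S \<subseteq> ?G" using commG by (auto simp: h_fixed_def)
  show ?thesis
  proof (intro ballI)
    fix x y assume "x \<in> ?G" "y \<in> ?G"
    then show "\<Omega> x y = 0"
      using span by (intro bilinear_vanish_span[OF G SG _ _ zero]) (use add scale in blast)+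
  qed
qed

end
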